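(* Let $X$ be a real Lévy process which is not a compound Poisson process and such that $|X|$ is not a subordinator. Assume that for every $t>0$ the law of $X_t$ under $\mathbb{P}$ is absolutely continuous on $[0,\infty)$, with density $p_t(x)$, and that the Lévy measure of $X$ is absolutely continuous on $(0,\infty)$, with density $\nu(x)$. Let $f_t(x)$ be the density on $(0,\infty)$ of the law of $\overline X_t=\sup_{s\le t}X_s$ under $\mathbb{P}$. Consider the conditions: (M) for every $r>0$ there exists $c(r)>0$ such that $\nu(y)\le c(r)\nu(x)$ for every $y>x>r$; (D) for every $r>0$ there exists $c(r)>0$ such that $\nu(x)\le c(r)\nu(2x)$ for every $x>r$. 1. Assume (M). If for every $x_0,t_0>0$ there exists $c=c(x_0,t_0)>0$ such that $p_t(x)\ge c\,t\nu(x)$ for all $0<t<t_0$, $x>x_0$, then for every $x_0,t_0>0$ there exists $c=c(x_0,t_0)>0$ such that $f_t(x)\ge c\,t\nu(x)$ for all $0<t<t_0$, $x>x_0$. 2. Assume (M) and (D). If for every $x_0,t_0>0$ there exists $c=c(x_0,t_0)>0$ such that $p_t(x)\le c\,t\nu(x)$ for all $0<t<t_0$, $x>x_0$, then for every $x_0,t_0>0$ there exists $c=c(x_0,t_0)>0$ such that $f_t(x)\le c\,t\nu(x)$ for all $0<t<t_0$, $x>x_0$. 3. In particular, assume (M) and (D). If for every $x_0,t_0>0$ there exists $c=c(x_0,t_0)>0$ such that $c^{-1}t\nu(x)\le p_t(x)\le c\,t\nu(x)$ for all $0<t<t_0$, $x>x_0$, then for every $x_0,t_0>0$ there exists $c=c(x_0,t_0)>0$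 such that, for all $0<t<t_0$ and $x>x_0$, $$c^{-1}p_t(x)\le f_t(x)\le c\,p_t(x)\quad\text{and}\quad c^{-1}t\nu(x)\le p_t(x)\le c\,t\nu(x).$$
   Context: Under $\mathbb{P}$ the process $X$ is a càdlàg real Lévy process started at $0$. It is known that, under the stated absolute continuity of the laws of $X_t$ on $[0,\infty)$, the law of $\overline X_t$ is absolutely continuous on $(0,\infty)$ (it may have an atom at $0$). Convention: $p_t$ and $f_t$ are defined up to Lebesgue-null sets of $x$; inequalities involving them are understood for Lebesgue-almost every $x$ in the indicated range. *)

theory Defs
  imports "HOL-Probability.Probability"
begin

definition cadlag :: "(real \<Rightarrow> real) \<Rightarrow> bool" where
  "cadlag w \<longleftrightarrow>
     (\<forall>t\<ge>0. continuous (at_right t) w) \<and> (\<forall>t>0. \<exists>l. (w \<longlongrightarrow> l) (at_left t))"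

text \<open>Time is \<open>[0,\<infinity>)\<close>; the values of \<open>X t\<close> for negative \<open>t\<close> are irrelevant.\<close>

locale levy_process = prob_space M for M :: "'a measure" +
  fixes X :: "real \<Rightarrow> 'a \<Rightarrow> real"
  assumes random_variable_X: "\<And>t. t \<ge> 0 \<Longrightarrow> random_variable borel (X t)"
    and start_at_zero: "AE \<omega> in M. X 0 \<omega> = 0"
    and cadlag_paths: "\<And>\<omega>. \<omega> \<in> space M \<Longrightarrow> cadlag (\<lambda>t. X t \<omega>)"
    and independent_increments:
      "\<And>(n::nat) (\<tau> :: nat \<Rightarrow> real). 0 \<le> \<tau> 0 \<Longrightarrow> (\<And>i. i < n \<Longrightarrow> \<tau> i \<le> \<tau> (Suc i)) \<Longrightarrow>
         indep_vars (\<lambda>_. borel) (\<lambda>i \<omega>. X (\<tau> (Suc i)) \<omega> - X (\<tau> i) \<omega>) {..<n}"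
    and stationary_increments:
      "\<And>s t. 0 \<le> s \<Longrightarrow> 0 \<le> t \<Longrightarrow>
         distr M borel (\<lambda>\<omega>. X (s + t) \<omega> - X s \<omega>) = distr M borel (X t)"

text \<open>The Levy measure is the jump measure in the Levy-Khintchine formula, which
  determines it uniquely. The cutoff \<open>indicator {-1<..<1}\<close> only affects the drift \<open>a\<close>.\<close>

definition is_levy_measure :: "'a measure \<Rightarrow> (real \<Rightarrow> 'a \<Rightarrow> real) \<Rightarrow> real measure \<Rightarrow> bool" where
  "is_levy_measure M X \<Lambda> \<longleftrightarrow>
     sets \<Lambda> = sets borel \<and> emeasure \<Lambda> {0} = 0 \<and>
     (\<integral>\<^sup>+x. ennreal (min 1 (x\<^sup>2)) \<partial>\<Lambda>) < \<infinity> \<and>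
     (\<exists>(a::real) (\<sigma>::real). \<forall>t\<ge>0. \<forall>u::real.
        char (distr M borel (X t)) u =
        exp (of_real t *
          (\<i> * of_real (a * u) - of_real (\<sigma>\<^sup>2 * u\<^sup>2 / 2) +
           (CLINT x|\<Lambda>. iexp (u * x) - 1 - \<i> * of_real (u * x * indicator {-1<..<1} x)))))"

text \<open>A compound Poisson process is a Levy process whose marginals are compound Poisson
  distributions, with rate \<open>r\<close> and jump law \<open>\<mu>\<close> not charging 0.\<close>

definition compound_poisson_process :: "'a measure \<Rightarrow> (real \<Rightarrow> 'a \<Rightarrow> real) \<Rightarrow> bool" where
  "compound_poisson_process M X \<longleftrightarrow> levy_process M X \<and>
     (\<exists>(r::real) (\<mu>::real measure).
        r > 0 \<and> prob_space \<mu> \<and> sets \<mu> = sets borel \<and> emeasure \<mu> {0} = 0 \<and>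
        (\<forall>t\<ge>0. \<forall>u. char (distr M borel (X t)) u = exp (of_real (t * r) * (char \<mu> u - 1))))"

definition subordinator :: "'a measure \<Rightarrow> (real \<Rightarrow> 'a \<Rightarrow> real) \<Rightarrow> bool" where
  "subordinator M Y \<longleftrightarrow> levy_process M Y \<and> (AE \<omega> in M. mono_on {0..} (\<lambda>t. Y t \<omega>))"

text \<open>For cadlag paths the supremum is over a bounded set, hence a genuine one.\<close>

definition running_sup :: "(real \<Rightarrow> 'a \<Rightarrow> real) \<Rightarrow> real \<Rightarrow> 'a \<Rightarrow> real" where
  "running_sup X t \<omega> = (SUP s\<in>{0..t}. X s \<omega>)"

text \<open>\<open>\<mu>\<close> restricted to \<open>S\<close> is absolutely continuous with density \<open>g\<close>; nothing is said
  about \<open>\<mu>\<close> or \<open>g\<close> outside \<open>S\<close>.\<close>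

definition has_density_on :: "real measure \<Rightarrow> real set \<Rightarrow> (real \<Rightarrow> real) \<Rightarrow> bool" where
  "has_density_on \<mu> S g \<longleftrightarrow>
     set_borel_measurable borel S g \<and> (\<forall>x\<in>S. 0 \<le> g x) \<and>
     (\<forall>B\<in>sets borel. B \<subseteq> S \<longrightarrow> emeasure \<mu> B = (\<integral>\<^sup>+x\<in>B. ennreal (g x) \<partial>lborel))"

definition cond_M :: "(real \<Rightarrow> real) \<Rightarrow> bool" where
  "cond_M \<nu> \<longleftrightarrow> (\<forall>r>0. \<exists>c>0. \<forall>x y. r < x \<and> x < y \<longrightarrow> \<nu> y \<le> c * \<nu> x)"

definition cond_D :: "(real \<Rightarrow> real) \<Rightarrow> bool" where
  "cond_D \<nu> \<longleftrightarrow> (\<forall>r>0. \<exists>c>0. \<forall>x. r < x \<longrightarrow> \<nu> x \<le> c * \<nu> (2 * x))"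

text \<open>Uniform estimates: for all \<open>x\<^sub>0, t\<^sub>0 > 0\<close> there is \<open>c > 0\<close> such that \<open>R c t x\<close>
  for all \<open>0 < t < t\<^sub>0\<close> and, since densities are defined up to null sets,
  for almost all \<open>x > x\<^sub>0\<close>.\<close>

definition unif_est :: "(real \<Rightarrow> real \<Rightarrow> real \<Rightarrow> bool) \<Rightarrow> bool" where
  "unif_est R \<longleftrightarrow>
     (\<forall>x\<^sub>0>0. \<forall>t\<^sub>0>0. \<exists>c>0. \<forall>t. 0 < t \<and> t < t\<^sub>0 \<longrightarrow> (AE x in lborel. x > x\<^sub>0 \<longrightarrow> R c t x))"

end

theory Submission
  imports Defs
begin

text \<open>
  The process is sampled on the grid \<open>0, h, \<dots>, n h = t\<close> and its maximum is studied there as the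
  maximum of a random walk. Let \<open>a\<^sub>k\<close> be the law of the walk at time \<open>k\<close> on the event
  that it stays positive up to \<open>k\<close>, \<open>b\<^sub>l\<close> the probability that it stays nonpositive up to
  \<open>l\<close>, and \<open>p\<^sub>j\<close> the law of its \<open>j\<close>-th position. Splitting at the first maximum, and reversing
  time before it, gives \<open>\<Sum>k\<le>n. b\<^sub>n\<^sub>-\<^sub>k a\<^sub>k\<close> as the law of the maximum.

  Lower bound: Spitzer's identity \<open>k a\<^sub>k = \<Sum>j=1..k. p\<^sub>j\<^sup>+ * a\<^sub>k\<^sub>-\<^sub>j\<close> turns a lower bound
  \<open>j h \<kappa>\<close> for \<open>p\<^sub>j\<close> into a lower bound for the law of the maximum, up to the probability that the
  maximum over a short initial time is small.

  Upper bound on \<open>(r, \<infinity>)\<close>: stop the positive walk when it first exceeds \<open>r / 2\<close>. Either it lands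
  below \<open>3 r / 4\<close>, and the remaining displacement is at least \<open>r / 4\<close>, or the single step of the
  overshoot is at least \<open>r / 4\<close>; in both cases the upper bound on \<open>p\<^sub>j\<close> applies.

  All constants are uniform in the mesh, and the grid maxima increase to the supremum.
\<close>

section \<open>Preliminaries\<close>

text \<open>The obstacle is uniformity in the mesh, so the proof works without asymptotics for the
  separate masses of \<open>pos_law k\<close> and \<open>nonpos_law l\<close>. It uses that the
  products of the masses of \<open>pos_law i\<close> and \<open>nonpos_law (q - i)\<close> sum to 1
  over \<open>i \<le> q\<close>, for every \<open>q\<close>. Each estimate of
  \<open>pos_law k\<close> on a set is therefore expressed through such masses again, and summation
  against \<open>nonpos_law (n - k)\<close> leaves explicit constants.

  For the supremum itself only half-open intervals are tested, since the passage to the limit goes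
  through distribution functions. The number \<open>\<kappa>\<close> is a multiple of the integral
  of \<open>\<nu>\<close> over the interval in the lower bound, and of the length of the interval in
  the upper bound. Inequalities between densities are recovered at the end.

  In the lower bound the interval is shifted to the left by at most \<open>x\<^sub>0 / 2\<close>,
  and (M) compares \<open>\<nu>\<close> before and after the shift. In the upper bound displacements
  down to an eighth of the level count, and (M) together with (D) leads back from there.\<close>

lemma sum_triangle_swap:
  fixes F :: "nat \<Rightarrow> nat \<Rightarrow> 'b :: comm_monoid_add"
  shows "(\<Sum>i<k. \<Sum>j=1..i. F j (i - j)) = (\<Sum>j=1..k. \<Sum>i<k - j. F j i)"
proof -
  have "(\<Sum>i<k. \<Sum>j=1..i. F j (i - j)) = (\<Sum>(i, j)\<in>(SIGMA i:{..<k}. {1..i}). F j (i - j))"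
    by (simp add: sum.Sigma)
  also have "\<dots> = (\<Sum>(j, i)\<in>(SIGMA j:{1..k}. {..<k - j}). F j i)"
    by (rule sum.reindex_bij_witness[where i = "\<lambda>(j, i). (i + j, j)" and j = "\<lambda>(i, j). (j, i - j)"]) auto
  also have "\<dots> = (\<Sum>j=1..k. \<Sum>i<k - j. F j i)"
    by (simp add: sum.Sigma)
  finally show ?thesis .
qed

text \<open>The condition \<open>i < k\<close> makes \<open>q = i + (n - k)\<close> range over
  \<open>q < n\<close>. In both bounds the inner sum on the right becomes a probability for the walk
  of \<open>q\<close> steps: its total mass, or the probability that its maximum is small.\<close>

lemma sum_antidiagonals:
  fixes F :: "nat \<Rightarrow> nat \<Rightarrow> 'b :: comm_monoid_add"
  shows "(\<Sum>k\<le>n. \<Sum>i<k. F i (n - k)) = (\<Sum>q<n. \<Sum>i\<le>q. F i (q - i))"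
proof -
  have "(\<Sum>k\<le>n. \<Sum>i<k. F i (n - k)) = (\<Sum>(k, i)\<in>(SIGMA k:{..n}. {..<k}). F i (n - k))"
    by (simp add: sum.Sigma)
  also have "\<dots> = (\<Sum>(q, i)\<in>(SIGMA q:{..<n}. {..q}). F i (q - i))"
    by (rule sum.reindex_bij_witness[where i = "\<lambda>(q, i). (n + i - q, i)" and j = "\<lambda>(k, i). (n + i - k, i)"]) auto
  also have "\<dots> = (\<Sum>q<n. \<Sum>i\<le>q. F i (q - i))"
    by (simp add: sum.Sigma)
  finally show ?thesis .
qed

lemma all_le_Suc_shift: "(\<forall>j\<le>Suc n. P j) \<longleftrightarrow> P 0 \<and> (\<forall>j\<le>n. P (Suc j))"
  by (metis Suc_le_mono not0_implies_Suc le0)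

lemma ennreal_half: "ennreal (1 / 2) = 1 / 2"
  using divide_ennreal[of 1 2] by simp

lemma finite_borel_imp_sigma_finite: "finite_borel_measure N \<Longrightarrow> sigma_finite_measure N"
  by (simp add: finite_borel_measure_def finite_measure_def)

lemma finite_borel_measureI:
  "finite_measure M \<Longrightarrow> sets M = sets borel \<Longrightarrow> finite_borel_measure M"
  by (simp add: finite_borel_measure_def finite_borel_measure_axioms_def)

lemma finite_borel_measure_convolution:
  assumes "finite_borel_measure M" "finite_borel_measure N"
  shows "finite_borel_measure (M \<star> N)"
proof -
  interpret M: finite_borel_measure M by fact
  interpret N: finite_borel_measure N by fact
  show ?thesis
    by (intro finite_borel_measureI convolution_finite M.finite_measure_axioms N.finite_measure_axioms)
       (simp_all only: M.M_is_borel N.M_is_borel sets_convolution)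
qed

lemma finite_borel_measure_density_indicator:
  assumes "finite_borel_measure M" and [measurable]: "A \<in> sets borel"
  shows "finite_borel_measure (density M (indicator A))"
proof -
  interpret M: finite_borel_measure M by fact
  note [simp, measurable_cong] = M.M_is_borel
  have "space M = UNIV"
    using sets_eq_imp_space_eq[OF M.M_is_borel] by simp
  then have "emeasure (density M (indicator A)) UNIV \<le> emeasure M UNIV"
    using emeasure_density[of "indicator A" M UNIV] emeasure_space[of M A] by simp
  then show ?thesis
    by (intro finite_borel_measureI finite_measureI)
       (auto simp: M.emeasure_finite top_unique \<open>space M = UNIV\<close>)
qed

lemma finite_borel_measure_return: "finite_borel_measure (return borel (x::real))"
  by (intro finite_borel_measureI prob_space.finite_measure prob_space_return) auto

lemma nn_integral_swap_borel:
  assumes "finite_borel_measure M" "finite_borel_measure N"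
    and [measurable]: "case_prod f \<in> borel_measurable (borel \<Otimes>\<^sub>M borel)"
  shows "(\<integral>\<^sup>+x. \<integral>\<^sup>+y. f x y \<partial>N \<partial>M) = (\<integral>\<^sup>+y. \<integral>\<^sup>+x. f x y \<partial>M \<partial>N)"
proof -
  interpret M: finite_borel_measure M by fact
  interpret N: finite_borel_measure N by fact
  interpret pair_sigma_finite N M ..
  note [measurable_cong] = M.M_is_borel N.M_is_borel
  have "(\<lambda>(y, x). f x y) \<in> borel_measurable (N \<Otimes>\<^sub>M M)"
    by measurable
  then show ?thesis
    using Fubini[of "\<lambda>(y, x). f x y"] by simp
qed

lemma nn_integral_convolution_borel:
  assumes "finite_borel_measure M" "finite_borel_measure N"
    and [measurable]: "f \<in> borel_measurable borel"
  shows "(\<integral>\<^sup>+x. f x \<partial>(M \<star> N)) = (\<integral>\<^sup>+x. \<integral>\<^sup>+y. f (x + y) \<partial>N \<partial>M)"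
proof -
  interpret M: finite_borel_measure M by fact
  interpret N: finite_borel_measure N by fact
  show ?thesis
    by (intro nn_integral_convolution M.finite_measure_axioms N.finite_measure_axioms)
       (simp_all only: M.M_is_borel N.M_is_borel assms)
qed

section \<open>Laws attached to a random walk\<close>

locale random_walk = real_distribution \<mu> for \<mu> :: "real measure"
begin

primrec walk_law :: "nat \<Rightarrow> real measure" where
  "walk_law 0 = return borel 0"
| "walk_law (Suc k) = (\<mu> \<star> walk_law k)"

text \<open>The law of the walk at time \<open>k\<close> on the event that it is positive at all times \<open>1, \<dots>, k\<close>.\<close>

primrec pos_law :: "nat \<Rightarrow> real measure" where
  "pos_law 0 = return borel 0"
| "pos_law (Suc k) = density (\<mu> \<star> pos_law k) (indicator {0<..})"

text \<open>For the walk \<open>x\<^sub>n\<close> with maximum \<open>m\<^sub>n\<close> over the times \<open>0, \<dots>, n\<close>, the joint law of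
  \<open>(m\<^sub>n, x\<^sub>n - m\<^sub>n)\<close>. The recursion prepends a step, so that no reversal of time is needed in the
  decomposition at the first maximum.\<close>

primrec max_law :: "nat \<Rightarrow> (real \<times> real) measure" where
  "max_law 0 = return (borel \<Otimes>\<^sub>M borel) (0, 0)"
| "max_law (Suc n) = distr (\<mu> \<Otimes>\<^sub>M max_law n) (borel \<Otimes>\<^sub>M borel)
     (\<lambda>(x, m, d). if 0 < x + m then (x + m, d) else (0, x + m + d))"

text \<open>On the event that the maximum is 0 the second coordinate is the endpoint. So this is the
  law of the endpoint of a walk that never becomes positive, and \<open>b\<^sub>n\<close> is its
  mass.\<close>

definition nonpos_law :: "nat \<Rightarrow> real measure" where
  "nonpos_law n = distr (density (max_law n) (indicator ({0} \<times> UNIV))) borel snd"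

lemma finite_borel_mu: "finite_borel_measure \<mu>"
  by (rule finite_borel_measure_M)

lemma finite_borel_walk_law: "finite_borel_measure (walk_law k)"
  by (induction k)
     (auto intro: finite_borel_measure_convolution finite_borel_measure_return finite_borel_mu)

lemma finite_borel_pos_law: "finite_borel_measure (pos_law k)"
  by (induction k)
     (auto intro!: finite_borel_measure_convolution finite_borel_measure_return finite_borel_mu
       finite_borel_measure_density_indicator)

lemma sets_walk_law [simp, measurable_cong]: "sets (walk_law k) = sets borel"
  using finite_borel_walk_law[of k] by (simp add: finite_borel_measure.M_is_borel)

lemma sets_pos_law [simp, measurable_cong]: "sets (pos_law k) = sets borel"
  using finite_borel_pos_law[of k] by (simp add: finite_borel_measure.M_is_borel)

lemma sets_max_law [simp, measurable_cong]: "sets (max_law n) = sets (borel \<Otimes>\<^sub>M borel)"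
  by (cases n) auto

lemma prob_space_max_law: "prob_space (max_law n)"
proof (induction n)
  case 0
  show ?case by (auto intro!: prob_space_return simp: space_pair_measure)
next
  case (Suc n)
  interpret J: prob_space "max_law n" by fact
  interpret P: pair_prob_space \<mu> "max_law n" ..
  show ?case
    unfolding max_law.simps by (rule P.prob_space_distr) measurable
qed

lemma sets_nonpos_law [simp, measurable_cong]: "sets (nonpos_law n) = sets borel"
  by (simp add: nonpos_law_def)

lemma nn_integral_nonpos_law:
  assumes [measurable]: "f \<in> borel_measurable borel"
  shows "(\<integral>\<^sup>+y. f y \<partial>nonpos_law n) = (\<integral>\<^sup>+z. indicator {0} (fst z) * f (snd z) \<partial>max_law n)"
proof -
  have *: "indicator ({0} \<times> UNIV) z = (indicator {0} (fst z) :: ennreal)" for z :: "real \<times> real"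
    by (cases z) (auto simp: indicator_def)
  show ?thesis
    unfolding nonpos_law_def
    by (subst nn_integral_distr, measurable, subst nn_integral_density) (auto simp: *)
qed

lemma finite_borel_nonpos_law: "finite_borel_measure (nonpos_law n)"
proof -
  interpret J: prob_space "max_law n" by (rule prob_space_max_law)
  have "emeasure (nonpos_law n) UNIV = (\<integral>\<^sup>+z. indicator {0} (fst z) \<partial>max_law n)"
    using nn_integral_nonpos_law[of "\<lambda>_. 1" n] by (simp add: sets_eq_imp_space_eq[OF sets_nonpos_law])
  also have "\<dots> \<le> (\<integral>\<^sup>+z. 1 \<partial>max_law n)"
    by (intro nn_integral_mono) (auto simp: indicator_def)
  also have "\<dots> = 1"
    by (simp add: J.emeasure_space_1)
  finally show ?thesis
    by (intro finite_borel_measureI finite_measureI)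
       (auto simp: top_unique sets_eq_imp_space_eq[OF sets_nonpos_law])
qed

lemmas finite_borel_laws = finite_borel_mu finite_borel_walk_law finite_borel_pos_law finite_borel_nonpos_law

lemma measurable_nn_integral_laws [measurable (raw)]:
  assumes "case_prod f \<in> borel_measurable (N \<Otimes>\<^sub>M borel)"
  shows "(\<lambda>x. \<integral>\<^sup>+y. f x y \<partial>\<mu>) \<in> borel_measurable N"
    and "(\<lambda>x. \<integral>\<^sup>+y. f x y \<partial>walk_law k) \<in> borel_measurable N"
    and "(\<lambda>x. \<integral>\<^sup>+y. f x y \<partial>pos_law k) \<in> borel_measurable N"
    and "(\<lambda>x. \<integral>\<^sup>+y. f x y \<partial>nonpos_law k) \<in> borel_measurable N"
proof -
  have "case_prod f \<in> borel_measurable (N \<Otimes>\<^sub>M \<mu>)"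
    "case_prod f \<in> borel_measurable (N \<Otimes>\<^sub>M walk_law k)"
    "case_prod f \<in> borel_measurable (N \<Otimes>\<^sub>M pos_law k)"
    "case_prod f \<in> borel_measurable (N \<Otimes>\<^sub>M nonpos_law k)"
    using assms by (simp_all cong: measurable_cong_sets sets_pair_measure_cong)
  then show "(\<lambda>x. \<integral>\<^sup>+y. f x y \<partial>\<mu>) \<in> borel_measurable N"
    and "(\<lambda>x. \<integral>\<^sup>+y. f x y \<partial>walk_law k) \<in> borel_measurable N"
    and "(\<lambda>x. \<integral>\<^sup>+y. f x y \<partial>pos_law k) \<in> borel_measurable N"
    and "(\<lambda>x. \<integral>\<^sup>+y. f x y \<partial>nonpos_law k) \<in> borel_measurable N"
    using finite_borel_laws by (auto intro!: sigma_finite_measure.borel_measurable_nn_integral finite_borel_imp_sigma_finite)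
qed

lemma nn_integral_walk_law_Suc:
  assumes [measurable]: "f \<in> borel_measurable borel"
  shows "(\<integral>\<^sup>+x. f x \<partial>walk_law (Suc k)) = (\<integral>\<^sup>+x. \<integral>\<^sup>+y. f (x + y) \<partial>walk_law k \<partial>\<mu>)"
  by (simp add: nn_integral_convolution_borel finite_borel_laws)

lemma nn_integral_pos_law_Suc:
  assumes [measurable]: "f \<in> borel_measurable borel"
  shows "(\<integral>\<^sup>+x. f x \<partial>pos_law (Suc k)) =
    (\<integral>\<^sup>+x. \<integral>\<^sup>+y. indicator {0<..} (x + y) * f (x + y) \<partial>pos_law k \<partial>\<mu>)"
  by (simp add: nn_integral_density nn_integral_convolution_borel finite_borel_laws)

lemma nn_integral_max_law_Suc:
  assumes [measurable]: "f \<in> borel_measurable (borel \<Otimes>\<^sub>M borel)"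
  shows "(\<integral>\<^sup>+z. f z \<partial>max_law (Suc n)) =
    (\<integral>\<^sup>+x. \<integral>\<^sup>+z. f (if 0 < x + fst z then (x + fst z, snd z) else (0, x + fst z + snd z)) \<partial>max_law n \<partial>\<mu>)"
proof -
  interpret J: prob_space "max_law n" by (rule prob_space_max_law)
  show ?thesis
    by (simp add: nn_integral_distr J.nn_integral_fst[symmetric] split_beta' cong: if_cong)
qed

lemma nn_integral_nonpos_law_Suc:
  assumes [measurable]: "f \<in> borel_measurable borel"
  shows "(\<integral>\<^sup>+y. f y \<partial>nonpos_law (Suc n)) =
    (\<integral>\<^sup>+x. \<integral>\<^sup>+z. indicator {..0} (x + fst z) * f (x + fst z + snd z) \<partial>max_law n \<partial>\<mu>)"
  unfolding nn_integral_nonpos_law[OF assms]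
  by (subst nn_integral_max_law_Suc, measurable)
     (auto intro!: nn_integral_cong simp: indicator_def)

text \<open>A prepended step \<open>x\<close> with \<open>x + m > 0\<close> moves the maximum to
  \<open>x + m\<close> and keeps the displacement after it: \<open>pos_law k\<close> becomes
  \<open>pos_law (Suc k)\<close> and the other factor is unchanged. If \<open>x + m \<le> 0\<close>,
  the maximum is 0, attained at time 0, and this whole part is the new summand \<open>k = 0\<close>.
  The strict inequality selects the first time of the maximum.\<close>

theorem max_law_decomposition:
  assumes "f \<in> borel_measurable (borel \<Otimes>\<^sub>M borel)"
  shows "(\<integral>\<^sup>+z. f z \<partial>max_law n) =
    (\<Sum>k\<le>n. \<integral>\<^sup>+x. \<integral>\<^sup>+y. f (x, y) \<partial>nonpos_law (n - k) \<partial>pos_law k)"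
  using assms
proof (induction n arbitrary: f)
  case 0
  note [measurable] = 0
  have "(\<integral>\<^sup>+x. \<integral>\<^sup>+y. f (x, y) \<partial>nonpos_law 0 \<partial>pos_law 0) = (\<integral>\<^sup>+y. f (0, y) \<partial>nonpos_law 0)"
    by (simp add: nn_integral_return)
  also have "\<dots> = f (0, 0)"
    by (subst nn_integral_nonpos_law) (simp_all add: nn_integral_return space_pair_measure)
  finally show ?case
    by (simp add: nn_integral_return space_pair_measure)
next
  case (Suc n)
  note [measurable] = Suc.prems
  have split: "f (if 0 < x + fst z then (x + fst z, snd z) else (0, x + fst z + snd z)) =
      indicator {0<..} (x + fst z) * f (x + fst z, snd z) +
      indicator {..0} (x + fst z) * f (0, x + fst z + snd z)" for x z
    by (auto simp: indicator_def)
  have "(\<integral>\<^sup>+z. f z \<partial>max_law (Suc n)) =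
      (\<integral>\<^sup>+x. \<integral>\<^sup>+z. indicator {0<..} (x + fst z) * f (x + fst z, snd z) \<partial>max_law n \<partial>\<mu>) +
      (\<integral>\<^sup>+x. \<integral>\<^sup>+z. indicator {..0} (x + fst z) * f (0, x + fst z + snd z) \<partial>max_law n \<partial>\<mu>)"
  proof -
    interpret J: prob_space "max_law n" by (rule prob_space_max_law)
    show ?thesis
      unfolding nn_integral_max_law_Suc[OF Suc.prems] split
      by (simp add: nn_integral_add)
  qed
  also have "(\<integral>\<^sup>+x. \<integral>\<^sup>+z. indicator {0<..} (x + fst z) * f (x + fst z, snd z) \<partial>max_law n \<partial>\<mu>) =
     (\<integral>\<^sup>+x. (\<Sum>k\<le>n. \<integral>\<^sup>+u. \<integral>\<^sup>+y. indicator {0<..} (x + u) * f (x + u, y)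
        \<partial>nonpos_law (n - k) \<partial>pos_law k) \<partial>\<mu>)"
    by (intro nn_integral_cong) (subst Suc.IH, auto)
  also have "\<dots> = (\<Sum>k\<le>n. \<integral>\<^sup>+x. \<integral>\<^sup>+u. \<integral>\<^sup>+y. indicator {0<..} (x + u) * f (x + u, y)
        \<partial>nonpos_law (n - k) \<partial>pos_law k \<partial>\<mu>)"
    by (subst nn_integral_sum) auto
  also have "\<dots> = (\<Sum>k\<le>n. \<integral>\<^sup>+x. \<integral>\<^sup>+y. f (x, y) \<partial>nonpos_law (n - k) \<partial>pos_law (Suc k))"
    by (intro sum.cong refl, subst nn_integral_pos_law_Suc) (auto simp: nn_integral_cmult)
  also have "(\<integral>\<^sup>+x. \<integral>\<^sup>+z. indicator {..0} (x + fst z) * f (0, x + fst z + snd z) \<partial>max_law n \<partial>\<mu>) =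
      (\<integral>\<^sup>+x. \<integral>\<^sup>+y. f (x, y) \<partial>nonpos_law (Suc n) \<partial>pos_law 0)"
    unfolding pos_law.simps
    by (subst nn_integral_return, simp, measurable) (simp add: nn_integral_nonpos_law_Suc)
  finally show ?case
    by (subst sum.atMost_Suc_shift) (simp add: add.commute del: pos_law.simps)
qed

text \<open>Both branches of the recursion of \<open>max_law\<close> add \<open>x\<close> to the sum
  of the coordinates, which is therefore the endpoint of the walk.\<close>

lemma max_law_sum:
  assumes "f \<in> borel_measurable borel"
  shows "(\<integral>\<^sup>+z. f (fst z + snd z) \<partial>max_law n) = (\<integral>\<^sup>+x. f x \<partial>walk_law n)"
  using assms
proof (induction n arbitrary: f)
  case 0
  then show ?case by (simp add: nn_integral_return space_pair_measure)
next
  case (Suc n)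
  note [measurable] = Suc.prems
  have "(\<integral>\<^sup>+z. f (fst z + snd z) \<partial>max_law (Suc n)) = (\<integral>\<^sup>+x. \<integral>\<^sup>+z. f (x + (fst z + snd z)) \<partial>max_law n \<partial>\<mu>)"
    by (subst nn_integral_max_law_Suc) (auto intro!: nn_integral_cong simp: add.assoc)
  also have "\<dots> = (\<integral>\<^sup>+x. \<integral>\<^sup>+z. f (x + z) \<partial>walk_law n \<partial>\<mu>)"
    by (intro nn_integral_cong Suc.IH) auto
  also have "\<dots> = (\<integral>\<^sup>+x. f x \<partial>walk_law (Suc n))"
    by (simp only: nn_integral_walk_law_Suc[OF Suc.prems])
  finally show ?case .
qed


lemma walk_law_add:
  assumes "f \<in> borel_measurable borel"
  shows "(\<integral>\<^sup>+x. f x \<partial>walk_law (j + l)) = (\<integral>\<^sup>+x. \<integral>\<^sup>+y. f (x + y) \<partial>walk_law l \<partial>walk_law j)"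
  using assms
proof (induction j arbitrary: f)
  case 0
  note [measurable] = 0
  have "(\<lambda>x. \<integral>\<^sup>+y. f (x + y) \<partial>walk_law l) \<in> borel_measurable borel" by measurable
  then show ?case by (simp add: nn_integral_return)
next
  case (Suc j)
  note [measurable] = Suc.prems
  have "(\<integral>\<^sup>+x. f x \<partial>walk_law (Suc j + l)) = (\<integral>\<^sup>+x. \<integral>\<^sup>+y. f (x + y) \<partial>walk_law (j + l) \<partial>\<mu>)"
    by (simp only: add_Suc nn_integral_walk_law_Suc[OF Suc.prems])
  also have "\<dots> = (\<integral>\<^sup>+x. \<integral>\<^sup>+y. \<integral>\<^sup>+z. f (x + (y + z)) \<partial>walk_law l \<partial>walk_law j \<partial>\<mu>)"
    by (intro nn_integral_cong Suc.IH) auto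
  also have "\<dots> = (\<integral>\<^sup>+x. \<integral>\<^sup>+y. f (x + y) \<partial>walk_law l \<partial>walk_law (Suc j))"
    by (subst nn_integral_walk_law_Suc) (auto simp: add.assoc)
  finally show ?case .
qed

lemma walk_law_decomposition:
  assumes [measurable]: "f \<in> borel_measurable borel"
  shows "(\<integral>\<^sup>+x. f x \<partial>walk_law n) =
    (\<Sum>k\<le>n. \<integral>\<^sup>+x. \<integral>\<^sup>+y. f (x + y) \<partial>nonpos_law (n - k) \<partial>pos_law k)"
  unfolding max_law_sum[OF assms, symmetric] by (subst max_law_decomposition) auto

text \<open>A violation after a prepended step implies one before it: the new first coordinate is
  nonnegative in both branches, and \<open>x + m + d > 0\<close> with \<open>x + m \<le> 0\<close>
  forces \<open>d > 0\<close>.\<close>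

lemma AE_max_law: "AE z in max_law n. 0 \<le> fst z \<and> snd z \<le> 0"
proof -
  define f :: "real \<times> real \<Rightarrow> ennreal" where "f z = (if fst z < 0 \<or> 0 < snd z then 1 else 0)" for z
  have [measurable]: "f \<in> borel_measurable (borel \<Otimes>\<^sub>M borel)"
    unfolding f_def by measurable
  have "(\<integral>\<^sup>+z. f z \<partial>max_law n) = 0"
  proof (induction n)
    case 0
    then show ?case by (simp add: nn_integral_return space_pair_measure f_def)
  next
    case (Suc n)
    have "(\<integral>\<^sup>+z. f z \<partial>max_law (Suc n)) \<le> (\<integral>\<^sup>+x. \<integral>\<^sup>+z. f z \<partial>max_law n \<partial>\<mu>)"
      unfolding nn_integral_max_law_Suc[OF \<open>f \<in> _\<close>]
      by (intro nn_integral_mono) (auto simp: f_def)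
    then show ?case using Suc by simp
  qed
  then have "AE z in max_law n. f z = 0"
    by (subst (asm) nn_integral_0_iff_AE) auto
  then show ?thesis
    by eventually_elim (auto simp: f_def split: if_splits)
qed

lemma AE_nonpos_law: "AE y in nonpos_law n. y \<le> 0"
proof -
  have "AE z in density (max_law n) (indicator ({0} \<times> UNIV)). snd z \<le> 0"
    using AE_max_law[of n] by (subst AE_density) auto
  then show ?thesis
    unfolding nonpos_law_def by (subst AE_distr_iff) auto
qed

lemma AE_pos_law: "AE x in pos_law (Suc k). 0 < x"
  unfolding pos_law.simps
  by (subst AE_density) (auto split: split_indicator)

lemma AE_pos_law_nonneg: "AE x in pos_law k. 0 \<le> x"
proof (cases k)
  case 0
  show ?thesis unfolding 0 pos_law.simps by (subst AE_return) auto
next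
  case (Suc k')
  show ?thesis unfolding Suc using AE_pos_law[of k'] by eventually_elim simp
qed

lemma nonpos_law_0: 
  assumes [measurable]: "f \<in> borel_measurable borel"
  shows "(\<integral>\<^sup>+y. f y \<partial>nonpos_law 0) = f 0"
  by (subst nn_integral_nonpos_law) (simp_all add: nn_integral_return space_pair_measure)

lemma nn_integral_mu_const [simp]: "(\<integral>\<^sup>+x. c \<partial>\<mu>) = c"
  using emeasure_space_1 by simp

lemma nn_integral_le_1:
  assumes "\<And>x. f x \<le> (1 :: ennreal)"
  shows "(\<integral>\<^sup>+x. f x \<partial>walk_law k) \<le> 1" "(\<integral>\<^sup>+x. f x \<partial>pos_law k) \<le> 1" "(\<integral>\<^sup>+x. f x \<partial>nonpos_law k) \<le> 1"
proof -
  have m1: "(\<lambda>_. 1) \<in> borel_measurable borel" by simp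
  have walk: "(\<integral>\<^sup>+x. 1 \<partial>walk_law k) = 1" for k
    by (induction k) (simp_all add: nn_integral_return nn_integral_walk_law_Suc del: walk_law.simps(2) nn_integral_const)
  have pos: "(\<integral>\<^sup>+x. 1 \<partial>pos_law k) \<le> 1" for k
  proof (induction k)
    case (Suc k)
    have "(\<integral>\<^sup>+x. 1 \<partial>pos_law (Suc k)) \<le> (\<integral>\<^sup>+x. \<integral>\<^sup>+y. 1 \<partial>pos_law k \<partial>\<mu>)"
      unfolding nn_integral_pos_law_Suc[OF m1]
      by (intro nn_integral_mono) (auto simp: indicator_def)
    also have "\<dots> \<le> (\<integral>\<^sup>+x. 1 \<partial>\<mu>)"
      by (intro nn_integral_mono Suc)
    finally show ?case by (simp del: nn_integral_const)
  qed (simp add: nn_integral_return del: nn_integral_const)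
  have neg: "(\<integral>\<^sup>+x. 1 \<partial>nonpos_law k) \<le> 1"
  proof -
    interpret J: prob_space "max_law k" by (rule prob_space_max_law)
    have "(\<integral>\<^sup>+x. 1 \<partial>nonpos_law k) \<le> (\<integral>\<^sup>+z. 1 \<partial>max_law k)"
      by (subst nn_integral_nonpos_law) (auto intro!: nn_integral_mono simp: indicator_def simp del: nn_integral_const)
    then show ?thesis by (simp add: J.emeasure_space_1)
  qed
  show "(\<integral>\<^sup>+x. f x \<partial>walk_law k) \<le> 1"
    using nn_integral_mono[of "walk_law k" f "\<lambda>_. 1", OF assms] walk by simp
  show "(\<integral>\<^sup>+x. f x \<partial>pos_law k) \<le> 1"
    using nn_integral_mono[of "pos_law k" f "\<lambda>_. 1", OF assms] pos[of k] by (simp del: nn_integral_const)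
  show "(\<integral>\<^sup>+x. f x \<partial>nonpos_law k) \<le> 1"
    using nn_integral_mono[of "nonpos_law k" f "\<lambda>_. 1", OF assms] neg by (simp del: nn_integral_const)
qed

section \<open>Spitzer's identity\<close>

text \<open>The right-hand side of Spitzer's identity as a functional of the test function, not as a
  measure: the identity is obtained by cancelling finite numbers, one \<open>f\<close> at a
  time.\<close>

definition pos_conv :: "nat \<Rightarrow> (real \<Rightarrow> ennreal) \<Rightarrow> ennreal" where
  "pos_conv k f = (\<Sum>j=1..k. \<integral>\<^sup>+x. \<integral>\<^sup>+y. indicator {0<..} x * f (x + y) \<partial>pos_law (k - j) \<partial>walk_law j)"

definition nonpos_conv :: "nat \<Rightarrow> (real \<Rightarrow> ennreal) \<Rightarrow> ennreal" where
  "nonpos_conv k f = (\<Sum>j=1..k. \<integral>\<^sup>+x. \<integral>\<^sup>+y. indicator {..0} x * f (x + y) \<partial>nonpos_law (k - j) \<partial>walk_law j)"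

text \<open>Both sides come from expanding \<open>k p\<^sub>k\<close>: once with \<open>p\<^sub>k = p\<^sub>j * p\<^sub>k\<^sub>-\<^sub>j\<close> for each \<open>j\<close>, once with the
  weight \<open>k = i + (k - i)\<close> in the decomposition at the first maximum. All terms with both factors
  nontrivial cancel by the induction hypothesis. The two remaining summands live on
  \<open>(0, \<infinity>)\<close> and \<open>(-\<infinity>, 0]\<close>, which separates them.\<close>

lemma spitzer_sum:
  assumes f [measurable]: "f \<in> borel_measurable borel" and f_le: "\<And>x. f x \<le> 1"
    and IH_pos: "\<And>i g. i < k \<Longrightarrow> g \<in> borel_measurable borel \<Longrightarrow> (\<And>x. g x \<le> 1) \<Longrightarrow>
       of_nat i * (\<integral>\<^sup>+x. g x \<partial>pos_law i) = pos_conv i g"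
    and IH_nonpos: "\<And>i g. i < k \<Longrightarrow> g \<in> borel_measurable borel \<Longrightarrow> (\<And>x. g x \<le> 1) \<Longrightarrow>
       of_nat i * (\<integral>\<^sup>+x. g x \<partial>nonpos_law i) = nonpos_conv i g"
  shows "of_nat k * (\<integral>\<^sup>+x. f x \<partial>pos_law k) + of_nat k * (\<integral>\<^sup>+x. f x \<partial>nonpos_law k) =
    pos_conv k f + nonpos_conv k f"
proof -
  \<comment> \<open>\<open>U i\<close> is the summand of the decomposition of
    \<open>walk_law k\<close> with first maximum at time \<open>i\<close>. \<open>P j i\<close> and
    \<open>N j i\<close> are the summands that arise when only the last \<open>k - j\<close> steps
    are decomposed, split by the sign of the displacement over the first \<open>j\<close>
    steps.\<close>
  define U where "U i = (\<integral>\<^sup>+x. \<integral>\<^sup>+y. f (x + y) \<partial>nonpos_law (k - i) \<partial>pos_law i)" for i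
  define T where "T A j i l = (\<integral>\<^sup>+x. \<integral>\<^sup>+y. \<integral>\<^sup>+z. indicator A x * f (x + y + z) \<partial>nonpos_law l \<partial>pos_law i \<partial>walk_law j)"
    for A :: "real set" and j i l
  define P where "P j i = T {0<..} j i (k - j - i)" for j i
  define N where "N j i = T {..0} j i (k - j - i)" for j i
  have U_pos: "of_nat i * U i = (\<Sum>j=1..i. T {0<..} j (i - j) (k - i))" if "i < k" for i
  proof -
    have "of_nat i * U i = pos_conv i (\<lambda>x. \<integral>\<^sup>+y. f (x + y) \<partial>nonpos_law (k - i))"
      unfolding U_def using that by (intro IH_pos nn_integral_le_1 f_le) auto
    also have "\<dots> = (\<Sum>j=1..i. T {0<..} j (i - j) (k - i))"
      unfolding pos_conv_def T_def
      by (intro sum.cong nn_integral_cong refl) (simp add: nn_integral_cmult)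
    finally show ?thesis .
  qed
  have U_swap: "U i = (\<integral>\<^sup>+y. \<integral>\<^sup>+x. f (x + y) \<partial>pos_law i \<partial>nonpos_law (k - i))" for i
    unfolding U_def by (rule nn_integral_swap_borel) (auto intro: finite_borel_laws)
  \<comment> \<open>The hypothesis needs \<open>k - i < k\<close>, hence \<open>0 < i\<close>. The
    terms excluded here and in \<open>U_pos\<close>, namely \<open>i = 0\<close> and
    \<open>i = k\<close>, are the ones containing the two integrals still to be found.\<close>
  have U_nonpos: "of_nat (k - i) * U i = (\<Sum>j=1..k - i. T {..0} j i (k - i - j))" if "0 < i" "i \<le> k" for i
  proof -
    have "of_nat (k - i) * U i = nonpos_conv (k - i) (\<lambda>y. \<integral>\<^sup>+x. f (x + y) \<partial>pos_law i)"
      unfolding U_swap using that by (intro IH_nonpos nn_integral_le_1 f_le) auto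
    also have "\<dots> = (\<Sum>j=1..k - i. \<integral>\<^sup>+x. \<integral>\<^sup>+z. \<integral>\<^sup>+y. indicator {..0} x * f (x + y + z)
        \<partial>pos_law i \<partial>nonpos_law (k - i - j) \<partial>walk_law j)"
      unfolding nonpos_conv_def
      by (intro sum.cong nn_integral_cong refl) (simp add: nn_integral_cmult ac_simps)
    also have "\<dots> = (\<Sum>j=1..k - i. T {..0} j i (k - i - j))"
      unfolding T_def
      by (intro sum.cong nn_integral_cong refl nn_integral_swap_borel) (auto intro: finite_borel_laws)
    finally show ?thesis .
  qed
  have "of_nat k * (\<integral>\<^sup>+x. f x \<partial>walk_law k) = (\<Sum>j=1..k. \<integral>\<^sup>+x. f x \<partial>walk_law k)"
    by simp
  also have "\<dots> = (\<Sum>j=1..k. \<Sum>i\<le>k - j. P j i + N j i)"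
  proof (intro sum.cong refl)
    fix j assume j: "j \<in> {1..k}"
    have "(\<integral>\<^sup>+x. f x \<partial>walk_law k) = (\<integral>\<^sup>+x. \<integral>\<^sup>+y. f (x + y) \<partial>walk_law (k - j) \<partial>walk_law j)"
      using walk_law_add[OF f, of j "k - j"] j by simp
    also have "\<dots> = (\<integral>\<^sup>+x. (\<Sum>i\<le>k - j. \<integral>\<^sup>+y. \<integral>\<^sup>+z. f (x + (y + z)) \<partial>nonpos_law (k - j - i) \<partial>pos_law i) \<partial>walk_law j)"
      by (intro nn_integral_cong walk_law_decomposition) auto
    also have "\<dots> = (\<Sum>i\<le>k - j. \<integral>\<^sup>+x. \<integral>\<^sup>+y. \<integral>\<^sup>+z. f (x + y + z) \<partial>nonpos_law (k - j - i) \<partial>pos_law i \<partial>walk_law j)"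
      by (subst nn_integral_sum) (auto simp: add.assoc)
    also have "\<dots> = (\<Sum>i\<le>k - j. P j i + N j i)"
    proof (intro sum.cong refl)
      fix i
      have "P j i + N j i = (\<integral>\<^sup>+x. \<integral>\<^sup>+y. \<integral>\<^sup>+z. indicator {0<..} x * f (x + y + z) + indicator {..0} x * f (x + y + z)
          \<partial>nonpos_law (k - j - i) \<partial>pos_law i \<partial>walk_law j)"
        unfolding P_def N_def T_def by (simp add: nn_integral_add)
      also have "\<dots> = (\<integral>\<^sup>+x. \<integral>\<^sup>+y. \<integral>\<^sup>+z. f (x + y + z) \<partial>nonpos_law (k - j - i) \<partial>pos_law i \<partial>walk_law j)"
        by (intro nn_integral_cong) (auto simp: indicator_def)
      finally show "(\<integral>\<^sup>+x. \<integral>\<^sup>+y. \<integral>\<^sup>+z. f (x + y + z) \<partial>nonpos_law (k - j - i) \<partial>pos_law i \<partial>walk_law j) = P j i + N j i"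
        by simp
    qed
    finally show "(\<integral>\<^sup>+x. f x \<partial>walk_law k) = (\<Sum>i\<le>k - j. P j i + N j i)" .
  qed
  also have "\<dots> = (\<Sum>j=1..k. \<Sum>i\<le>k - j. P j i) + (\<Sum>j=1..k. \<Sum>i\<le>k - j. N j i)"
    by (simp add: sum.distrib)
  \<comment> \<open>The terms \<open>i = k - j\<close> of \<open>P\<close> have a point mass at 0 as
    nonpositive factor and make up \<open>pos_conv k f\<close>. In the same way the terms
    \<open>i = 0\<close> of \<open>N\<close> make up \<open>nonpos_conv k f\<close> below.\<close>
  also have "(\<Sum>j=1..k. \<Sum>i\<le>k - j. P j i) = (\<Sum>j=1..k. \<Sum>i<k - j. P j i) + (\<Sum>j=1..k. P j (k - j))"
    by (simp add: sum.distrib[symmetric] lessThan_Suc_atMost[symmetric])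
  also have "(\<Sum>j=1..k. P j (k - j)) = pos_conv k f"
    unfolding P_def pos_conv_def T_def
    by (intro sum.cong nn_integral_cong refl) (simp add: nonpos_law_0)
  also have "(\<Sum>j=1..k. \<Sum>i\<le>k - j. N j i) = (\<Sum>j=1..k. \<Sum>i=1..k - j. N j i) + (\<Sum>j=1..k. N j 0)"
    by (simp add: sum.distrib[symmetric] sum.atMost_shift add.commute
        sum.atLeast1_atMost_eq)
  also have "(\<Sum>j=1..k. N j 0) = nonpos_conv k f"
    unfolding N_def nonpos_conv_def T_def
    by (intro sum.cong nn_integral_cong refl) (simp add: nn_integral_return)
  also have "(\<Sum>j=1..k. \<Sum>i=1..k - j. N j i) = (\<Sum>i=1..k. of_nat (k - i) * U i)"
  proof -
    have "(\<Sum>j=1..k. \<Sum>i=1..k - j. N j i) = (\<Sum>(j, i)\<in>(SIGMA j:{1..k}. {1..k - j}). N j i)"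
      by (simp add: sum.Sigma)
    also have "\<dots> = (\<Sum>(i, j)\<in>(SIGMA i:{1..k}. {1..k - i}). N j i)"
      by (rule sum.reindex_bij_witness[where i = "\<lambda>(i, j). (j, i)" and j = "\<lambda>(j, i). (i, j)"]) auto
    also have "\<dots> = (\<Sum>i=1..k. \<Sum>j=1..k - i. N j i)"
      by (simp add: sum.Sigma)
    also have "\<dots> = (\<Sum>i=1..k. of_nat (k - i) * U i)"
      by (intro sum.cong refl) (simp add: U_nonpos N_def add.commute)
    finally show ?thesis .
  qed
  also have "(\<Sum>j=1..k. \<Sum>i<k - j. P j i) = (\<Sum>i<k. of_nat i * U i)"
    unfolding sum_triangle_swap[of "\<lambda>j i. P j i", symmetric]
    by (intro sum.cong refl) (simp add: U_pos P_def)
  finally have 1: "of_nat k * (\<integral>\<^sup>+x. f x \<partial>walk_law k) =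
      (\<Sum>i<k. of_nat i * U i) + pos_conv k f + ((\<Sum>i=1..k. of_nat (k - i) * U i) + nonpos_conv k f)" .
  have "of_nat k * (\<integral>\<^sup>+x. f x \<partial>walk_law k) = of_nat k * (\<Sum>i\<le>k. U i)"
    by (simp add: walk_law_decomposition U_def)
  also have "\<dots> = (\<Sum>i\<le>k. of_nat i * U i + of_nat (k - i) * U i)"
    unfolding sum_distrib_left
    by (intro sum.cong refl) (simp add: distrib_right[symmetric] of_nat_add[symmetric] del: of_nat_add)
  also have "\<dots> = (\<Sum>i\<le>k. of_nat i * U i) + (\<Sum>i\<le>k. of_nat (k - i) * U i)"
    by (simp add: sum.distrib)
  also have "(\<Sum>i\<le>k. of_nat i * U i) = (\<Sum>i<k. of_nat i * U i) + of_nat k * (\<integral>\<^sup>+x. f x \<partial>pos_law k)"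
    by (simp add: lessThan_Suc_atMost[symmetric] U_def nonpos_law_0)
  also have "(\<Sum>i\<le>k. of_nat (k - i) * U i) = (\<Sum>i=1..k. of_nat (k - i) * U i) + of_nat k * (\<integral>\<^sup>+x. f x \<partial>nonpos_law k)"
    by (simp add: sum.atMost_shift add.commute sum.atLeast1_atMost_eq U_def nn_integral_return)
  finally have 2: "of_nat k * (\<integral>\<^sup>+x. f x \<partial>walk_law k) =
      (\<Sum>i<k. of_nat i * U i) + of_nat k * (\<integral>\<^sup>+x. f x \<partial>pos_law k) +
      ((\<Sum>i=1..k. of_nat (k - i) * U i) + of_nat k * (\<integral>\<^sup>+x. f x \<partial>nonpos_law k))" .
  have U_le: "U i \<le> 1" for i
    unfolding U_def by (intro nn_integral_le_1 f_le)
  have U_fin: "U i < \<top>" for i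
    using U_le[of i] by (simp add: order_le_less_trans)
  \<comment> \<open>Cancellation in \<open>ennreal\<close> requires the common part to be finite;
    this is why test functions are bounded by 1.\<close>
  have fin: "(\<Sum>i<k. of_nat i * U i) + (\<Sum>i=1..k. of_nat (k - i) * U i) \<noteq> \<top>"
    using U_fin by (simp add: ennreal_mult_eq_top_iff less_top)
  have "((\<Sum>i<k. of_nat i * U i) + (\<Sum>i=1..k. of_nat (k - i) * U i)) +
      (of_nat k * (\<integral>\<^sup>+x. f x \<partial>pos_law k) + of_nat k * (\<integral>\<^sup>+x. f x \<partial>nonpos_law k)) =
    ((\<Sum>i<k. of_nat i * U i) + (\<Sum>i=1..k. of_nat (k - i) * U i)) + (pos_conv k f + nonpos_conv k f)"
    using 1[unfolded 2] by (simp only: add_ac)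
  then show ?thesis
    using fin by (subst (asm) ennreal_add_left_cancel) auto
qed


text \<open>The two identities are proved together, since \<open>spitzer_sum\<close> consumes both
  of them for smaller indices. The case \<open>k = 0\<close> is separate because
  \<open>pos_law 0\<close> charges 0; for \<open>k > 0\<close> the two laws live on disjoint
  half-lines, and testing with \<open>f\<close> cut to either half-line isolates one
  identity.\<close>

theorem spitzer:
  assumes "f \<in> borel_measurable borel" "\<And>x. f x \<le> 1"
  shows "of_nat k * (\<integral>\<^sup>+x. f x \<partial>pos_law k) = pos_conv k f"
    and "of_nat k * (\<integral>\<^sup>+x. f x \<partial>nonpos_law k) = nonpos_conv k f"
proof -
  have "of_nat k * (\<integral>\<^sup>+x. f x \<partial>pos_law k) = pos_conv k f \<and>
      of_nat k * (\<integral>\<^sup>+x. f x \<partial>nonpos_law k) = nonpos_conv k f"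
    using assms
  proof (induction k arbitrary: f rule: less_induct)
    case (less k)
    note [measurable] = less.prems(1)
    show ?case
    proof (cases k)
      case 0
      then show ?thesis by (simp add: pos_conv_def nonpos_conv_def)
    next
      case (Suc k')
      have restrict: "of_nat k * (\<integral>\<^sup>+x. indicator A x * f x \<partial>pos_law k) + of_nat k * (\<integral>\<^sup>+x. indicator A x * f x \<partial>nonpos_law k) =
         pos_conv k (\<lambda>x. indicator A x * f x) + nonpos_conv k (\<lambda>x. indicator A x * f x)"
        if [measurable]: "A \<in> sets borel" for A
        using less.prems(2) less.IH by (intro spitzer_sum) (auto simp: indicator_def)
      have pos_null: "(\<integral>\<^sup>+x. indicator {..0} x * f x \<partial>pos_law k) = 0"
        unfolding Suc using AE_pos_law[of k'] by (subst nn_integral_0_iff_AE) (auto simp: indicator_def elim!: AE_mp)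
      have pos: "(\<integral>\<^sup>+x. indicator {0<..} x * f x \<partial>pos_law k) = (\<integral>\<^sup>+x. f x \<partial>pos_law k)"
        unfolding Suc using AE_pos_law[of k'] by (intro nn_integral_cong_AE) (auto simp: indicator_def elim!: AE_mp)
      have nonpos_null: "(\<integral>\<^sup>+x. indicator {0<..} x * f x \<partial>nonpos_law k) = 0"
        using AE_nonpos_law[of k] by (subst nn_integral_0_iff_AE) (auto simp: indicator_def elim!: AE_mp)
      have nonpos: "(\<integral>\<^sup>+x. indicator {..0} x * f x \<partial>nonpos_law k) = (\<integral>\<^sup>+x. f x \<partial>nonpos_law k)"
        using AE_nonpos_law[of k] by (intro nn_integral_cong_AE) (auto simp: indicator_def elim!: AE_mp)
      \<comment> \<open>With \<open>x > 0\<close> and \<open>y \<ge> 0\<close> also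
        \<open>x + y > 0\<close>, so \<open>pos_conv\<close> only sees \<open>f\<close> on the
        positive half-line; likewise \<open>nonpos_conv\<close> only sees \<open>f\<close> on
        \<open>{..0}\<close>.\<close>
      have "(\<integral>\<^sup>+y. indicator {0<..} x * (indicator {0<..} (x + y) * f (x + y)) \<partial>pos_law j) =
          (\<integral>\<^sup>+y. indicator {0<..} x * f (x + y) \<partial>pos_law j)" for x j
        using AE_pos_law_nonneg[of j] by (intro nn_integral_cong_AE) (auto simp: indicator_def elim!: AE_mp)
      then have pc: "pos_conv k (\<lambda>x. indicator {0<..} x * f x) = pos_conv k f"
        by (simp add: pos_conv_def)
      have "(\<integral>\<^sup>+y. indicator {0<..} x * (indicator {..0} (x + y) * f (x + y)) \<partial>pos_law j) = 0" for x j
        using AE_pos_law_nonneg[of j] by (subst nn_integral_0_iff_AE) (auto simp: indicator_def elim!: AE_mp)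
      then have pc0: "pos_conv k (\<lambda>x. indicator {..0} x * f x) = 0"
        by (simp add: pos_conv_def)
      have "(\<integral>\<^sup>+y. indicator {..0} x * (indicator {..0} (x + y) * f (x + y)) \<partial>nonpos_law j) =
          (\<integral>\<^sup>+y. indicator {..0} x * f (x + y) \<partial>nonpos_law j)" for x j
        using AE_nonpos_law[of j] by (intro nn_integral_cong_AE) (auto simp: indicator_def elim!: AE_mp)
      then have nc: "nonpos_conv k (\<lambda>x. indicator {..0} x * f x) = nonpos_conv k f"
        by (simp add: nonpos_conv_def)
      have "(\<integral>\<^sup>+y. indicator {..0} x * (indicator {0<..} (x + y) * f (x + y)) \<partial>nonpos_law j) = 0" for x j
        using AE_nonpos_law[of j] by (subst nn_integral_0_iff_AE) (auto simp: indicator_def elim!: AE_mp)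
      then have nc0: "nonpos_conv k (\<lambda>x. indicator {0<..} x * f x) = 0"
        by (simp add: nonpos_conv_def)
      show ?thesis
        using restrict[of "{0<..}"] restrict[of "{..0}"]
        unfolding pos_null pos nonpos_null nonpos pc pc0 nc nc0 by simp
    qed
  qed
  then show "of_nat k * (\<integral>\<^sup>+x. f x \<partial>pos_law k) = pos_conv k f"
    and "of_nat k * (\<integral>\<^sup>+x. f x \<partial>nonpos_law k) = nonpos_conv k f"
    by auto
qed

section \<open>Bounds for the law of the maximum\<close>

lemma max_law_fst:
  assumes [measurable]: "f \<in> borel_measurable borel"
  shows "(\<integral>\<^sup>+z. f (fst z) \<partial>max_law n) =
    (\<Sum>k\<le>n. (\<integral>\<^sup>+x. f x \<partial>pos_law k) * (\<integral>\<^sup>+y. 1 \<partial>nonpos_law (n - k)))"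
  by (subst max_law_decomposition) (auto simp: nn_integral_multc simp del: nn_integral_const
      intro!: sum.cong, simp add: nn_integral_multc)

lemma max_law_mass: "(\<Sum>k\<le>n. (\<integral>\<^sup>+x. 1 \<partial>pos_law k) * (\<integral>\<^sup>+y. 1 \<partial>nonpos_law (n - k))) = 1"
proof -
  interpret J: prob_space "max_law n" by (rule prob_space_max_law)
  show ?thesis
    using max_law_fst[of "\<lambda>_. 1" n] by (simp add: J.emeasure_space_1)
qed

text \<open>Spitzer's identity is used for the times \<open>k \<ge> n - m\<close>, keeping the
  summands with at most \<open>m\<close> steps in the factor \<open>pos_law\<close>. For these
  \<open>j \<ge> k / 2\<close>, which absorbs the division by \<open>k\<close> at the cost of a
  factor 2. The masses of \<open>pos_law i\<close> on \<open>{..\<delta>}\<close> that appear are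
  then summed against \<open>nonpos_law\<close> and give the probabilities in \<open>small\<close>;
  their bound 1/2 is responsible for the second factor 2.\<close>

theorem max_law_lower_bound:
  fixes B :: "real set" and \<kappa> :: ennreal
  assumes B [measurable]: "B \<in> sets borel"
    and lower: "\<And>j y. 1 \<le> j \<Longrightarrow> j \<le> n \<Longrightarrow> 0 \<le> y \<Longrightarrow> y \<le> \<delta> \<Longrightarrow>
      of_nat j * \<kappa> \<le> (\<integral>\<^sup>+x. indicator {0<..} x * indicator B (x + y) \<partial>walk_law j)"
    and m: "0 < m" "4 * m \<le> n"
    and small: "\<And>q. q \<le> m \<Longrightarrow> 1 / 2 \<le> (\<integral>\<^sup>+z. indicator {..\<delta>} (fst z) \<partial>max_law q)"
  shows "of_nat m * \<kappa> \<le> 4 * (\<integral>\<^sup>+z. indicator B (fst z) \<partial>max_law n)"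
proof -
  define A where "A i = (\<integral>\<^sup>+x. indicator {..\<delta>} x \<partial>pos_law i)" for i
  define b where "b l = (\<integral>\<^sup>+y. 1 \<partial>nonpos_law l)" for l
  define a where "a k = (\<integral>\<^sup>+x. indicator B x \<partial>pos_law k)" for k
  have conv: "of_nat j * \<kappa> * A (k - j) \<le>
     (\<integral>\<^sup>+x. \<integral>\<^sup>+y. indicator {0<..} x * indicator B (x + y) \<partial>pos_law (k - j) \<partial>walk_law j)"
    if "1 \<le> j" "j \<le> n" for j k
  proof -
    have "of_nat j * \<kappa> * A (k - j) = (\<integral>\<^sup>+y. of_nat j * \<kappa> * indicator {..\<delta>} y \<partial>pos_law (k - j))"
      unfolding A_def by (rule nn_integral_cmult[symmetric]) auto
    also have "\<dots> \<le> (\<integral>\<^sup>+y. \<integral>\<^sup>+x. indicator {0<..} x * indicator B (x + y) \<partial>walk_law j \<partial>pos_law (k - j))"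
    proof (intro nn_integral_mono_AE)
      show "AE y in pos_law (k - j). of_nat j * \<kappa> * indicator {..\<delta>} y
          \<le> (\<integral>\<^sup>+x. indicator {0<..} x * indicator B (x + y) \<partial>walk_law j)"
        using AE_pos_law_nonneg[of "k - j"]
        by eventually_elim (use lower[OF that] in \<open>auto simp: indicator_def\<close>)
    qed
    also have "\<dots> = (\<integral>\<^sup>+x. \<integral>\<^sup>+y. indicator {0<..} x * indicator B (x + y) \<partial>pos_law (k - j) \<partial>walk_law j)"
      by (rule nn_integral_swap_borel) (auto intro: finite_borel_laws)
    finally show ?thesis .
  qed
  have a: "\<kappa> * (\<Sum>i\<le>m. A i) \<le> 2 * a k" if k: "n - m \<le> k" "k \<le> n" for k
  proof -
    have "of_nat k * (\<kappa> * (\<Sum>i\<le>m. A i)) = (\<Sum>i\<le>m. of_nat k * \<kappa> * A i)"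
      by (simp add: sum_distrib_left mult.assoc)
    also have "\<dots> \<le> (\<Sum>i\<le>m. 2 * (of_nat (k - i) * \<kappa> * A i))"
    proof (intro sum_mono)
      fix i assume "i \<in> {..m}"
      \<comment> \<open>This follows from \<open>k \<ge> n - m \<ge> 3 * m\<close> and
        \<open>i \<le> m\<close>.\<close>
      then have "k \<le> 2 * (k - i)" using k m by auto
      then have "of_nat k \<le> (of_nat (2 * (k - i)) :: ennreal)"
        by (rule of_nat_mono)
      then have "of_nat k * (\<kappa> * A i) \<le> of_nat (2 * (k - i)) * (\<kappa> * A i)"
        by (rule mult_right_mono) simp
      then show "of_nat k * \<kappa> * A i \<le> 2 * (of_nat (k - i) * \<kappa> * A i)"
        by (simp add: mult.assoc)
    qed
    also have "\<dots> = 2 * (\<Sum>i\<le>m. of_nat (k - i) * \<kappa> * A i)"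
      by (simp add: sum_distrib_left)
    also have "(\<Sum>i\<le>m. of_nat (k - i) * \<kappa> * A i) = (\<Sum>j\<in>{k - m..k}. of_nat j * \<kappa> * A (k - j))"
      using k m by (intro sum.reindex_bij_witness[where i = "\<lambda>j. k - j" and j = "\<lambda>i. k - i"]) auto
    also have "\<dots> \<le> (\<Sum>j\<in>{k - m..k}. \<integral>\<^sup>+x. \<integral>\<^sup>+y. indicator {0<..} x * indicator B (x + y)
        \<partial>pos_law (k - j) \<partial>walk_law j)"
      using k m by (intro sum_mono conv) auto
    also have "\<dots> \<le> pos_conv k (indicator B)"
      unfolding pos_conv_def using k m by (intro sum_mono2) auto
    also have "pos_conv k (indicator B) = of_nat k * a k"
      unfolding a_def by (rule spitzer(1)[symmetric]) (auto simp: indicator_def)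
    finally have *: "of_nat k * (\<kappa> * (\<Sum>i\<le>m. A i)) \<le> of_nat k * (2 * a k)"
      by (simp add: mult.left_commute mult_left_mono)
    have "0 < k" using k m by simp
    then have "(0 :: ennreal) < of_nat k" "(of_nat k :: ennreal) < \<top>"
      by (simp_all add: of_nat_less_top)
    then show ?thesis
      using * by (subst (asm) ennreal_mult_le_mult_iff) auto
  qed
  \<comment> \<open>The number \<open>m\<close> is written as a sum of halves so that each half can
    be replaced by the probability that the maximum of \<open>q\<close> steps is at most
    \<open>\<delta>\<close>, for \<open>q < m\<close>.\<close>
  have "of_nat m * \<kappa> = \<kappa> * (2 * (\<Sum>q<m. 1 / 2))"
  proof -
    have "2 * (\<Sum>q<m. 1 / 2) = of_nat m * (2 * (1 / 2 :: ennreal))"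
      by (simp only: sum_constant card_lessThan mult_ac)
    also have "\<dots> = of_nat m"
      by (simp add: ennreal_times_divide)
    finally show ?thesis by (simp only: mult.commute)
  qed
  also have "\<dots> \<le> \<kappa> * (2 * (\<Sum>q<m. \<Sum>i\<le>q. A i * b (q - i)))"
  proof (intro mult_left_mono sum_mono)
    fix q assume "q \<in> {..<m}"
    then show "1 / 2 \<le> (\<Sum>i\<le>q. A i * b (q - i))"
      using small[of q] by (simp add: max_law_fst A_def b_def)
  qed auto
  also have "(\<Sum>q<m. \<Sum>i\<le>q. A i * b (q - i)) = (\<Sum>(l, i)\<in>(SIGMA k:{..m}. {..<k}). A i * b (m - l))"
    unfolding sum_antidiagonals[of "\<lambda>i l. A i * b l", symmetric] by (simp add: sum.Sigma)
  also have "\<dots> \<le> (\<Sum>(l, i)\<in>{..m} \<times> {..m}. A i * b (m - l))"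
    by (intro sum_mono2) auto
  also have "\<dots> = (\<Sum>l\<le>m. \<Sum>i\<le>m. A i * b (m - l))"
    by (simp add: sum.cartesian_product)
  also have "\<kappa> * (2 * \<dots>) = 2 * (\<Sum>l\<le>m. (\<kappa> * (\<Sum>i\<le>m. A i)) * b (m - l))"
    by (simp add: sum_distrib_left sum_distrib_right mult_ac)
  also have "\<dots> \<le> 2 * (\<Sum>l\<le>m. (2 * a (n - m + l)) * b (m - l))"
    using m by (intro mult_left_mono sum_mono mult_right_mono a) auto
  also have "(\<Sum>l\<le>m. (2 * a (n - m + l)) * b (m - l)) = 2 * (\<Sum>l\<le>m. a (n - m + l) * b (m - l))"
    by (simp add: sum_distrib_left mult_ac)
  \<comment> \<open>With \<open>k = n - m + l\<close> one has \<open>n - k = m - l\<close>: the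
    masses of \<open>nonpos_law\<close> from the short walk of \<open>m\<close> steps are those of
    the last summands for the walk of \<open>n\<close> steps.\<close>
  also have "(\<Sum>l\<le>m. a (n - m + l) * b (m - l)) = (\<Sum>k\<in>{n - m..n}. a k * b (n - k))"
    using m by (intro sum.reindex_bij_witness[where i = "\<lambda>k. k + m - n" and j = "\<lambda>l. n - m + l"]) auto
  also have "\<dots> \<le> (\<Sum>k\<le>n. a k * b (n - k))"
    by (intro sum_mono2) auto
  also have "\<dots> = (\<integral>\<^sup>+z. indicator B (fst z) \<partial>max_law n)"
    by (simp add: max_law_fst a_def b_def)
  finally show ?thesis
    by (simp add: mult_left_mono mult.assoc[symmetric])
qed

section \<open>First passage of the positive walk above a level\<close>

text \<open>The law of the walk while it has stayed in \<open>(0, r]\<close>, and its law when it leaves this interval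
  upwards, exactly at time \<open>k \<ge> 1\<close>.\<close>

primrec below_law :: "real \<Rightarrow> nat \<Rightarrow> real measure" where
  "below_law r 0 = return borel 0"
| "below_law r (Suc k) = density (\<mu> \<star> below_law r k) (indicator {0<..r})"

definition exit_law :: "real \<Rightarrow> nat \<Rightarrow> real measure" where
  "exit_law r k = density (\<mu> \<star> below_law r (k - 1)) (indicator {r<..})"

lemma finite_borel_below_law: "finite_borel_measure (below_law r k)"
  by (induction k)
     (auto intro!: finite_borel_measure_convolution finite_borel_measure_return finite_borel_mu
       finite_borel_measure_density_indicator)

lemma finite_borel_exit_law: "finite_borel_measure (exit_law r k)"
  unfolding exit_law_def
  by (auto intro!: finite_borel_measure_convolution finite_borel_mu finite_borel_below_law
       finite_borel_measure_density_indicator)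

lemma sets_below_law [simp, measurable_cong]: "sets (below_law r k) = sets borel"
  using finite_borel_below_law[of r k] by (simp add: finite_borel_measure.M_is_borel)

lemma sets_exit_law [simp, measurable_cong]: "sets (exit_law r k) = sets borel"
  using finite_borel_exit_law[of r k] by (simp add: finite_borel_measure.M_is_borel)

lemma measurable_nn_integral_below_law [measurable (raw)]:
  assumes "case_prod f \<in> borel_measurable (N \<Otimes>\<^sub>M borel)"
  shows "(\<lambda>x. \<integral>\<^sup>+y. f x y \<partial>below_law r k) \<in> borel_measurable N"
    and "(\<lambda>x. \<integral>\<^sup>+y. f x y \<partial>exit_law r k) \<in> borel_measurable N"
proof -
  have "case_prod f \<in> borel_measurable (N \<Otimes>\<^sub>M below_law r k)"
    "case_prod f \<in> borel_measurable (N \<Otimes>\<^sub>M exit_law r k)"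
    using assms by (simp_all cong: measurable_cong_sets sets_pair_measure_cong)
  then show "(\<lambda>x. \<integral>\<^sup>+y. f x y \<partial>below_law r k) \<in> borel_measurable N"
    and "(\<lambda>x. \<integral>\<^sup>+y. f x y \<partial>exit_law r k) \<in> borel_measurable N"
    using finite_borel_below_law finite_borel_exit_law
    by (auto intro!: sigma_finite_measure.borel_measurable_nn_integral finite_borel_imp_sigma_finite)
qed

lemma nn_integral_below_law_Suc:
  assumes [measurable]: "f \<in> borel_measurable borel"
  shows "(\<integral>\<^sup>+x. f x \<partial>below_law r (Suc k)) =
    (\<integral>\<^sup>+x. \<integral>\<^sup>+y. indicator {0<..r} (x + y) * f (x + y) \<partial>below_law r k \<partial>\<mu>)"
  by (simp add: nn_integral_density nn_integral_convolution_borel finite_borel_laws finite_borel_below_law)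

lemma nn_integral_exit_law:
  assumes [measurable]: "f \<in> borel_measurable borel"
  shows "(\<integral>\<^sup>+x. f x \<partial>exit_law r (Suc k)) =
    (\<integral>\<^sup>+x. \<integral>\<^sup>+y. indicator {r<..} (x + y) * f (x + y) \<partial>below_law r k \<partial>\<mu>)"
  by (simp add: exit_law_def nn_integral_density nn_integral_convolution_borel finite_borel_laws finite_borel_below_law)

lemma AE_below_law:
  assumes "0 \<le> r"
  shows "AE x in below_law r k. x \<le> r"
proof (cases k)
  case 0
  show ?thesis unfolding 0 below_law.simps using assms by (subst AE_return) auto
next
  case (Suc k')
  show ?thesis unfolding Suc below_law.simps
    by (subst AE_density) (auto split: split_indicator)
qed

lemma AE_exit_law: "AE x in exit_law r k. r < x"
  unfolding exit_law_def by (subst AE_density) (auto split: split_indicator)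

lemma nn_integral_below_law_le:
  assumes "f \<in> borel_measurable borel"
  shows "(\<integral>\<^sup>+x. f x \<partial>below_law r k) \<le> (\<integral>\<^sup>+x. f x \<partial>pos_law k)"
  using assms
proof (induction k arbitrary: f)
  case (Suc k)
  note [measurable] = Suc.prems
  have "(\<integral>\<^sup>+x. f x \<partial>below_law r (Suc k)) \<le>
      (\<integral>\<^sup>+x. \<integral>\<^sup>+y. indicator {0<..} (x + y) * f (x + y) \<partial>below_law r k \<partial>\<mu>)"
    unfolding nn_integral_below_law_Suc[OF Suc.prems]
    by (intro nn_integral_mono mult_right_mono) (auto simp: indicator_def)
  also have "\<dots> \<le> (\<integral>\<^sup>+x. f x \<partial>pos_law (Suc k))"
    unfolding nn_integral_pos_law_Suc[OF Suc.prems]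
    by (intro nn_integral_mono Suc.IH) auto
  finally show ?case .
qed simp

text \<open>This is only an inequality because positivity is forgotten after the first passage above
  \<open>r\<close>. From then on the walk is free, so that the hypotheses on \<open>walk_law\<close>
  can be applied to the rest of it.\<close>

lemma pos_law_le_exit:
  assumes "f \<in> borel_measurable borel"
  shows "(\<integral>\<^sup>+x. f x \<partial>pos_law k) \<le> (\<integral>\<^sup>+x. f x \<partial>below_law r k) +
    (\<Sum>i=1..k. \<integral>\<^sup>+x. \<integral>\<^sup>+y. f (x + y) \<partial>walk_law (k - i) \<partial>exit_law r i)"
  using assms
proof (induction k arbitrary: f)
  case (Suc k)
  note [measurable] = Suc.prems
  let ?g = "\<lambda>x y. indicator {0<..} (x + y) * f (x + y)"
  have "(\<integral>\<^sup>+x. f x \<partial>pos_law (Suc k)) = (\<integral>\<^sup>+x. \<integral>\<^sup>+y. ?g x y \<partial>pos_law k \<partial>\<mu>)"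
    by (rule nn_integral_pos_law_Suc) fact
  also have "\<dots> \<le> (\<integral>\<^sup>+x. (\<integral>\<^sup>+y. ?g x y \<partial>below_law r k) +
      (\<Sum>i=1..k. \<integral>\<^sup>+u. \<integral>\<^sup>+y. ?g x (u + y) \<partial>walk_law (k - i) \<partial>exit_law r i) \<partial>\<mu>)"
    by (intro nn_integral_mono Suc.IH) auto
  also have "\<dots> = (\<integral>\<^sup>+x. \<integral>\<^sup>+y. ?g x y \<partial>below_law r k \<partial>\<mu>) +
      (\<Sum>i=1..k. \<integral>\<^sup>+x. \<integral>\<^sup>+u. \<integral>\<^sup>+y. ?g x (u + y) \<partial>walk_law (k - i) \<partial>exit_law r i \<partial>\<mu>)"
    by (simp add: nn_integral_add nn_integral_sum)
  also have "(\<integral>\<^sup>+x. \<integral>\<^sup>+y. ?g x y \<partial>below_law r k \<partial>\<mu>) \<le>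
      (\<integral>\<^sup>+x. \<integral>\<^sup>+y. indicator {0<..r} (x + y) * f (x + y) + indicator {r<..} (x + y) * f (x + y) \<partial>below_law r k \<partial>\<mu>)"
    by (intro nn_integral_mono) (auto simp: indicator_def)
  also have "\<dots> = (\<integral>\<^sup>+x. f x \<partial>below_law r (Suc k)) + (\<integral>\<^sup>+x. f x \<partial>exit_law r (Suc k))"
    by (simp add: nn_integral_add nn_integral_below_law_Suc nn_integral_exit_law del: below_law.simps)
  also have "(\<integral>\<^sup>+x. f x \<partial>exit_law r (Suc k)) =
      (\<integral>\<^sup>+x. \<integral>\<^sup>+y. f (x + y) \<partial>walk_law (Suc k - Suc k) \<partial>exit_law r (Suc k))"
    by (simp add: nn_integral_return)
  also have "(\<Sum>i=1..k. \<integral>\<^sup>+x. \<integral>\<^sup>+u. \<integral>\<^sup>+y. ?g x (u + y) \<partial>walk_law (k - i) \<partial>exit_law r i \<partial>\<mu>) \<le>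
     (\<Sum>i=1..k. \<integral>\<^sup>+u. \<integral>\<^sup>+y. f (u + y) \<partial>walk_law (Suc k - i) \<partial>exit_law r i)"
  proof (intro sum_mono)
    fix i assume i: "i \<in> {1..k}"
    have "(\<integral>\<^sup>+x. \<integral>\<^sup>+u. \<integral>\<^sup>+y. ?g x (u + y) \<partial>walk_law (k - i) \<partial>exit_law r i \<partial>\<mu>) \<le>
        (\<integral>\<^sup>+x. \<integral>\<^sup>+u. \<integral>\<^sup>+y. f (u + (x + y)) \<partial>walk_law (k - i) \<partial>exit_law r i \<partial>\<mu>)"
      by (intro nn_integral_mono) (auto simp: indicator_def add_ac)
    also have "\<dots> = (\<integral>\<^sup>+u. \<integral>\<^sup>+x. \<integral>\<^sup>+y. f (u + (x + y)) \<partial>walk_law (k - i) \<partial>\<mu> \<partial>exit_law r i)"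
      by (rule nn_integral_swap_borel) (auto intro: finite_borel_laws finite_borel_exit_law)
    also have "\<dots> = (\<integral>\<^sup>+u. \<integral>\<^sup>+y. f (u + y) \<partial>walk_law (Suc k - i) \<partial>exit_law r i)"
      using i by (simp add: Suc_diff_le nn_integral_walk_law_Suc del: walk_law.simps)
    finally show "(\<integral>\<^sup>+x. \<integral>\<^sup>+u. \<integral>\<^sup>+y. ?g x (u + y) \<partial>walk_law (k - i) \<partial>exit_law r i \<partial>\<mu>) \<le>
      (\<integral>\<^sup>+u. \<integral>\<^sup>+y. f (u + y) \<partial>walk_law (Suc k - i) \<partial>exit_law r i)" .
  qed
  finally show ?case
    by (simp add: add.assoc add_ac add_mono del: below_law.simps walk_law.simps)
qed simp

text \<open>The probability that the walk started at \<open>y\<close> is positive at the times \<open>1, \<dots>, j\<close>.\<close>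

primrec stay :: "nat \<Rightarrow> real \<Rightarrow> ennreal" where
  "stay 0 y = 1"
| "stay (Suc j) y = (\<integral>\<^sup>+x. indicator {0<..} (x + y) * stay j (x + y) \<partial>\<mu>)"

lemma stay_0: "stay 0 = (\<lambda>_. 1)"
  by (simp add: fun_eq_iff)

lemma measurable_stay [measurable]: "stay j \<in> borel_measurable borel"
proof (induction j)
  case (Suc j)
  note [measurable] = Suc
  have "stay (Suc j) = (\<lambda>y. \<integral>\<^sup>+x. indicator {0<..} (x + y) * stay j (x + y) \<partial>\<mu>)"
    by (simp add: fun_eq_iff)
  then show ?case by simp
qed (simp add: stay_0)

text \<open>The Markov property at time \<open>k\<close>.\<close>

lemma stay_pos_law: "(\<integral>\<^sup>+y. stay j y \<partial>pos_law k) = (\<integral>\<^sup>+y. 1 \<partial>pos_law (k + j))"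
proof (induction j arbitrary: k)
  case (Suc j)
  have "(\<integral>\<^sup>+y. stay (Suc j) y \<partial>pos_law k) =
      (\<integral>\<^sup>+x. \<integral>\<^sup>+y. indicator {0<..} (x + y) * stay j (x + y) \<partial>pos_law k \<partial>\<mu>)"
    unfolding stay.simps by (rule nn_integral_swap_borel) (auto intro: finite_borel_laws)
  also have "\<dots> = (\<integral>\<^sup>+y. stay j y \<partial>pos_law (Suc k))"
    by (rule nn_integral_pos_law_Suc[symmetric]) auto
  finally show ?case using Suc[of "Suc k"] by (simp del: pos_law.simps)
qed (simp add: stay_0)

lemma stay_below_law:
  "(\<integral>\<^sup>+y. stay (Suc j) y \<partial>below_law r k) \<ge>
   (\<integral>\<^sup>+y. stay j y \<partial>below_law r (Suc k)) + (\<integral>\<^sup>+y. stay j y \<partial>exit_law r (Suc k))" if "0 \<le> r"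
proof -
  have "(\<integral>\<^sup>+y. stay j y \<partial>below_law r (Suc k)) + (\<integral>\<^sup>+y. stay j y \<partial>exit_law r (Suc k)) =
    (\<integral>\<^sup>+x. \<integral>\<^sup>+y. indicator {0<..r} (x + y) * stay j (x + y) + indicator {r<..} (x + y) * stay j (x + y)
       \<partial>below_law r k \<partial>\<mu>)"
    by (simp add: nn_integral_add nn_integral_below_law_Suc nn_integral_exit_law del: below_law.simps)
  also have "\<dots> \<le> (\<integral>\<^sup>+x. \<integral>\<^sup>+y. indicator {0<..} (x + y) * stay j (x + y) \<partial>below_law r k \<partial>\<mu>)"
    using that by (intro nn_integral_mono) (auto simp: indicator_def)
  also have "\<dots> = (\<integral>\<^sup>+y. stay (Suc j) y \<partial>below_law r k)"
    unfolding stay.simps by (rule nn_integral_swap_borel) (auto intro: finite_borel_laws finite_borel_below_law)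
  finally show ?thesis .
qed

text \<open>The events of first passage above \<open>r\<close> at time \<open>i\<close>, followed by
  staying positive until time \<open>j + k\<close>, are disjoint for different \<open>i\<close> and
  from the event of no passage, and they all imply positivity until \<open>j + k\<close>. The
  parameter \<open>j\<close> carries the induction, in which each step moves one unit of time from
  \<open>k\<close> to \<open>j\<close>.\<close>

lemma stay_exit_law_sum:
  assumes "0 \<le> r"
  shows "(\<integral>\<^sup>+y. stay j y \<partial>below_law r k) + (\<Sum>i=1..k. \<integral>\<^sup>+y. stay (j + k - i) y \<partial>exit_law r i) \<le>
    (\<integral>\<^sup>+y. 1 \<partial>pos_law (j + k))"
proof (induction k arbitrary: j)
  case 0
  have "below_law r 0 = pos_law 0" by simp
  then show ?case using stay_pos_law[where j = j and k = 0] by (simp del: nn_integral_const pos_law.simps below_law.simps)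
next
  case (Suc k)
  have "(\<integral>\<^sup>+y. stay j y \<partial>below_law r (Suc k)) + (\<Sum>i=1..Suc k. \<integral>\<^sup>+y. stay (j + Suc k - i) y \<partial>exit_law r i) =
    ((\<integral>\<^sup>+y. stay j y \<partial>below_law r (Suc k)) + (\<integral>\<^sup>+y. stay j y \<partial>exit_law r (Suc k))) +
    (\<Sum>i=1..k. \<integral>\<^sup>+y. stay (Suc j + k - i) y \<partial>exit_law r i)"
    by (simp add: add_ac del: below_law.simps stay.simps)
  also have "\<dots> \<le> (\<integral>\<^sup>+y. stay (Suc j) y \<partial>below_law r k) + (\<Sum>i=1..k. \<integral>\<^sup>+y. stay (Suc j + k - i) y \<partial>exit_law r i)"
    by (intro add_right_mono stay_below_law assms)
  also have "\<dots> \<le> (\<integral>\<^sup>+y. 1 \<partial>pos_law (Suc j + k))"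
    by (rule Suc)
  finally show ?case by (simp del: nn_integral_const pos_law.simps stay.simps below_law.simps)
qed

text \<open>The passage probability has to be compared with the mass of \<open>pos_law k\<close>
  rather than with 1, since only then is its sum against \<open>nonpos_law (n - k)\<close>
  controlled. The comparison holds because a walk that has passed above \<open>r\<close> stays
  positive until time \<open>k\<close> with probability at least 1/2.\<close>

lemma exit_law_sum_le:
  assumes "0 \<le> r" and stay: "\<And>j y. j \<le> k \<Longrightarrow> r < y \<Longrightarrow> 1 / 2 \<le> stay j y"
  shows "(\<Sum>i=1..k. \<integral>\<^sup>+y. 1 \<partial>exit_law r i) \<le> 2 * (\<integral>\<^sup>+y. 1 \<partial>pos_law k)"
proof -
  have "(\<integral>\<^sup>+y. 1 \<partial>exit_law r i) \<le> 2 * (\<integral>\<^sup>+y. stay (k - i) y \<partial>exit_law r i)" for i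
  proof -
    have "(\<integral>\<^sup>+y. 1 \<partial>exit_law r i) \<le> (\<integral>\<^sup>+y. 2 * stay (k - i) y \<partial>exit_law r i)"
    proof (intro nn_integral_mono_AE)
      show "AE y in exit_law r i. 1 \<le> 2 * stay (k - i) y"
        using AE_exit_law
      proof eventually_elim
        case (elim y)
        then have "2 * (1 / 2) \<le> 2 * stay (k - i) y"
          by (intro mult_left_mono stay) auto
        then show ?case by (simp add: ennreal_times_divide)
      qed
    qed
    then show ?thesis by (simp add: nn_integral_cmult del: nn_integral_const)
  qed
  then have "(\<Sum>i=1..k. \<integral>\<^sup>+y. 1 \<partial>exit_law r i) \<le> 2 * (\<Sum>i=1..k. \<integral>\<^sup>+y. stay (k - i) y \<partial>exit_law r i)"
    unfolding sum_distrib_left by (intro sum_mono)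
  also have "(\<Sum>i=1..k. \<integral>\<^sup>+y. stay (k - i) y \<partial>exit_law r i) \<le>
      (\<integral>\<^sup>+y. stay 0 y \<partial>below_law r k) + (\<Sum>i=1..k. \<integral>\<^sup>+y. stay (0 + k - i) y \<partial>exit_law r i)"
    by simp
  also note stay_exit_law_sum[OF assms(1), where j = 0 and k = k]
  finally show ?thesis by (simp add: mult_left_mono del: nn_integral_const stay.simps)
qed

text \<open>The level is \<open>4 * \<rho>\<close>, and the walk is stopped above
  \<open>2 * \<rho>\<close>. A landing at or below \<open>3 * \<rho>\<close> costs
  \<open>n * \<kappa>\<close> times the passage probability, which \<open>exit_law_sum_le\<close>
  turns into \<open>2 * n * \<kappa> * a k\<close>. A longer overshoot costs \<open>\<kappa>\<close>
  times the mass before the step, in total at most \<open>\<kappa>\<close> times the sum of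
  \<open>a i\<close> over \<open>i < k\<close>. Summed against \<open>b (n - k)\<close> these give
  \<open>2 * n\<close> and \<open>n\<close>, hence the factor 3.\<close>

theorem max_law_upper_bound:
  fixes B :: "real set" and \<kappa> :: ennreal
  assumes B [measurable]: "B \<in> sets borel" and B_sub: "B \<subseteq> {4 * \<rho><..}" and \<rho>: "0 < \<rho>"
    and upper: "\<And>j y. 1 \<le> j \<Longrightarrow> j \<le> n \<Longrightarrow>
      (\<integral>\<^sup>+x. indicator {\<rho><..} x * indicator B (x + y) \<partial>walk_law j) \<le> of_nat j * \<kappa>"
    and stay: "\<And>j y. j \<le> n \<Longrightarrow> 2 * \<rho> < y \<Longrightarrow> 1 / 2 \<le> stay j y"
  shows "(\<integral>\<^sup>+z. indicator B (fst z) \<partial>max_law n) \<le> of_nat (3 * n) * \<kappa>"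
proof -
  define a where "a k = (\<integral>\<^sup>+y. 1 \<partial>pos_law k)" for k
  define b where "b l = (\<integral>\<^sup>+y. 1 \<partial>nonpos_law l)" for l
  define e where "e i = (\<integral>\<^sup>+y. 1 \<partial>exit_law (2 * \<rho>) i)" for i
  have upper_mu: "(\<integral>\<^sup>+x. indicator {\<rho><..} x * indicator B (x + y) \<partial>\<mu>) \<le> \<kappa>" if "0 < n" for y
    using upper[of 1 y] that by (simp add: nn_integral_walk_law_Suc nn_integral_return del: walk_law.simps(2))
  have exit: "(\<integral>\<^sup>+x. \<integral>\<^sup>+y. indicator B (x + y) \<partial>walk_law (k - i) \<partial>exit_law (2 * \<rho>) i) \<le>
      of_nat n * \<kappa> * e i + \<kappa> * a (i - 1)" if i: "1 \<le> i" "i \<le> k" "k \<le> n" for i k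
  proof -
    have near: "indicator {..3 * \<rho>} x * (\<integral>\<^sup>+y. indicator B (x + y) \<partial>walk_law (k - i)) \<le> of_nat n * \<kappa>" for x
    proof (cases "x \<le> 3 * \<rho> \<and> i < k")
      case True
      have "(\<integral>\<^sup>+y. indicator B (x + y) \<partial>walk_law (k - i)) \<le>
          (\<integral>\<^sup>+y. indicator {\<rho><..} y * indicator B (y + x) \<partial>walk_law (k - i))"
        using B_sub True by (intro nn_integral_mono) (auto simp: indicator_def add_ac)
      also have "\<dots> \<le> of_nat (k - i) * \<kappa>"
        using True i by (intro upper) auto
      also have "\<dots> \<le> of_nat n * \<kappa>"
        using i by (intro mult_right_mono of_nat_mono) auto
      finally show ?thesis using True by simp
    next
      case False
      then show ?thesis
      proof (cases "x \<le> 3 * \<rho>")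
        case True
        \<comment> \<open>No step is left, and the position itself is too low to be in
          \<open>B\<close>.\<close>
        with False i have "k - i = 0" by simp
        moreover have "x \<notin> B" using B_sub True \<rho> by auto
        ultimately show ?thesis by (simp add: nn_integral_return)
      qed simp
    qed
    have far: "(\<integral>\<^sup>+x. indicator {3 * \<rho><..} x * (\<integral>\<^sup>+y. indicator B (x + y) \<partial>walk_law (k - i)) \<partial>exit_law (2 * \<rho>) i)
        \<le> \<kappa> * a (i - 1)"
    proof -
      obtain i' where i': "i = Suc i'" using i by (cases i) auto
      have "(\<integral>\<^sup>+x. indicator {3 * \<rho><..} x * (\<integral>\<^sup>+y. indicator B (x + y) \<partial>walk_law (k - i)) \<partial>exit_law (2 * \<rho>) i) =
        (\<integral>\<^sup>+w. \<integral>\<^sup>+u. indicator {2 * \<rho><..} (w + u) * (indicator {3 * \<rho><..} (w + u) *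
           (\<integral>\<^sup>+y. indicator B (w + u + y) \<partial>walk_law (k - i))) \<partial>below_law (2 * \<rho>) i' \<partial>\<mu>)"
        unfolding i' by (subst nn_integral_exit_law) auto
      also have "\<dots> \<le> (\<integral>\<^sup>+w. \<integral>\<^sup>+u. \<integral>\<^sup>+y. indicator {\<rho><..} w * indicator B (w + (u + y)) \<partial>walk_law (k - i)
          \<partial>below_law (2 * \<rho>) i' \<partial>\<mu>)"
      proof (rule nn_integral_mono, rule nn_integral_mono_AE)
        fix w
        show "AE u in below_law (2 * \<rho>) i'. indicator {2 * \<rho><..} (w + u) * (indicator {3 * \<rho><..} (w + u) *
           (\<integral>\<^sup>+y. indicator B (w + u + y) \<partial>walk_law (k - i))) \<le>
           (\<integral>\<^sup>+y. indicator {\<rho><..} w * indicator B (w + (u + y)) \<partial>walk_law (k - i))"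
          using AE_below_law[of "2 * \<rho>" i', simplified]
          by (rule AE_mp) (use \<rho> in \<open>auto simp: add.assoc split: split_indicator\<close>)
      qed
      \<comment> \<open>The overshooting step \<open>w\<close> is integrated first, with the
        position \<open>u\<close> before it and the displacement \<open>y\<close> after it frozen.
        This brings in the hypothesis for a single step, with \<open>B\<close> shifted by
        \<open>u + y\<close>.\<close>
      also have "\<dots> = (\<integral>\<^sup>+u. \<integral>\<^sup>+w. \<integral>\<^sup>+y. indicator {\<rho><..} w * indicator B (w + (u + y)) \<partial>walk_law (k - i)
          \<partial>\<mu> \<partial>below_law (2 * \<rho>) i')"
        by (rule nn_integral_swap_borel) (auto intro: finite_borel_laws finite_borel_below_law)
      also have "\<dots> = (\<integral>\<^sup>+u. \<integral>\<^sup>+y. \<integral>\<^sup>+w. indicator {\<rho><..} w * indicator B (w + (u + y)) \<partial>\<mu> \<partial>walk_law (k - i)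
          \<partial>below_law (2 * \<rho>) i')"
        by (intro nn_integral_cong nn_integral_swap_borel) (auto intro: finite_borel_laws)
      also have "\<dots> \<le> (\<integral>\<^sup>+u. \<integral>\<^sup>+y. \<kappa> * 1 \<partial>walk_law (k - i) \<partial>below_law (2 * \<rho>) i')"
        using i by (intro nn_integral_mono) (simp add: upper_mu)
      also have "\<dots> \<le> (\<integral>\<^sup>+u. \<kappa> * 1 \<partial>below_law (2 * \<rho>) i')"
      proof (rule nn_integral_mono)
        fix u
        have "(\<integral>\<^sup>+y. \<kappa> * 1 \<partial>walk_law (k - i)) = \<kappa> * (\<integral>\<^sup>+y. 1 \<partial>walk_law (k - i))"
          by (rule nn_integral_cmult) auto
        also have "\<dots> \<le> \<kappa> * 1"
          by (intro mult_left_mono nn_integral_le_1) auto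
        finally show "(\<integral>\<^sup>+y. \<kappa> * 1 \<partial>walk_law (k - i)) \<le> \<kappa> * 1" .
      qed
      also have "\<dots> = \<kappa> * (\<integral>\<^sup>+u. 1 \<partial>below_law (2 * \<rho>) i')"
        by (subst nn_integral_cmult) auto
      also have "\<dots> \<le> \<kappa> * a (i - 1)"
        unfolding a_def i' by (intro mult_left_mono) (auto intro!: nn_integral_below_law_le simp del: nn_integral_const)
      finally show ?thesis .
    qed
    have "(\<integral>\<^sup>+x. \<integral>\<^sup>+y. indicator B (x + y) \<partial>walk_law (k - i) \<partial>exit_law (2 * \<rho>) i) =
      (\<integral>\<^sup>+x. indicator {..3 * \<rho>} x * (\<integral>\<^sup>+y. indicator B (x + y) \<partial>walk_law (k - i)) +
         indicator {3 * \<rho><..} x * (\<integral>\<^sup>+y. indicator B (x + y) \<partial>walk_law (k - i)) \<partial>exit_law (2 * \<rho>) i)"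
      by (intro nn_integral_cong) (auto split: split_indicator)
    also have "\<dots> = (\<integral>\<^sup>+x. indicator {..3 * \<rho>} x * (\<integral>\<^sup>+y. indicator B (x + y) \<partial>walk_law (k - i)) \<partial>exit_law (2 * \<rho>) i) +
         (\<integral>\<^sup>+x. indicator {3 * \<rho><..} x * (\<integral>\<^sup>+y. indicator B (x + y) \<partial>walk_law (k - i)) \<partial>exit_law (2 * \<rho>) i)"
      by (rule nn_integral_add) auto
    also have "\<dots> \<le> (\<integral>\<^sup>+x. of_nat n * \<kappa> * 1 \<partial>exit_law (2 * \<rho>) i) + \<kappa> * a (i - 1)"
      using near by (intro add_mono far nn_integral_mono) simp
    also have "(\<integral>\<^sup>+x. of_nat n * \<kappa> * 1 \<partial>exit_law (2 * \<rho>) i) = of_nat n * \<kappa> * e i"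
      unfolding e_def by (subst nn_integral_cmult) auto
    finally show ?thesis .
  qed
  have a_B: "(\<integral>\<^sup>+x. indicator B x \<partial>pos_law k) \<le> of_nat (2 * n) * \<kappa> * a k + \<kappa> * (\<Sum>i<k. a i)" if k: "k \<le> n" for k
  proof -
    have "AE x in below_law (2 * \<rho>) k. indicator B x = (0 :: ennreal)"
    proof -
      have "0 \<le> 2 * \<rho>" using \<rho> by simp
      from AE_below_law[OF this, of k] show ?thesis
        by eventually_elim (use B_sub \<rho> in \<open>force split: split_indicator\<close>)
    qed
    then have "(\<integral>\<^sup>+x. indicator B x \<partial>below_law (2 * \<rho>) k) = 0"
      by (subst nn_integral_0_iff_AE) auto
    then have "(\<integral>\<^sup>+x. indicator B x \<partial>pos_law k) \<le>
        (\<Sum>i=1..k. \<integral>\<^sup>+x. \<integral>\<^sup>+y. indicator B (x + y) \<partial>walk_law (k - i) \<partial>exit_law (2 * \<rho>) i)"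
      using pos_law_le_exit[of "indicator B" k "2 * \<rho>"] by simp
    also have "\<dots> \<le> (\<Sum>i=1..k. of_nat n * \<kappa> * e i + \<kappa> * a (i - 1))"
      using k by (intro sum_mono exit) auto
    also have "\<dots> = of_nat n * \<kappa> * (\<Sum>i=1..k. e i) + \<kappa> * (\<Sum>i<k. a i)"
      by (simp add: sum.distrib sum_distrib_left sum.atLeast1_atMost_eq)
    also have "\<dots> \<le> of_nat n * \<kappa> * (2 * a k) + \<kappa> * (\<Sum>i<k. a i)"
      unfolding e_def a_def using k \<rho> by (intro add_mono mult_left_mono exit_law_sum_le stay) auto
    finally show ?thesis by (simp add: mult_ac)
  qed
  have "(\<integral>\<^sup>+z. indicator B (fst z) \<partial>max_law n) =
      (\<Sum>k\<le>n. (\<integral>\<^sup>+x. indicator B x \<partial>pos_law k) * b (n - k))"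
    by (simp add: max_law_fst b_def)
  also have "\<dots> \<le> (\<Sum>k\<le>n. (of_nat (2 * n) * \<kappa> * a k + \<kappa> * (\<Sum>i<k. a i)) * b (n - k))"
    by (intro sum_mono mult_right_mono a_B) auto
  also have "\<dots> = of_nat (2 * n) * \<kappa> * (\<Sum>k\<le>n. a k * b (n - k)) + \<kappa> * (\<Sum>k\<le>n. \<Sum>i<k. a i * b (n - k))"
    by (simp add: sum.distrib sum_distrib_left sum_distrib_right distrib_left distrib_right mult_ac)
  also have "(\<Sum>k\<le>n. a k * b (n - k)) = 1"
    unfolding a_def b_def by (rule max_law_mass)
  also have "(\<Sum>k\<le>n. \<Sum>i<k. a i * b (n - k)) = (\<Sum>q<n. \<Sum>i\<le>q. a i * b (q - i))"
    by (rule sum_antidiagonals)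
  also have "\<dots> = of_nat n"
    unfolding a_def b_def max_law_mass by simp
  also have "of_nat (2 * n) * \<kappa> * 1 + \<kappa> * of_nat n = of_nat (2 * n + n) * \<kappa>"
    by (simp only: of_nat_add distrib_right mult_1_right) (simp only: mult.commute)
  finally show ?thesis
    by simp
qed

text \<open>The Markov property at time \<open>s\<close>; the position at that time is
  \<open>fst z + snd z\<close>.\<close>

lemma max_law_add:
  assumes "f \<in> borel_measurable borel"
  shows "(\<integral>\<^sup>+z. f (fst z) \<partial>max_law (s + m)) =
    (\<integral>\<^sup>+z. \<integral>\<^sup>+w. f (max (fst z) (fst z + snd z + fst w)) \<partial>max_law m \<partial>max_law s)"
  using assms
proof (induction s arbitrary: f)
  case 0
  note [measurable] = 0
  interpret J: prob_space "max_law m" by (rule prob_space_max_law)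
  have "(\<integral>\<^sup>+z. f (fst z) \<partial>max_law m) = (\<integral>\<^sup>+z. f (max 0 (fst z)) \<partial>max_law m)"
    using AE_max_law[of m] by (intro nn_integral_cong_AE) (auto elim!: eventually_mono)
  also have "\<dots> = (\<integral>\<^sup>+z. \<integral>\<^sup>+w. f (max (fst z) (fst z + snd z + fst w)) \<partial>max_law m \<partial>max_law 0)"
    unfolding max_law.simps by (subst nn_integral_return) (simp_all add: space_pair_measure)
  finally show ?case by simp
next
  case (Suc s)
  note [measurable] = Suc.prems
  interpret J: prob_space "max_law m" by (rule prob_space_max_law)
  have "(\<integral>\<^sup>+z. f (fst z) \<partial>max_law (Suc s + m)) =
     (\<integral>\<^sup>+x. \<integral>\<^sup>+z. f (max 0 (x + fst z)) \<partial>max_law (s + m) \<partial>\<mu>)"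
    unfolding add_Suc
    by (subst nn_integral_max_law_Suc, measurable)
       (auto intro!: nn_integral_cong arg_cong[where f = f])
  also have "\<dots> = (\<integral>\<^sup>+x. \<integral>\<^sup>+z. \<integral>\<^sup>+w. f (max 0 (x + max (fst z) (fst z + snd z + fst w)))
       \<partial>max_law m \<partial>max_law s \<partial>\<mu>)"
    by (intro nn_integral_cong) (subst Suc.IH, auto)
  also have "\<dots> = (\<integral>\<^sup>+z. \<integral>\<^sup>+w. f (max (fst z) (fst z + snd z + fst w)) \<partial>max_law m \<partial>max_law (Suc s))"
    by (subst nn_integral_max_law_Suc, measurable)
       (auto intro!: nn_integral_cong arg_cong[where f = f])
  finally show ?case .
qed

text \<open>For long times the hypothesis on \<open>stay\<close> may fail. It is only needed for blocks of \<open>m\<close> steps: if the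
  maximum is attained in a given block, then the position at its start or the maximum within it
  exceeds half of the level.\<close>

theorem max_law_upper_bound_blocks:
  fixes B :: "real set" and \<kappa> :: ennreal
  assumes B [measurable]: "B \<in> sets borel" and B_sub: "B \<subseteq> {8 * \<rho><..}" and \<rho>: "0 < \<rho>"
    and upper: "\<And>j y. 1 \<le> j \<Longrightarrow> j \<le> N * m \<Longrightarrow>
      (\<integral>\<^sup>+x. indicator {\<rho><..} x * indicator B (x + y) \<partial>walk_law j) \<le> of_nat j * \<kappa>"
    and stay: "\<And>j y. j \<le> m \<Longrightarrow> 2 * \<rho> < y \<Longrightarrow> 1 / 2 \<le> stay j y"
  shows "(\<integral>\<^sup>+z. indicator B (fst z) \<partial>max_law (N * m)) \<le> of_nat (N * (N * m + 3 * m)) * \<kappa>"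
proof -
  interpret J: prob_space "max_law n" for n by (rule prob_space_max_law)
  \<comment> \<open>Each block contributes \<open>N * m\<close> for a large position at its start
    and \<open>3 * m\<close> for a large maximum within it. Bounding the number of steps before the
    block by \<open>N * m\<close> makes this increment the same for all blocks.\<close>
  have "(\<integral>\<^sup>+z. indicator B (fst z) \<partial>max_law (L * m)) \<le> of_nat (L * (N * m + 3 * m)) * \<kappa>"
    if "L \<le> N" for L
    using that
  proof (induction L)
    case 0
    have "0 \<notin> B" using B_sub \<rho> by auto
    then show ?case by (simp add: nn_integral_return space_pair_measure)
  next
    case (Suc L)
    have small: "(\<integral>\<^sup>+x. indicator {4 * \<rho><..} x * indicator B (x + v) \<partial>walk_law (L * m)) \<le> of_nat (N * m) * \<kappa>" for v
    proof (cases "L * m = 0")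
      case True
      show ?thesis unfolding True using \<rho> by (simp add: nn_integral_return)
    next
      case False
      have "(\<integral>\<^sup>+x. indicator {4 * \<rho><..} x * indicator B (x + v) \<partial>walk_law (L * m)) \<le>
          (\<integral>\<^sup>+x. indicator {\<rho><..} x * indicator B (x + v) \<partial>walk_law (L * m))"
        using \<rho> by (intro nn_integral_mono) (auto simp: indicator_def)
      also have "\<dots> \<le> of_nat (L * m) * \<kappa>"
        using False Suc.prems by (intro upper) auto
      also have "\<dots> \<le> of_nat (N * m) * \<kappa>"
        using Suc.prems by (intro mult_right_mono of_nat_mono) auto
      finally show ?thesis .
    qed
    \<comment> \<open>The previous bound is applied to the translate of \<open>B\<close> by
      \<open>-x\<close>, cut to \<open>{4 * \<rho><..}\<close>. Its hypothesis is inherited because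
      \<open>upper\<close> is assumed for all shifts \<open>y\<close>.\<close>
    have large: "(\<integral>\<^sup>+w. indicator {4 * \<rho><..} (fst w) * indicator B (x + fst w) \<partial>max_law m) \<le> of_nat (3 * m) * \<kappa>" for x
    proof -
      have "(\<integral>\<^sup>+w. indicator {4 * \<rho><..} (fst w) * indicator B (x + fst w) \<partial>max_law m) =
         (\<integral>\<^sup>+w. indicator ({4 * \<rho><..} \<inter> {v. x + v \<in> B}) (fst w) \<partial>max_law m)"
        by (intro nn_integral_cong) (auto simp: indicator_def)
      also have "\<dots> \<le> of_nat (3 * m) * \<kappa>"
      proof (rule max_law_upper_bound)
        fix j :: nat and y
        assume j: "1 \<le> j" "j \<le> m"
        have "(\<integral>\<^sup>+u. indicator {\<rho><..} u * indicator ({4 * \<rho><..} \<inter> {v. x + v \<in> B}) (u + y) \<partial>walk_law j) \<le>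
          (\<integral>\<^sup>+u. indicator {\<rho><..} u * indicator B (u + (x + y)) \<partial>walk_law j)"
          by (intro nn_integral_mono) (auto simp: indicator_def add_ac)
        also have "\<dots> \<le> of_nat j * \<kappa>"
          using j Suc.prems by (intro upper) (auto intro: order_trans)
        finally show "(\<integral>\<^sup>+u. indicator {\<rho><..} u * indicator ({4 * \<rho><..} \<inter> {v. x + v \<in> B}) (u + y) \<partial>walk_law j)
          \<le> of_nat j * \<kappa>" .
      qed (use \<rho> stay in auto)
      finally show ?thesis .
    qed
    \<comment> \<open>A point of \<open>B\<close> exceeds \<open>8 * \<rho>\<close>, so if it is the
      sum of a position and a block maximum, one of the two exceeds
      \<open>4 * \<rho>\<close>.\<close>
    have split: "indicator B (max (fst z) (fst z + snd z + fst w)) \<le>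
       indicator B (fst z) + (indicator {4 * \<rho><..} (fst z + snd z) * indicator B (fst z + snd z + fst w) +
       (indicator {4 * \<rho><..} (fst w) * indicator B (fst z + snd z + fst w) :: ennreal))" for z w :: "real \<times> real"
      using B_sub by (force simp: indicator_def max_def)
    have "(\<integral>\<^sup>+z. indicator B (fst z) \<partial>max_law (Suc L * m)) =
       (\<integral>\<^sup>+z. \<integral>\<^sup>+w. indicator B (max (fst z) (fst z + snd z + fst w)) \<partial>max_law m \<partial>max_law (L * m))"
      unfolding mult_Suc add.commute[of m] by (rule max_law_add) auto
    also have "\<dots> \<le> (\<integral>\<^sup>+z. \<integral>\<^sup>+w. indicator B (fst z) +
       (indicator {4 * \<rho><..} (fst z + snd z) * indicator B (fst z + snd z + fst w) +
       indicator {4 * \<rho><..} (fst w) * indicator B (fst z + snd z + fst w)) \<partial>max_law m \<partial>max_law (L * m))"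
      by (intro nn_integral_mono split)
    also have "\<dots> = (\<integral>\<^sup>+z. indicator B (fst z) \<partial>max_law (L * m)) +
      ((\<integral>\<^sup>+z. \<integral>\<^sup>+w. indicator {4 * \<rho><..} (fst z + snd z) * indicator B (fst z + snd z + fst w) \<partial>max_law m \<partial>max_law (L * m)) +
       (\<integral>\<^sup>+z. \<integral>\<^sup>+w. indicator {4 * \<rho><..} (fst w) * indicator B (fst z + snd z + fst w) \<partial>max_law m \<partial>max_law (L * m)))"
      by (simp add: nn_integral_add J.emeasure_space_1)
    also have "(\<integral>\<^sup>+z. \<integral>\<^sup>+w. indicator {4 * \<rho><..} (fst z + snd z) * indicator B (fst z + snd z + fst w) \<partial>max_law m \<partial>max_law (L * m)) =
       (\<integral>\<^sup>+x. \<integral>\<^sup>+w. indicator {4 * \<rho><..} x * indicator B (x + fst w) \<partial>max_law m \<partial>walk_law (L * m))"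
      by (subst max_law_sum[symmetric]) auto
    also have "\<dots> = (\<integral>\<^sup>+w. \<integral>\<^sup>+x. indicator {4 * \<rho><..} x * indicator B (x + fst w) \<partial>walk_law (L * m) \<partial>max_law m)"
    proof -
      interpret W: finite_borel_measure "walk_law (L * m)" by (rule finite_borel_laws)
      interpret P: pair_sigma_finite "max_law m" "walk_law (L * m)" ..
      show ?thesis
        using P.Fubini[of "\<lambda>(w, x). indicator {4 * \<rho><..} x * indicator B (x + fst w)"] by simp
    qed
    also have "\<dots> \<le> (\<integral>\<^sup>+w. of_nat (N * m) * \<kappa> \<partial>max_law m)"
      by (intro nn_integral_mono small)
    also have "\<dots> = of_nat (N * m) * \<kappa>"
      by (simp add: J.emeasure_space_1)
    also have "(\<integral>\<^sup>+z. \<integral>\<^sup>+w. indicator {4 * \<rho><..} (fst w) * indicator B (fst z + snd z + fst w) \<partial>max_law m \<partial>max_law (L * m))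
       \<le> (\<integral>\<^sup>+z. of_nat (3 * m) * \<kappa> \<partial>max_law (L * m))"
      by (intro nn_integral_mono large)
    also have "\<dots> = of_nat (3 * m) * \<kappa>"
      by (simp add: J.emeasure_space_1)
    also have "(\<integral>\<^sup>+z. indicator B (fst z) \<partial>max_law (L * m)) \<le> of_nat (L * (N * m + 3 * m)) * \<kappa>"
      using Suc by simp
    finally show ?case
      by (simp add: distrib_right add_ac add_mono)
  qed
  then show ?thesis by simp
qed

section \<open>The minimum of the walk and the probability of staying positive\<close>

primrec min_law :: "nat \<Rightarrow> real measure" where
  "min_law 0 = return borel 0"
| "min_law (Suc n) = distr (\<mu> \<Otimes>\<^sub>M min_law n) borel (\<lambda>(x, m). min 0 (x + m))"

lemma sets_min_law [simp, measurable_cong]: "sets (min_law n) = sets borel"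
  by (cases n) auto

lemma prob_space_min_law: "prob_space (min_law n)"
proof (induction n)
  case 0
  show ?case by (auto intro!: prob_space_return)
next
  case (Suc n)
  interpret J: prob_space "min_law n" by fact
  interpret P: pair_prob_space \<mu> "min_law n" ..
  show ?case
    unfolding min_law.simps by (rule P.prob_space_distr) measurable
qed

lemma nn_integral_min_law_Suc:
  assumes [measurable]: "f \<in> borel_measurable borel"
  shows "(\<integral>\<^sup>+z. f z \<partial>min_law (Suc n)) = (\<integral>\<^sup>+x. \<integral>\<^sup>+m. f (min 0 (x + m)) \<partial>min_law n \<partial>\<mu>)"
proof -
  interpret J: prob_space "min_law n" by (rule prob_space_min_law)
  show ?thesis
    by (simp add: nn_integral_distr J.nn_integral_fst[symmetric] split_beta')
qed

lemma AE_min_law: "AE m in min_law n. m \<le> 0"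
proof (cases n)
  case 0
  show ?thesis unfolding 0 min_law.simps by (subst AE_return) auto
next
  case (Suc n')
  show ?thesis unfolding Suc min_law.simps by (subst AE_distr_iff) auto
qed

text \<open>The minimum includes time 0 while \<open>stay\<close> does not, whence the inequality.
  It links the recursively defined \<open>stay\<close> to an event for paths, so that a lower bound
  for \<open>stay\<close> follows from a probability estimate.\<close>

lemma min_law_le_stay: "(\<integral>\<^sup>+m. indicator {0<..} (y + m) \<partial>min_law j) \<le> stay j y"
proof (induction j arbitrary: y)
  case 0
  show ?case by (simp add: nn_integral_return indicator_def)
next
  case (Suc j)
  have "(\<integral>\<^sup>+m. indicator {0<..} (y + m) \<partial>min_law (Suc j)) =
      (\<integral>\<^sup>+x. \<integral>\<^sup>+m. indicator {0<..} (y + min 0 (x + m)) \<partial>min_law j \<partial>\<mu>)"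
    by (rule nn_integral_min_law_Suc) auto
  also have "\<dots> \<le> (\<integral>\<^sup>+x. \<integral>\<^sup>+m. indicator {0<..} (x + y) * indicator {0<..} (x + y + m) \<partial>min_law j \<partial>\<mu>)"
  proof (rule nn_integral_mono, rule nn_integral_mono_AE)
    fix x
    show "AE m in min_law j. indicator {0<..} (y + min 0 (x + m)) \<le>
        (indicator {0<..} (x + y) * indicator {0<..} (x + y + m) :: ennreal)"
      using AE_min_law[of j] by eventually_elim (auto simp: indicator_def min_def split: if_splits)
  qed
  also have "\<dots> = (\<integral>\<^sup>+x. indicator {0<..} (x + y) * (\<integral>\<^sup>+m. indicator {0<..} (x + y + m) \<partial>min_law j) \<partial>\<mu>)"
    by (intro nn_integral_cong nn_integral_cmult) auto
  also have "\<dots> \<le> (\<integral>\<^sup>+x. indicator {0<..} (x + y) * stay j (x + y) \<partial>\<mu>)"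
    by (intro nn_integral_mono mult_left_mono Suc) auto
  finally show ?case by simp
qed

end

section \<open>Walks with independent identically distributed increments\<close>

text \<open>\<open>Z n s\<close> folds \<open>H\<close> over the increments with indices from
  \<open>s\<close> to \<open>s + n - 1\<close>. Its recursion splits off the first of them, which is
  independent of the rest, so the law obeys the recursion of \<open>K\<close>. The maximum and the
  minimum of a walk are both instances.\<close>

lemma (in prob_space) iid_fold_law:
  fixes \<xi> :: "nat \<Rightarrow> 'a \<Rightarrow> real" and Z :: "nat \<Rightarrow> nat \<Rightarrow> 'a \<Rightarrow> 'z"
  assumes ind: "indep_vars (\<lambda>_. borel) \<xi> {..<N}"
    and law: "\<And>i. i < N \<Longrightarrow> distr M borel (\<xi> i) = \<mu>"
    and H [measurable]: "H \<in> borel \<Otimes>\<^sub>M S \<rightarrow>\<^sub>M S" and z: "z \<in> space S"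
    and Z_0: "\<And>s \<omega>. Z 0 s \<omega> = z"
    and Z_Suc: "\<And>n s \<omega>. Z (Suc n) s \<omega> = H (\<xi> s \<omega>, Z n (Suc s) \<omega>)"
    and K_0: "K 0 = return S z"
    and K_Suc: "\<And>n. K (Suc n) = distr (\<mu> \<Otimes>\<^sub>M K n) S H"
    and "s + n \<le> N"
  shows "distr M S (Z n s) = K n"
  using \<open>s + n \<le> N\<close>
proof (induction n arbitrary: s)
  case 0
  have "distr M S (\<lambda>\<omega>. z) = return S z"
    by (rule distr_const[OF z])
  then show ?case by (simp add: Z_0[abs_def] K_0)
next
  case (Suc n)
  \<comment> \<open>Independence is available for restrictions of the family to disjoint index sets,
    so \<open>Z n s\<close> is first written as a measurable function of such a restriction.\<close>
  have factor: "\<exists>F \<in> PiM {s..<s + n} (\<lambda>_. borel) \<rightarrow>\<^sub>M S. \<forall>\<omega>. Z n s \<omega> = F (restrict (\<lambda>i. \<xi> i \<omega>) {s..<s + n})" for s n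
  proof (induction n arbitrary: s)
    case 0
    then show ?case using z by (intro bexI[of _ "\<lambda>_. z"]) (auto simp: Z_0)
  next
    case (Suc n)
    obtain F where F [measurable]: "F \<in> PiM {Suc s..<Suc s + n} (\<lambda>_. borel) \<rightarrow>\<^sub>M S"
      and F_eq: "\<And>\<omega>. Z n (Suc s) \<omega> = F (restrict (\<lambda>i. \<xi> i \<omega>) {Suc s..<Suc s + n})"
      using Suc[of "Suc s"] by blast
    have [measurable]: "(\<lambda>w. restrict w {Suc s..<Suc s + n}) \<in>
        PiM {s..<s + Suc n} (\<lambda>_. borel :: real measure) \<rightarrow>\<^sub>M PiM {Suc s..<Suc s + n} (\<lambda>_. borel)"
      by (rule measurable_restrict_subset) auto
    have [measurable]: "(\<lambda>w. w s) \<in> PiM {s..<s + Suc n} (\<lambda>_. borel :: real measure) \<rightarrow>\<^sub>M borel"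
      by (rule measurable_component_singleton) auto
    show ?case
    proof (intro bexI[of _ "\<lambda>w. H (w s, F (restrict w {Suc s..<Suc s + n}))"] allI)
      fix \<omega>
      have "{s..<s + Suc n} \<inter> {Suc s..<Suc s + n} = {Suc s..<Suc s + n}" by auto
      then show "Z (Suc n) s \<omega> = H (restrict (\<lambda>i. \<xi> i \<omega>) {s..<s + Suc n} s,
          F (restrict (restrict (\<lambda>i. \<xi> i \<omega>) {s..<s + Suc n}) {Suc s..<Suc s + n}))"
        by (simp add: Z_Suc F_eq restrict_restrict del: add_Suc add_Suc_right)
    qed measurable
  qed
  obtain F where F [measurable]: "F \<in> PiM {Suc s..<Suc s + n} (\<lambda>_. borel) \<rightarrow>\<^sub>M S"
    and F_eq: "\<And>\<omega>. Z n (Suc s) \<omega> = F (restrict (\<lambda>i. \<xi> i \<omega>) {Suc s..<Suc s + n})"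
    using factor[of "Suc s" n] by blast
  let ?P = "PiM {s} (\<lambda>_. borel) :: (nat \<Rightarrow> real) measure"
  let ?Q = "PiM {Suc s..<Suc s + n} (\<lambda>_. borel) :: (nat \<Rightarrow> real) measure"
  let ?u = "\<lambda>\<omega>. restrict (\<lambda>i. \<xi> i \<omega>) {s}"
  let ?v = "\<lambda>\<omega>. restrict (\<lambda>i. \<xi> i \<omega>) {Suc s..<Suc s + n}"
  have iv: "indep_var ?P ?u ?Q ?v"
    using Suc.prems by (intro indep_var_restrict[OF ind]) auto
  then have [measurable]: "random_variable ?P ?u" "random_variable ?Q ?v"
    by (blast dest: indep_var_rv1 indep_var_rv2)+
  have [measurable]: "(\<lambda>w. w s) \<in> ?P \<rightarrow>\<^sub>M borel"
    by (rule measurable_component_singleton) auto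
  have \<xi>_eq: "\<xi> s = (\<lambda>\<omega>. ?u \<omega> s)" and Z_eq: "Z n (Suc s) = (\<lambda>\<omega>. F (?v \<omega>))"
    by (simp_all add: fun_eq_iff F_eq)
  interpret V: prob_space "distr M S (Z n (Suc s))"
    unfolding Z_eq by (rule prob_space_distr) measurable
  have [measurable]: "random_variable borel (\<xi> s)" "random_variable S (Z n (Suc s))"
    unfolding \<xi>_eq Z_eq by measurable
  have "distr M S (Z (Suc n) s) = distr (distr M (borel \<Otimes>\<^sub>M S) (\<lambda>\<omega>. (\<xi> s \<omega>, Z n (Suc s) \<omega>))) S H"
    by (subst distr_distr) (auto simp: comp_def Z_Suc[abs_def])
  also have "distr M (borel \<Otimes>\<^sub>M S) (\<lambda>\<omega>. (\<xi> s \<omega>, Z n (Suc s) \<omega>)) =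
      distr (distr M (?P \<Otimes>\<^sub>M ?Q) (\<lambda>\<omega>. (?u \<omega>, ?v \<omega>))) (borel \<Otimes>\<^sub>M S) (\<lambda>(u, v). (u s, F v))"
    by (subst distr_distr, measurable) (simp add: comp_def F_eq)
  also have "distr M (?P \<Otimes>\<^sub>M ?Q) (\<lambda>\<omega>. (?u \<omega>, ?v \<omega>)) = distr M ?P ?u \<Otimes>\<^sub>M distr M ?Q ?v"
    using iv by (simp add: indep_var_distribution_eq)
  also have "distr (distr M ?P ?u \<Otimes>\<^sub>M distr M ?Q ?v) (borel \<Otimes>\<^sub>M S) (\<lambda>(u, v). (u s, F v)) =
      distr M borel (\<xi> s) \<Otimes>\<^sub>M distr M S (Z n (Suc s))"
  proof -
    have 1: "distr (distr M ?P ?u) borel (\<lambda>w. w s) = distr M borel (\<xi> s)"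
      by (subst distr_distr, measurable) (simp only: comp_def \<xi>_eq)
    have 2: "distr (distr M ?Q ?v) S F = distr M S (Z n (Suc s))"
      by (subst distr_distr, measurable) (simp only: comp_def Z_eq)
    show ?thesis
      by (rule pair_measure_distr[of "\<lambda>w. w s" "distr M ?P ?u" borel F "distr M ?Q ?v" S,
            unfolded 1 2 measurable_distr_eq1, OF _ F V.sigma_finite_measure_axioms, symmetric]) measurable
  qed
  also have "\<dots> = \<mu> \<Otimes>\<^sub>M K n"
    using Suc by (simp add: law)
  finally show ?case by (simp add: K_Suc)
qed

text \<open>The recursion runs from the front, in the form required by \<open>iid_fold_law\<close>
  and parallel to \<open>max_law\<close>; \<open>s\<close> is the index of the first increment
  used.\<close>

primrec walk_max :: "(nat \<Rightarrow> 'a \<Rightarrow> real) \<Rightarrow> nat \<Rightarrow> nat \<Rightarrow> 'a \<Rightarrow> real" where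
  "walk_max \<xi> 0 s \<omega> = 0"
| "walk_max \<xi> (Suc n) s \<omega> = max 0 (\<xi> s \<omega> + walk_max \<xi> n (Suc s) \<omega>)"

primrec walk_min :: "(nat \<Rightarrow> 'a \<Rightarrow> real) \<Rightarrow> nat \<Rightarrow> nat \<Rightarrow> 'a \<Rightarrow> real" where
  "walk_min \<xi> 0 s \<omega> = 0"
| "walk_min \<xi> (Suc n) s \<omega> = min 0 (\<xi> s \<omega> + walk_min \<xi> n (Suc s) \<omega>)"

lemma walk_max_le_iff: "walk_max \<xi> n s \<omega> \<le> c \<longleftrightarrow> (\<forall>j\<le>n. (\<Sum>i<j. \<xi> (s + i) \<omega>) \<le> c)"
proof (induction n arbitrary: s c)
  case (Suc n)
  have "walk_max \<xi> (Suc n) s \<omega> \<le> c \<longleftrightarrow> 0 \<le> c \<and> walk_max \<xi> n (Suc s) \<omega> \<le> c - \<xi> s \<omega>"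
    by auto
  then show ?case
    unfolding Suc all_le_Suc_shift
    by (simp add: sum.lessThan_Suc_shift algebra_simps del: sum.lessThan_Suc walk_max.simps walk_min.simps)
qed simp

lemma walk_min_less_iff: "c < walk_min \<xi> n s \<omega> \<longleftrightarrow> (\<forall>j\<le>n. c < (\<Sum>i<j. \<xi> (s + i) \<omega>))"
proof (induction n arbitrary: s c)
  case (Suc n)
  have "c < walk_min \<xi> (Suc n) s \<omega> \<longleftrightarrow> c < 0 \<and> c - \<xi> s \<omega> < walk_min \<xi> n (Suc s) \<omega>"
    by auto
  then show ?case
    unfolding Suc all_le_Suc_shift
    by (simp add: sum.lessThan_Suc_shift algebra_simps del: sum.lessThan_Suc walk_max.simps walk_min.simps)
qed simp

lemma (in prob_space)
  fixes \<xi> :: "nat \<Rightarrow> 'a \<Rightarrow> real"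
  assumes "random_walk \<mu>" and ind: "indep_vars (\<lambda>_. borel) \<xi> {..<n}"
    and law: "\<And>i. i < n \<Longrightarrow> distr M borel (\<xi> i) = \<mu>"
  shows distr_walk_max: "distr M (borel \<Otimes>\<^sub>M borel)
      (\<lambda>\<omega>. (walk_max \<xi> n 0 \<omega>, (\<Sum>i<n. \<xi> i \<omega>) - walk_max \<xi> n 0 \<omega>)) = random_walk.max_law \<mu> n"
    and distr_walk_min: "distr M borel (walk_min \<xi> n 0) = random_walk.min_law \<mu> n"
proof -
  interpret W: random_walk \<mu> by fact
  let ?Z = "\<lambda>n s \<omega>. (walk_max \<xi> n s \<omega>, (\<Sum>i<n. \<xi> (s + i) \<omega>) - walk_max \<xi> n s \<omega>)"
  have "distr M (borel \<Otimes>\<^sub>M borel) (?Z n 0) = W.max_law n"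
    by (rule iid_fold_law[OF ind law, where z = "(0, 0)" and Z = ?Z and K = W.max_law and
          H = "\<lambda>(x, m, d). if 0 < x + m then (x + m, d) else (0, x + m + d)"])
       (auto simp: space_pair_measure sum.lessThan_Suc_shift simp del: sum.lessThan_Suc)
  then show "distr M (borel \<Otimes>\<^sub>M borel)
      (\<lambda>\<omega>. (walk_max \<xi> n 0 \<omega>, (\<Sum>i<n. \<xi> i \<omega>) - walk_max \<xi> n 0 \<omega>)) = W.max_law n"
    by simp
  show "distr M borel (walk_min \<xi> n 0) = W.min_law n"
    by (rule iid_fold_law[OF ind law, where z = 0 and Z = "walk_min \<xi>" and K = W.min_law and
          H = "\<lambda>(x, m). min 0 (x + m)"]) auto
qed

section \<open>Cadlag paths and grids\<close>

text \<open>Right continuity recovers each \<open>s < t\<close> from grid points strictly to its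
  right, and the endpoint \<open>t\<close> is itself a grid point. The factor \<open>N\<close>
  provides \<open>N\<close> blocks of duration \<open>t / N\<close>, each consisting of exactly
  \<open>2 ^ q\<close> steps for every \<open>q\<close>.\<close>

lemma all_le_iff_grid:
  fixes w :: "real \<Rightarrow> real"
  assumes right: "\<And>s. 0 \<le> s \<Longrightarrow> continuous (at_right s) w" and "0 < t" "0 < N"
  shows "(\<forall>s\<in>{0..t}. w s \<le> c) \<longleftrightarrow>
    (\<forall>q. \<forall>j\<le>N * 2 ^ q. w (real j * (t / real (N * 2 ^ q))) \<le> c)"
proof safe
  fix q j assume *: "\<forall>s\<in>{0..t}. w s \<le> c" "j \<le> N * 2 ^ q"
  have "real j * t \<le> real (N * 2 ^ q) * t"
    using *(2) \<open>0 < t\<close> by (intro mult_right_mono of_nat_mono) auto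
  then have "real j * (t / real (N * 2 ^ q)) \<in> {0..t}"
    using assms by (simp add: field_simps)
  with *(1) show "w (real j * (t / real (N * 2 ^ q))) \<le> c" by blast
next
  fix s assume grid: "\<forall>q. \<forall>j\<le>N * 2 ^ q. w (real j * (t / real (N * 2 ^ q))) \<le> c"
    and s: "s \<in> {0..t}"
  show "w s \<le> c"
  proof (cases "s = t")
    case True
    then show ?thesis using grid[rule_format, of "N * 2 ^ 0" 0] \<open>0 < N\<close> by simp
  next
    case False
    then have "s < t" "0 \<le> s" using s by auto
    define h where "h q = t / real (N * 2 ^ q)" for q
    \<comment> \<open>Adding 1 to the floor keeps \<open>x q\<close> strictly to the right of
      \<open>s\<close>, even if \<open>s\<close> is a grid point, as a limit along
      \<open>at_right s\<close> requires.\<close>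
    define j where "j q = nat \<lfloor>s / h q\<rfloor> + 1" for q
    define x where "x q = real (j q) * h q" for q
    have h_pos: "0 < h q" for q
      using assms by (simp add: h_def)
    have rj: "real (j q) = real_of_int \<lfloor>s / h q\<rfloor> + 1" for q
      using h_pos[of q] \<open>0 \<le> s\<close> by (simp add: j_def)
    have s_less: "s < x q" for q
    proof -
      have "s / h q < real_of_int \<lfloor>s / h q\<rfloor> + 1" by linarith
      then show ?thesis
        unfolding x_def rj pos_divide_less_eq[OF h_pos[of q]] .
    qed
    have x_le: "x q \<le> s + h q" for q
    proof -
      have "real_of_int \<lfloor>s / h q\<rfloor> \<le> s / h q" by linarith
      then have "real_of_int \<lfloor>s / h q\<rfloor> * h q \<le> s"
        unfolding pos_le_divide_eq[OF h_pos[of q]] .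
      then show ?thesis
        unfolding x_def rj by (simp add: distrib_right)
    qed
    have j_le: "j q \<le> N * 2 ^ q" for q
    proof -
      have "s / h q < real (N * 2 ^ q)"
        using \<open>s < t\<close> assms by (simp add: h_def field_simps)
      then have "\<lfloor>s / h q\<rfloor> < int (N * 2 ^ q)"
        by (simp add: floor_less_iff)
      then show ?thesis
        unfolding j_def using h_pos[of q] \<open>0 \<le> s\<close> by (simp add: Suc_le_eq nat_less_iff)
    qed
    have "(\<lambda>q. h q) \<longlonglongrightarrow> 0"
    proof -
      have "(\<lambda>q. t / real N * (1 / 2) ^ q) \<longlonglongrightarrow> t / real N * 0"
        by (intro tendsto_intros LIMSEQ_realpow_zero) auto
      moreover have "t / real N * (1 / 2) ^ q = h q" for q
        by (simp add: h_def power_one_over)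
      ultimately show ?thesis by simp
    qed
    then have "(\<lambda>q. s + h q) \<longlonglongrightarrow> s + 0"
      by (intro tendsto_intros)
    then have "x \<longlonglongrightarrow> s"
      using s_less x_le
      by (intro real_tendsto_sandwich[of "\<lambda>_. s" x sequentially "\<lambda>q. s + h q"])
         (auto intro!: always_eventually less_imp_le)
    then have "filterlim x (at_right s) sequentially"
      using s_less by (auto simp: filterlim_at intro!: always_eventually)
    moreover have "(w \<longlongrightarrow> w s) (at_right s)"
      using right[OF \<open>0 \<le> s\<close>] by (simp add: continuous_within)
    ultimately have "(\<lambda>q. w (x q)) \<longlonglongrightarrow> w s"
      by (rule filterlim_compose[rotated])
    then show ?thesis
      using grid j_le by (intro LIMSEQ_le_const2) (auto simp: x_def h_def)
  qed
qed

text \<open>One-sided limits bound the path near each point, and bisection extends this to the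
  interval.\<close>

lemma cadlag_bounded_above:
  assumes "cadlag w" "0 \<le> t"
  shows "bdd_above (w ` {0..t})"
proof -
  \<comment> \<open>The condition \<open>0 \<le> s\<close> matters because bisection asks for all
    short intervals around a point, and those around 0 may contain negative times, about which
    nothing is known.\<close>
  define P where "P a b \<longleftrightarrow> (\<exists>K. \<forall>s\<in>{a..b}. 0 \<le> s \<longrightarrow> w s \<le> K)" for a b
  have "P 0 t"
    using \<open>0 \<le> t\<close>
  proof (induction rule: Bolzano)
    case (trans a b c)
    then obtain K L where "\<forall>s\<in>{a..b}. 0 \<le> s \<longrightarrow> w s \<le> K" "\<forall>s\<in>{b..c}. 0 \<le> s \<longrightarrow> w s \<le> L"
      unfolding P_def by blast
    then show ?case unfolding P_def by (intro exI[of _ "max K L"]) (force simp: le_max_iff_disj)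
  next
    case (local x)
    have "(w \<longlongrightarrow> w x) (at_right x)"
      using assms(1) local by (auto simp: cadlag_def continuous_within)
    then have "eventually (\<lambda>s. w s < w x + 1) (at_right x)"
      by (rule order_tendstoD) simp
    then obtain r where r: "x < r" "\<And>s. x < s \<Longrightarrow> s < r \<Longrightarrow> w s < w x + 1"
      by (auto simp: eventually_at_right_field)
    have "\<exists>l K. l < x \<and> (\<forall>s. l < s \<longrightarrow> s < x \<longrightarrow> 0 \<le> s \<longrightarrow> w s \<le> K)"
    proof (cases "x = 0")
      case True
      then show ?thesis by (intro exI[of _ "-1"]) auto
    next
      case False
      then have "0 < x" using local by simp
      then obtain y where "(w \<longlongrightarrow> y) (at_left x)"
        using assms(1) unfolding cadlag_def by blast
      then have "eventually (\<lambda>s. w s < y + 1) (at_left x)"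
        by (rule order_tendstoD) simp
      then obtain l where "l < x" "\<And>s. l < s \<Longrightarrow> s < x \<Longrightarrow> w s < y + 1"
        by (auto simp: eventually_at_left_field)
      then show ?thesis by (intro exI[of _ l] exI[of _ "y + 1"]) (auto intro: less_imp_le)
    qed
    then obtain l K where l: "l < x" "\<And>s. l < s \<Longrightarrow> s < x \<Longrightarrow> 0 \<le> s \<Longrightarrow> w s \<le> K" by blast
    show ?case
    proof (intro exI[of _ "min (r - x) (x - l)"] conjI allI impI)
      fix a b assume ab: "a \<le> x \<and> x \<le> b \<and> b - a < min (r - x) (x - l)"
      show "P a b"
        unfolding P_def
      proof (intro exI[of _ "max K (w x + 1)"] ballI impI)
        fix s assume s: "s \<in> {a..b}" "0 \<le> s"
        consider "s < x" | "s = x" | "x < s" by linarith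
        then show "w s \<le> max K (w x + 1)"
        proof cases
          case 1
          then show ?thesis using l(2)[of s] s ab by auto
        next
          case 3
          then show ?thesis using r(2)[of s] s ab by auto
        qed simp
      qed
    qed (use r l in auto)
  qed
  then show ?thesis by (auto simp: bdd_above_def P_def)
qed

lemma running_sup_le_iff:
  assumes "cadlag (\<lambda>s. X s \<omega>)" "0 \<le> t"
  shows "running_sup X t \<omega> \<le> c \<longleftrightarrow> (\<forall>s\<in>{0..t}. X s \<omega> \<le> c)"
  unfolding running_sup_def
  using cadlag_bounded_above[OF assms] assms(2) by (subst cSUP_le_iff) auto

section \<open>Suprema over grids and over short time intervals\<close>

context prob_space
begin

text \<open>Doubling the number of points makes the grids nested, so the grid events decrease to the
  event for the whole interval. The family \<open>Y\<close> is general because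
  \<open>small_time\<close>, which relies on this, is applied both to the process and to its
  negative.\<close>

lemma grid_events:
  fixes Y :: "real \<Rightarrow> 'a \<Rightarrow> real"
  assumes rv [measurable]: "\<And>t. 0 \<le> t \<Longrightarrow> random_variable borel (Y t)"
    and right: "\<And>\<omega> s. \<omega> \<in> space M \<Longrightarrow> 0 \<le> s \<Longrightarrow> continuous (at_right s) (\<lambda>t. Y t \<omega>)"
    and "0 < t" "0 < N"
  shows sets_sup_event: "{\<omega> \<in> space M. \<forall>s\<in>{0..t}. Y s \<omega> \<le> c} \<in> events" (is "?E \<in> events")
    and prob_grid_tendsto: "(\<lambda>q. prob {\<omega> \<in> space M. \<forall>j\<le>N * 2 ^ q. Y (real j * (t / real (N * 2 ^ q))) \<omega> \<le> c})
      \<longlonglongrightarrow> prob {\<omega> \<in> space M. \<forall>s\<in>{0..t}. Y s \<omega> \<le> c}" (is "(\<lambda>q. prob (?G q)) \<longlonglongrightarrow> _")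
proof -
  have E: "?E = (\<Inter>q. ?G q)"
    using all_le_iff_grid[OF right \<open>0 < t\<close> \<open>0 < N\<close>] by auto
  have G: "?G q \<in> events" for q
  proof -
    have [measurable]: "Y (real j * (t / real (N * 2 ^ q))) \<in> borel_measurable M" for j
      using \<open>0 < t\<close> by (intro rv) simp
    show ?thesis by measurable
  qed
  then have range: "range ?G \<subseteq> events" by blast
  show "?E \<in> events"
    unfolding E by (rule sets.countable_INT[OF range]) simp
  have "decseq ?G"
  proof (intro decseq_SucI subsetI)
    fix q \<omega> assume \<omega>: "\<omega> \<in> ?G (Suc q)"
    have "Y (real j * (t / real (N * 2 ^ q))) \<omega> \<le> c" if "j \<le> N * 2 ^ q" for j
    proof -
      have "2 * j \<le> N * 2 ^ Suc q" using that by simp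
      then have "Y (real (2 * j) * (t / real (N * 2 ^ Suc q))) \<omega> \<le> c"
        using \<omega> by blast
      then show ?thesis by simp
    qed
    with \<omega> show "\<omega> \<in> ?G q" by simp
  qed
  then show "(\<lambda>q. prob (?G q)) \<longlonglongrightarrow> prob ?E"
    unfolding E by (rule finite_Lim_measure_decseq[OF range])
qed

text \<open>Right continuity at 0 makes these events increase to one of probability 1 as the
  interval shrinks. The value 1/2 is the one expected by the hypotheses \<open>small\<close> and
  \<open>stay\<close> of the walk bounds.\<close>

lemma small_time:
  fixes Y :: "real \<Rightarrow> 'a \<Rightarrow> real"
  assumes rv: "\<And>t. 0 \<le> t \<Longrightarrow> random_variable borel (Y t)"
    and right: "\<And>\<omega> s. \<omega> \<in> space M \<Longrightarrow> 0 \<le> s \<Longrightarrow> continuous (at_right s) (\<lambda>t. Y t \<omega>)"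
    and zero: "AE \<omega> in M. Y 0 \<omega> = 0" and "0 < \<epsilon>"
  obtains \<tau> where "0 < \<tau>" "1 / 2 \<le> prob {\<omega> \<in> space M. \<forall>s\<in>{0..\<tau>}. Y s \<omega> \<le> \<epsilon>}"
proof -
  define E where "E k = {\<omega> \<in> space M. \<forall>s\<in>{0..1 / real (Suc k)}. Y s \<omega> \<le> \<epsilon>}" for k
  have E: "E k \<in> events" for k
    unfolding E_def by (rule sets_sup_event[OF rv right, where N = 1]) auto
  have "incseq E"
  proof (intro incseq_SucI subsetI)
    fix k \<omega> assume "\<omega> \<in> E k"
    moreover have "1 / real (Suc (Suc k)) \<le> 1 / real (Suc k)"
      by (simp add: field_simps)
    ultimately show "\<omega> \<in> E (Suc k)" unfolding E_def by force
  qed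
  then have "(\<lambda>k. prob (E k)) \<longlonglongrightarrow> prob (\<Union>k. E k)"
    using E by (intro finite_Lim_measure_incseq) auto
  also have "prob (\<Union>k. E k) = 1"
  proof (subst prob_eq_1)
    show "(\<Union>k. E k) \<in> events" using E by auto
    show "AE \<omega> in M. \<omega> \<in> (\<Union>k. E k)"
      using zero AE_space
    proof eventually_elim
      case (elim \<omega>)
      then have "((\<lambda>t. Y t \<omega>) \<longlongrightarrow> Y 0 \<omega>) (at_right 0)"
        using right[of \<omega> 0] by (simp add: continuous_within)
      then have "eventually (\<lambda>s. Y s \<omega> < \<epsilon>) (at_right 0)"
        using elim \<open>0 < \<epsilon>\<close> by (intro order_tendstoD) auto
      then obtain r where r: "0 < r" "\<And>s. 0 < s \<Longrightarrow> s < r \<Longrightarrow> Y s \<omega> < \<epsilon>"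
        by (auto simp: eventually_at_right_field)
      obtain k where k: "1 / real (Suc k) < r"
        using reals_Archimedean[OF \<open>0 < r\<close>] by (auto simp: inverse_eq_divide)
      have "Y s \<omega> \<le> \<epsilon>" if "s \<in> {0..1 / real (Suc k)}" for s
        using r(2)[of s] that k elim \<open>0 < \<epsilon>\<close> by (cases "s = 0") auto
      then have "\<omega> \<in> E k" using elim by (simp add: E_def)
      then show ?case by blast
    qed
  qed
  finally have "eventually (\<lambda>k. 1 / 2 < prob (E k)) sequentially"
    by (rule order_tendstoD) simp
  then obtain k where "1 / 2 < prob (E k)"
    by (auto simp: eventually_sequentially)
  then show thesis
    using that[of "1 / real (Suc k)"] by (simp add: E_def less_imp_le)
qed

end

section \<open>The process sampled on a grid\<close>

context levy_process
begin

lemma right_continuous_paths: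
  "\<omega> \<in> space M \<Longrightarrow> 0 \<le> s \<Longrightarrow> continuous (at_right s) (\<lambda>t. X t \<omega>)"
  using cadlag_paths by (auto simp: cadlag_def)

lemma right_continuous_minus_paths:
  "\<omega> \<in> space M \<Longrightarrow> 0 \<le> s \<Longrightarrow> continuous (at_right s) (\<lambda>t. - X t \<omega>)"
  by (intro continuous_minus right_continuous_paths)

definition step_law :: "real \<Rightarrow> real measure" where
  "step_law h = distr M borel (X h)"

lemma random_walk_step_law: "0 \<le> h \<Longrightarrow> random_walk (step_law h)"
  unfolding random_walk_def step_law_def by (intro real_distribution_distr random_variable_X)

context
  fixes h :: real
  assumes h: "0 < h"
begin

interpretation W: random_walk "step_law h"
  using h by (intro random_walk_step_law) simp

definition incr :: "nat \<Rightarrow> 'a \<Rightarrow> real" where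
  "incr i \<omega> = X (real (Suc i) * h) \<omega> - X (real i * h) \<omega>"

lemma rv_grid [measurable]: "random_variable borel (X (real j * h))"
  using h by (intro random_variable_X) simp

lemma rv_incr [measurable]: "random_variable borel (incr i)"
  unfolding incr_def[abs_def] using rv_grid[of "Suc i"] rv_grid[of i] by measurable

lemma indep_incr: "indep_vars (\<lambda>_. borel) incr {..<n}"
  using independent_increments[of "\<lambda>i. real i * h" n] h
  by (simp add: incr_def[abs_def] mult_right_mono)

lemma distr_incr: "distr M borel (incr i) = step_law h"
  using stationary_increments[of "real i * h" h] h
  by (simp add: incr_def[abs_def] step_law_def algebra_simps)

lemma sum_incr: "(\<Sum>i<j. incr i \<omega>) = X (real j * h) \<omega> - X 0 \<omega>"
  by (induction j) (auto simp: incr_def)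

lemmas distr_max = distr_walk_max[OF W.random_walk_axioms indep_incr distr_incr]
lemmas distr_min = distr_walk_min[OF W.random_walk_axioms indep_incr distr_incr]

lemma rv_walk_max [measurable]: "random_variable borel (walk_max incr n s)"
proof (induction n arbitrary: s)
  case (Suc n)
  note [measurable] = Suc
  have "walk_max incr (Suc n) s = (\<lambda>\<omega>. max 0 (incr s \<omega> + walk_max incr n (Suc s) \<omega>))"
    by (simp add: fun_eq_iff)
  then show ?case by simp
qed (simp add: walk_max.simps(1)[abs_def])

lemma rv_walk_min [measurable]: "random_variable borel (walk_min incr n s)"
proof (induction n arbitrary: s)
  case (Suc n)
  note [measurable] = Suc
  have "walk_min incr (Suc n) s = (\<lambda>\<omega>. min 0 (incr s \<omega> + walk_min incr n (Suc s) \<omega>))"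
    by (simp add: fun_eq_iff)
  then show ?case by simp
qed (simp add: walk_min.simps(1)[abs_def])

text \<open>A by-product of the joint law of maximum and displacement, whose coordinates add up to
  \<open>X (n * h) - X 0\<close>.\<close>

lemma walk_law_eq: "W.walk_law n = distr M borel (X (real n * h))"
proof (rule measure_eqI)
  fix A assume "A \<in> sets (W.walk_law n)"
  then have [measurable]: "A \<in> sets borel" by simp
  have "emeasure (W.walk_law n) A = (\<integral>\<^sup>+x. indicator A x \<partial>W.walk_law n)"
    by simp
  also have "\<dots> = (\<integral>\<^sup>+z. indicator A (fst z + snd z) \<partial>W.max_law n)"
    by (rule W.max_law_sum[symmetric]) auto
  also have "\<dots> = (\<integral>\<^sup>+\<omega>. indicator A (X (real n * h) \<omega> - X 0 \<omega>) \<partial>M)"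
    unfolding distr_max[symmetric] by (subst nn_integral_distr) (auto simp: sum_incr[symmetric])
  also have "\<dots> = (\<integral>\<^sup>+\<omega>. indicator A (X (real n * h) \<omega>) \<partial>M)"
    using start_at_zero by (intro nn_integral_cong_AE) (auto elim!: eventually_mono)
  also have "\<dots> = (\<integral>\<^sup>+x. indicator A x \<partial>distr M borel (X (real n * h)))"
    by (rule nn_integral_distr[symmetric]) auto
  finally show "emeasure (W.walk_law n) A = emeasure (distr M borel (X (real n * h))) A"
    by simp
qed simp

lemma max_law_le:
  "(\<integral>\<^sup>+z. indicator {..c} (fst z) \<partial>W.max_law n) = prob {\<omega> \<in> space M. \<forall>j\<le>n. X (real j * h) \<omega> \<le> c}"
proof -
  have "(\<integral>\<^sup>+z. indicator {..c} (fst z) \<partial>W.max_law n) = (\<integral>\<^sup>+\<omega>. indicator {..c} (walk_max incr n 0 \<omega>) \<partial>M)"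
    unfolding distr_max[symmetric] by (subst nn_integral_distr) auto
  also have "\<dots> = (\<integral>\<^sup>+\<omega>. indicator {\<omega> \<in> space M. \<forall>j\<le>n. X (real j * h) \<omega> \<le> c} \<omega> \<partial>M)"
    using start_at_zero
    by (intro nn_integral_cong_AE)
       (auto elim!: eventually_mono simp: indicator_def walk_max_le_iff sum_incr)
  also have "\<dots> = prob {\<omega> \<in> space M. \<forall>j\<le>n. X (real j * h) \<omega> \<le> c}"
    by (simp add: emeasure_eq_measure)
  finally show ?thesis .
qed

lemma min_law_greater:
  "(\<integral>\<^sup>+m. indicator {0<..} (y + m) \<partial>W.min_law n) = prob {\<omega> \<in> space M. \<forall>j\<le>n. - y < X (real j * h) \<omega>}"
proof -
  have "(\<integral>\<^sup>+m. indicator {0<..} (y + m) \<partial>W.min_law n) = (\<integral>\<^sup>+\<omega>. indicator {-y<..} (walk_min incr n 0 \<omega>) \<partial>M)"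
    unfolding distr_min[symmetric] by (subst nn_integral_distr) (auto simp: indicator_def intro!: nn_integral_cong)
  also have "\<dots> = (\<integral>\<^sup>+\<omega>. indicator {\<omega> \<in> space M. \<forall>j\<le>n. - y < X (real j * h) \<omega>} \<omega> \<partial>M)"
    using start_at_zero
    by (intro nn_integral_cong_AE)
       (auto elim!: eventually_mono simp: indicator_def walk_min_less_iff sum_incr)
  also have "\<dots> = prob {\<omega> \<in> space M. \<forall>j\<le>n. - y < X (real j * h) \<omega>}"
    by (simp add: emeasure_eq_measure)
  finally show ?thesis .
qed

lemma max_law_Ioc:
  assumes "a \<le> b"
  shows "(\<integral>\<^sup>+z. indicator {a<..b} (fst z) \<partial>W.max_law n) =
    ennreal (prob {\<omega> \<in> space M. \<forall>j\<le>n. X (real j * h) \<omega> \<le> b} - prob {\<omega> \<in> space M. \<forall>j\<le>n. X (real j * h) \<omega> \<le> a})"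
proof -
  interpret J: prob_space "W.max_law n" by (rule W.prob_space_max_law)
  have "(\<integral>\<^sup>+z. indicator {..b} (fst z) \<partial>W.max_law n) =
      (\<integral>\<^sup>+z. indicator {a<..b} (fst z) + indicator {..a} (fst z) \<partial>W.max_law n)"
    using assms by (intro nn_integral_cong) (auto simp: indicator_def)
  also have "\<dots> = (\<integral>\<^sup>+z. indicator {a<..b} (fst z) \<partial>W.max_law n) + (\<integral>\<^sup>+z. indicator {..a} (fst z) \<partial>W.max_law n)"
    by (rule nn_integral_add) auto
  finally show ?thesis
    unfolding max_law_le by (simp add: ennreal_minus[symmetric])
qed

end

lemma rv_running_sup:
  assumes "0 < t"
  shows "random_variable borel (running_sup X t)"
proof (rule borel_measurableI_le)
  fix c
  have "{\<omega> \<in> space M. running_sup X t \<omega> \<le> c} = {\<omega> \<in> space M. \<forall>s\<in>{0..t}. X s \<omega> \<le> c}"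
    using assms cadlag_paths by (auto simp: running_sup_le_iff)
  then show "{\<omega> \<in> space M. running_sup X t \<omega> \<le> c} \<in> events"
    using sets_sup_event[OF random_variable_X right_continuous_paths assms, of 1] by simp
qed

text \<open>The distribution functions of the grid maxima converge at every point, because the
  events with \<open>\<le>\<close> decrease to the one for the supremum. Half-open intervals are
  differences of these, so no condition on atoms at their endpoints arises.\<close>

lemma running_sup_Ioc_tendsto:
  assumes t: "0 < t" and N: "0 < N" and "a \<le> b"
  shows "(\<lambda>q. \<integral>\<^sup>+z. indicator {a<..b} (fst z) \<partial>random_walk.max_law (step_law (t / real (N * 2 ^ q))) (N * 2 ^ q))
    \<longlonglongrightarrow> emeasure (distr M borel (running_sup X t)) {a<..b}"
proof -
  interpret S: prob_space "distr M borel (running_sup X t)"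
    using t by (intro prob_space_distr rv_running_sup)
  have le: "measure (distr M borel (running_sup X t)) {..c} = prob {\<omega> \<in> space M. \<forall>s\<in>{0..t}. X s \<omega> \<le> c}" for c
  proof -
    have "running_sup X t -` {..c} \<inter> space M = {\<omega> \<in> space M. \<forall>s\<in>{0..t}. X s \<omega> \<le> c}"
      using t cadlag_paths by (auto simp: running_sup_le_iff)
    then show ?thesis by (simp add: measure_distr rv_running_sup[OF t])
  qed
  have "{a<..b} = {..b} - {..a}" by auto
  then have "measure (distr M borel (running_sup X t)) {a<..b} =
      measure (distr M borel (running_sup X t)) {..b} - measure (distr M borel (running_sup X t)) {..a}"
    using \<open>a \<le> b\<close> by (simp add: S.finite_measure_Diff)
  then have eq: "emeasure (distr M borel (running_sup X t)) {a<..b} =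
      ennreal (prob {\<omega> \<in> space M. \<forall>s\<in>{0..t}. X s \<omega> \<le> b} - prob {\<omega> \<in> space M. \<forall>s\<in>{0..t}. X s \<omega> \<le> a})"
    by (simp add: S.emeasure_eq_measure le)
  have "(\<lambda>q. ennreal (prob {\<omega> \<in> space M. \<forall>j\<le>N * 2 ^ q. X (real j * (t / real (N * 2 ^ q))) \<omega> \<le> b} -
      prob {\<omega> \<in> space M. \<forall>j\<le>N * 2 ^ q. X (real j * (t / real (N * 2 ^ q))) \<omega> \<le> a}))
    \<longlonglongrightarrow> emeasure (distr M borel (running_sup X t)) {a<..b}"
    unfolding eq using t N
    by (intro tendsto_ennrealI tendsto_diff prob_grid_tendsto[OF random_variable_X right_continuous_paths])
  moreover have "0 < t / real (N * 2 ^ q)" for q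
    using t N by simp
  ultimately show ?thesis
    using \<open>a \<le> b\<close> by (simp only: max_law_Ioc)
qed

end

section \<open>Comparison of densities\<close>

text \<open>The difference of the distribution functions is nondecreasing, so it defines a measure, which
  added to the smaller measure gives the larger one on a generating class.\<close>

lemma AE_le_of_nn_integral_Ioc_le:
  fixes u v :: "real \<Rightarrow> ennreal"
  assumes [measurable]: "u \<in> borel_measurable borel" "v \<in> borel_measurable borel"
    and fin: "(\<integral>\<^sup>+x. v x \<partial>lborel) < \<top>"
    and le: "\<And>a b. a < b \<Longrightarrow> (\<integral>\<^sup>+x\<in>{a<..b}. u x \<partial>lborel) \<le> (\<integral>\<^sup>+x\<in>{a<..b}. v x \<partial>lborel)"
  shows "AE x in lborel. u x \<le> v x"
proof -
  define U where "U = density lborel u"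
  define V where "V = density lborel v"
  have [simp, measurable_cong]: "sets U = sets borel" "sets V = sets borel"
    by (simp_all add: U_def V_def)
  have [simp]: "space U = UNIV" "space V = UNIV"
    by (simp_all add: U_def V_def)
  have V_fin: "emeasure V UNIV < \<top>"
    using fin by (simp add: V_def emeasure_density)
  have Ioc: "emeasure U {a<..b} \<le> emeasure V {a<..b}" for a b
    using le[of a b] by (cases "a < b") (simp_all add: U_def V_def emeasure_density)
  \<comment> \<open>Finiteness of \<open>U\<close> follows by exhausting the line with intervals; it
    makes distribution functions available for \<open>U\<close> as well.\<close>
  have U_fin: "emeasure U UNIV \<le> emeasure V UNIV"
  proof -
    have "(\<lambda>n::nat. emeasure U {- real n<..real n}) \<longlonglongrightarrow> emeasure U (\<Union>n::nat. {- real n<..real n})"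
      by (intro Lim_emeasure_incseq) (auto simp: incseq_def)
    moreover have "emeasure U {- real n<..real n} \<le> emeasure V UNIV" for n
      using Ioc by (rule order_trans) (auto intro: emeasure_mono)
    ultimately show ?thesis
      unfolding UN_Ioc_eq_UNIV by (intro LIMSEQ_le_const2) auto
  qed
  interpret U: finite_borel_measure U
    using U_fin V_fin by (intro finite_borel_measureI finite_measureI) auto
  interpret V: finite_borel_measure V
    using V_fin by (intro finite_borel_measureI finite_measureI) auto
  define F where "F x = cdf V x - cdf U x" for x
  have mono_F: "F a \<le> F b" if "a \<le> b" for a b
    using Ioc[of a b] U.cdf_nondecreasing[OF that] V.cdf_nondecreasing[OF that]
    by (simp add: F_def U.emeasure_Ioc[OF that] V.emeasure_Ioc[OF that])
  define I where "I = interval_measure F"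
  have [simp, measurable_cong]: "sets I = sets borel" by (simp add: I_def)
  have I_Ioc: "emeasure I {a<..b} = F b - F a" if "a \<le> b" for a b
    unfolding I_def F_def[abs_def] using that mono_F
    by (intro emeasure_interval_measure_Ioc)
       (auto simp: F_def[abs_def] intro!: continuous_diff U.cdf_is_right_cont V.cdf_is_right_cont)
  define S where "S = measure_of UNIV (sets borel) (\<lambda>A. emeasure U A + emeasure I A)"
  have [simp]: "sets S = sets borel" "space S = UNIV"
    using sets.sigma_sets_eq[of borel] by (simp_all add: S_def sets_measure_of_conv space_measure_of_conv)
  have S: "emeasure S A = emeasure U A + emeasure I A" if "A \<in> sets borel" for A
  proof (rule emeasure_measure_of[OF S_def])
    show "countably_additive (sets S) (\<lambda>A. emeasure U A + emeasure I A)"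
    proof (rule countably_additiveI)
      fix B :: "nat \<Rightarrow> real set"
      assume "range B \<subseteq> sets S" "disjoint_family B"
      then show "(\<Sum>i. emeasure U (B i) + emeasure I (B i)) = emeasure U (\<Union>i. B i) + emeasure I (\<Union>i. B i)"
        by (subst suminf_add[symmetric]) (auto simp: suminf_emeasure)
    qed
  qed (use that in \<open>auto simp: positive_def\<close>)
  have "V = S"
  proof (rule measure_eqI_generator_eq[where E = "range (\<lambda>(a, b). {a<..b})" and \<Omega> = UNIV
        and A = "\<lambda>n::nat. {- real n<..real n}"])
    show "Int_stable (range (\<lambda>(a, b). {a<..b :: real}))"
    proof (rule Int_stableI)
      fix A B :: "real set" assume "A \<in> range (\<lambda>(a, b). {a<..b})" "B \<in> range (\<lambda>(a, b). {a<..b})"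
      then obtain a b c d where "A = {a<..b}" "B = {c<..d}" by auto
      then have "A \<inter> B = (\<lambda>(a, b). {a<..b}) (max a c, min b d)" by auto
      then show "A \<inter> B \<in> range (\<lambda>(a, b). {a<..b})" by blast
    qed
    show "emeasure V X = emeasure S X" if "X \<in> range (\<lambda>(a, b). {a<..b})" for X
    proof -
      obtain a b where X: "X = {a<..b}" using \<open>X \<in> _\<close> by auto
      show ?thesis
      proof (cases "a \<le> b")
        case True
        have "emeasure S X = ennreal (cdf U b - cdf U a) + ennreal (F b - F a)"
          by (simp add: X S I_Ioc U.emeasure_Ioc True)
        also have "\<dots> = ennreal ((cdf U b - cdf U a) + (F b - F a))"
          using mono_F U.cdf_nondecreasing True by (intro ennreal_plus[symmetric]) auto
        also have "\<dots> = emeasure V X"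
          by (simp add: X V.emeasure_Ioc True F_def)
        finally show ?thesis by simp
      qed (simp add: X)
    qed
    have "sets borel = sigma_sets UNIV (range (\<lambda>(a, b). {a<..b :: real}))"
      by (subst borel_sigma_sets_Ioc, subst sets_measure_of) auto
    then show "sets V = sigma_sets UNIV (range (\<lambda>(a, b). {a<..b :: real}))"
      "sets S = sigma_sets UNIV (range (\<lambda>(a, b). {a<..b :: real}))"
      by simp_all
    show "range (\<lambda>n::nat. {- real n<..real n}) \<subseteq> range (\<lambda>(a, b). {a<..b :: real})"
      by auto
    show "(\<Union>n::nat. {- real n<..real n}) = UNIV"
      by (rule UN_Ioc_eq_UNIV)
    show "emeasure V {- real n<..real n} \<noteq> \<infinity>" for n :: nat
      by (simp add: V.emeasure_finite)
  qed auto
  \<comment> \<open>On \<open>A\<close> the difference \<open>u - v\<close> is positive, but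
    \<open>U \<le> V\<close> on all Borel sets makes its integral over \<open>A\<close>
    vanish.\<close>
  define A where "A = {x. v x < u x}"
  have A [measurable]: "A \<in> sets borel" unfolding A_def by measurable
  have fin_A: "(\<integral>\<^sup>+x. indicator A x * v x \<partial>lborel) < \<top>"
  proof -
    have "(\<integral>\<^sup>+x. indicator A x * v x \<partial>lborel) \<le> (\<integral>\<^sup>+x. v x \<partial>lborel)"
      by (intro nn_integral_mono) (auto simp: indicator_def)
    then show ?thesis using fin by (rule order_le_less_trans)
  qed
  have "(\<integral>\<^sup>+x. indicator A x * (u x - v x) \<partial>lborel) = (\<integral>\<^sup>+x. indicator A x * u x - indicator A x * v x \<partial>lborel)"
    by (intro nn_integral_cong) (auto simp: indicator_def)
  also have "\<dots> = (\<integral>\<^sup>+x. indicator A x * u x \<partial>lborel) - (\<integral>\<^sup>+x. indicator A x * v x \<partial>lborel)"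
    using fin_A by (intro nn_integral_diff) (auto simp: A_def indicator_def intro: less_imp_le)
  also have "\<dots> = 0"
  proof -
    have "emeasure U A \<le> emeasure V A"
      unfolding \<open>V = S\<close> S[OF A] by simp
    then have "(\<integral>\<^sup>+x. indicator A x * u x \<partial>lborel) \<le> (\<integral>\<^sup>+x. indicator A x * v x \<partial>lborel)"
      by (simp add: U_def V_def emeasure_density mult.commute)
    then show ?thesis
      using fin_A by (intro diff_eq_0_ennreal) (auto intro: order_le_less_trans)
  qed
  finally have "AE x in lborel. indicator A x * (u x - v x) = 0"
    by (subst (asm) nn_integral_0_iff_AE) auto
  then show ?thesis
    by eventually_elim (auto simp: A_def indicator_def not_less diff_eq_0_iff_ennreal split: if_splits)
qed

lemma AE_le_on_of_nn_integral_Ioc_le: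
  fixes u v :: "real \<Rightarrow> ennreal"
  assumes [measurable]: "u \<in> borel_measurable borel" "v \<in> borel_measurable borel"
    and fin: "(\<integral>\<^sup>+x\<in>{L<..R}. v x \<partial>lborel) < \<top>"
    and le: "\<And>a b. L \<le> a \<Longrightarrow> a < b \<Longrightarrow> b \<le> R \<Longrightarrow>
      (\<integral>\<^sup>+x\<in>{a<..b}. u x \<partial>lborel) \<le> (\<integral>\<^sup>+x\<in>{a<..b}. v x \<partial>lborel)"
  shows "AE x in lborel. L < x \<longrightarrow> x \<le> R \<longrightarrow> u x \<le> v x"
proof -
  have "AE x in lborel. u x * indicator {L<..R} x \<le> v x * indicator {L<..R} x"
  proof (rule AE_le_of_nn_integral_Ioc_le)
    fix a b :: real
    have *: "(\<integral>\<^sup>+x\<in>{a<..b}. g x * indicator {L<..R} x \<partial>lborel) = (\<integral>\<^sup>+x\<in>{max a L<..min b R}. g x \<partial>lborel)"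
      for g :: "real \<Rightarrow> ennreal"
      by (intro nn_integral_cong) (auto simp: indicator_def)
    show "(\<integral>\<^sup>+x\<in>{a<..b}. u x * indicator {L<..R} x \<partial>lborel) \<le> (\<integral>\<^sup>+x\<in>{a<..b}. v x * indicator {L<..R} x \<partial>lborel)"
    proof (cases "max a L < min b R")
      case True
      then show ?thesis unfolding * by (intro le) auto
    next
      case False
      then have empty: "{max a L<..min b R} = {}" by (intro greaterThanAtMost_empty leI)
      show ?thesis unfolding * empty by simp
    qed
  qed (use fin in auto)
  then show ?thesis
    by eventually_elim (auto simp: indicator_def)
qed

text \<open>Outside \<open>S\<close> a density may be negative or fail to be measurable, so it is
  replaced there by 0.\<close>

lemma has_density_onE:
  assumes "has_density_on \<mu> S g" and [measurable]: "S \<in> sets borel"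
  obtains g' where "g' \<in> borel_measurable borel" "\<And>x. 0 \<le> g' x" "\<And>x. x \<in> S \<Longrightarrow> g' x = g x"
    "\<And>B. B \<in> sets borel \<Longrightarrow> B \<subseteq> S \<Longrightarrow> emeasure \<mu> B = (\<integral>\<^sup>+x\<in>B. ennreal (g' x) \<partial>lborel)"
proof -
  define g' where "g' x = indicator S x *\<^sub>R g x" for x
  have S: "x \<in> S \<Longrightarrow> g' x = g x" for x by (simp add: g'_def)
  show thesis
  proof
    show "g' \<in> borel_measurable borel"
      using assms(1) by (simp add: has_density_on_def set_borel_measurable_def g'_def[abs_def])
    show "0 \<le> g' x" for x
      using assms(1) by (auto simp: has_density_on_def g'_def indicator_def)
    fix B assume B: "B \<in> sets borel" "B \<subseteq> S"
    then have "emeasure \<mu> B = (\<integral>\<^sup>+x\<in>B. ennreal (g x) \<partial>lborel)"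
      using assms(1) by (simp add: has_density_on_def)
    also have "\<dots> = (\<integral>\<^sup>+x\<in>B. ennreal (g' x) \<partial>lborel)"
      using B S by (intro nn_integral_cong) (auto simp: indicator_def)
    finally show "emeasure \<mu> B = (\<integral>\<^sup>+x\<in>B. ennreal (g' x) \<partial>lborel)" .
  qed (rule S)
qed

section \<open>Density of the running supremum\<close>

context levy_process
begin

text \<open>The walk bound is applied with \<open>m = 2 ^ q\<close> and \<open>\<kappa>\<close>
  multiplied by the mesh. The first \<open>m\<close> steps cover the time \<open>t / N\<close> for
  every \<open>q\<close>, so the result is free of the mesh and passes to the limit.\<close>

lemma running_sup_lower_bound:
  assumes t: "0 < t" and N: "4 \<le> N" and "a \<le> b"
    and lower: "\<And>s y. 0 < s \<Longrightarrow> s \<le> t \<Longrightarrow> 0 \<le> y \<Longrightarrow> y \<le> \<delta> \<Longrightarrow>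
      ennreal s * \<kappa> \<le> (\<integral>\<^sup>+x. indicator {0<..} x * indicator {a<..b} (x + y) \<partial>step_law s)"
    and \<tau>: "t / real N \<le> \<tau>" and small: "1 / 2 \<le> prob {\<omega> \<in> space M. \<forall>s\<in>{0..\<tau>}. X s \<omega> \<le> \<delta>}"
  shows "ennreal (t / real N) * \<kappa> \<le> 4 * emeasure (distr M borel (running_sup X t)) {a<..b}"
proof -
  have bound: "ennreal (t / real N) * \<kappa> \<le> 4 * (\<integral>\<^sup>+z. indicator {a<..b} (fst z)
      \<partial>random_walk.max_law (step_law (t / real (N * 2 ^ q))) (N * 2 ^ q))" for q
  proof -
    define h where "h = t / real (N * 2 ^ q)"
    have h: "0 < h" using t N by (simp add: h_def)
    have t_eq: "t = real (N * 2 ^ q) * h" "t / real N = real (2 ^ q) * h"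
      using N by (simp_all add: h_def)
    interpret W: random_walk "step_law h"
      using h by (intro random_walk_step_law) simp
    have "of_nat (2 ^ q) * (ennreal h * \<kappa>) \<le> 4 * (\<integral>\<^sup>+z. indicator {a<..b} (fst z) \<partial>W.max_law (N * 2 ^ q))"
    proof (rule W.max_law_lower_bound)
      fix j :: nat and y assume j: "1 \<le> j" "j \<le> N * 2 ^ q" and y: "0 \<le> y" "y \<le> \<delta>"
      have "real j * h \<le> t"
        unfolding t_eq(1) using j h by (intro mult_right_mono of_nat_mono) auto
      then have "ennreal (real j * h) * \<kappa> \<le>
          (\<integral>\<^sup>+x. indicator {0<..} x * indicator {a<..b} (x + y) \<partial>step_law (real j * h))"
        using j h y by (intro lower) auto
      then show "of_nat j * (ennreal h * \<kappa>) \<le>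
          (\<integral>\<^sup>+x. indicator {0<..} x * indicator {a<..b} (x + y) \<partial>W.walk_law j)"
        using h by (simp add: walk_law_eq[OF h, folded step_law_def] ennreal_mult ennreal_of_nat_eq_real_of_nat mult.assoc)
    next
      fix k :: nat assume k: "k \<le> 2 ^ q"
      have "real k * h \<le> real (2 ^ q) * h"
        using k h by (intro mult_right_mono of_nat_mono) auto
      also have "\<dots> \<le> \<tau>"
        using \<tau> unfolding t_eq(2) .
      finally have "real k * h \<le> \<tau>" .
      have in_range: "real j * h \<in> {0..\<tau>}" if "j \<le> k" for j
      proof -
        have "real j * h \<le> real k * h"
          using that h by (intro mult_right_mono of_nat_mono) auto
        then have "real j * h \<le> \<tau>"
          using \<open>real k * h \<le> \<tau>\<close> by (rule order_trans)
        moreover have "0 \<le> real j * h" using h by simp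
        ultimately show ?thesis by (simp only: atLeastAtMost_iff)
      qed
      have "{\<omega> \<in> space M. \<forall>j\<le>k. X (real j * h) \<omega> \<le> \<delta>} \<in> events"
        using rv_grid[OF h, measurable] by measurable
      then have "prob {\<omega> \<in> space M. \<forall>s\<in>{0..\<tau>}. X s \<omega> \<le> \<delta>} \<le> prob {\<omega> \<in> space M. \<forall>j\<le>k. X (real j * h) \<omega> \<le> \<delta>}"
        using in_range by (intro finite_measure_mono) blast+
      then have "ennreal (1 / 2) \<le> prob {\<omega> \<in> space M. \<forall>j\<le>k. X (real j * h) \<omega> \<le> \<delta>}"
        using small by (intro ennreal_leI) simp
      then show "1 / 2 \<le> (\<integral>\<^sup>+z. indicator {..\<delta>} (fst z) \<partial>W.max_law k)"
        by (simp only: max_law_le[OF h] ennreal_half)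
    qed (use N in auto)
    moreover have "ennreal (t / real N) * \<kappa> = of_nat (2 ^ q) * (ennreal h * \<kappa>)"
      unfolding t_eq(2) using h
      by (simp only: ennreal_mult[OF of_nat_0_le_iff less_imp_le] ennreal_of_nat_eq_real_of_nat mult.assoc)
    ultimately show ?thesis by (simp only: h_def)
  qed
  have "(\<lambda>q. 4 * (\<integral>\<^sup>+z. indicator {a<..b} (fst z)
      \<partial>random_walk.max_law (step_law (t / real (N * 2 ^ q))) (N * 2 ^ q)))
    \<longlonglongrightarrow> 4 * emeasure (distr M borel (running_sup X t)) {a<..b}"
    using t N \<open>a \<le> b\<close> by (intro ennreal_tendsto_cmult running_sup_Ioc_tendsto) auto
  then show ?thesis
    by (rule LIMSEQ_le_const) (use bound in auto)
qed

text \<open>There are \<open>N\<close> blocks of \<open>m = 2 ^ q\<close> steps, and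
  \<open>N * (N * m + 3 * m)\<close> times the mesh is \<open>(N + 3) * t\<close>. During one block
  the path falls below \<open>- \<epsilon>\<close> with probability at most 1/2, so from a start
  above \<open>2 * \<rho>\<close> it remains positive at the grid times with probability at least
  1/2.\<close>

lemma running_sup_upper_bound:
  assumes t: "0 < t" and N: "0 < N" and "a \<le> b" and \<rho>: "0 < \<rho>" "8 * \<rho> \<le> a" "\<epsilon> \<le> \<rho>"
    and upper: "\<And>s y. 0 < s \<Longrightarrow> s \<le> t \<Longrightarrow>
      (\<integral>\<^sup>+x. indicator {\<rho><..} x * indicator {a<..b} (x + y) \<partial>step_law s) \<le> ennreal s * \<kappa>"
    and \<tau>: "t / real N \<le> \<tau>" and small: "1 / 2 \<le> prob {\<omega> \<in> space M. \<forall>s\<in>{0..\<tau>}. - X s \<omega> \<le> \<epsilon>}"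
  shows "emeasure (distr M borel (running_sup X t)) {a<..b} \<le> ennreal (real (N + 3) * t) * \<kappa>"
proof -
  have bound: "(\<integral>\<^sup>+z. indicator {a<..b} (fst z)
      \<partial>random_walk.max_law (step_law (t / real (N * 2 ^ q))) (N * 2 ^ q)) \<le> ennreal (real (N + 3) * t) * \<kappa>" for q
  proof -
    define h where "h = t / real (N * 2 ^ q)"
    have h: "0 < h" using t N by (simp add: h_def)
    have t_eq: "t = real (N * 2 ^ q) * h" "t / real N = real (2 ^ q) * h"
      using N by (simp_all add: h_def)
    interpret W: random_walk "step_law h"
      using h by (intro random_walk_step_law) simp
    have "(\<integral>\<^sup>+z. indicator {a<..b} (fst z) \<partial>W.max_law (N * 2 ^ q)) \<le>
        of_nat (N * (N * 2 ^ q + 3 * 2 ^ q)) * (ennreal h * \<kappa>)"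
    proof (rule W.max_law_upper_bound_blocks)
      fix j :: nat and y :: real assume j: "1 \<le> j" "j \<le> N * 2 ^ q"
      have "real j * h \<le> t"
        unfolding t_eq(1) using j h by (intro mult_right_mono of_nat_mono) auto
      then have "(\<integral>\<^sup>+x. indicator {\<rho><..} x * indicator {a<..b} (x + y) \<partial>step_law (real j * h)) \<le>
          ennreal (real j * h) * \<kappa>"
        using j h by (intro upper) auto
      then show "(\<integral>\<^sup>+x. indicator {\<rho><..} x * indicator {a<..b} (x + y) \<partial>W.walk_law j) \<le>
          of_nat j * (ennreal h * \<kappa>)"
        using h by (simp add: walk_law_eq[OF h, folded step_law_def] ennreal_mult ennreal_of_nat_eq_real_of_nat mult.assoc)
    next
      fix k :: nat and y :: real assume k: "k \<le> 2 ^ q" and y: "2 * \<rho> < y"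
      have "real k * h \<le> real (2 ^ q) * h"
        using k h by (intro mult_right_mono of_nat_mono) auto
      also have "\<dots> \<le> \<tau>"
        using \<tau> unfolding t_eq(2) .
      finally have "real k * h \<le> \<tau>" .
      have in_range: "real j * h \<in> {0..\<tau>}" if "j \<le> k" for j
      proof -
        have "real j * h \<le> real k * h"
          using that h by (intro mult_right_mono of_nat_mono) auto
        then have "real j * h \<le> \<tau>"
          using \<open>real k * h \<le> \<tau>\<close> by (rule order_trans)
        moreover have "0 \<le> real j * h" using h by simp
        ultimately show ?thesis by (simp only: atLeastAtMost_iff)
      qed
      have "{\<omega> \<in> space M. \<forall>j\<le>k. - y < X (real j * h) \<omega>} \<in> events"
        using rv_grid[OF h, measurable] by measurable
      then have "prob {\<omega> \<in> space M. \<forall>s\<in>{0..\<tau>}. - X s \<omega> \<le> \<epsilon>} \<le> prob {\<omega> \<in> space M. \<forall>j\<le>k. - y < X (real j * h) \<omega>}"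
      proof (rule finite_measure_mono[rotated], intro subsetI)
        fix \<omega> assume \<omega>: "\<omega> \<in> {\<omega> \<in> space M. \<forall>s\<in>{0..\<tau>}. - X s \<omega> \<le> \<epsilon>}"
        have "- y < X (real j * h) \<omega>" if "j \<le> k" for j
        proof -
          have "- X (real j * h) \<omega> \<le> \<epsilon>" using \<omega> in_range[OF that] by blast
          then show ?thesis using y \<rho> by simp
        qed
        then show "\<omega> \<in> {\<omega> \<in> space M. \<forall>j\<le>k. - y < X (real j * h) \<omega>}"
          using \<omega> by blast
      qed
      then have "ennreal (1 / 2) \<le> prob {\<omega> \<in> space M. \<forall>j\<le>k. - y < X (real j * h) \<omega>}"
        using small by (intro ennreal_leI) simp
      then show "1 / 2 \<le> W.stay k y"
        using W.min_law_le_stay[of k y] unfolding min_law_greater[OF h] ennreal_half by (rule order_trans)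
    qed (use \<rho> in auto)
    also have "\<dots> = ennreal (real (N + 3) * t) * \<kappa>"
    proof -
      have "real (N + 3) * t = real (N * (N * 2 ^ q + 3 * 2 ^ q)) * h"
        unfolding t_eq(1) by (simp add: algebra_simps)
      then show ?thesis
        using h by (simp only: ennreal_mult[OF of_nat_0_le_iff less_imp_le] ennreal_of_nat_eq_real_of_nat mult.assoc)
    qed
    finally show ?thesis by (simp only: h_def)
  qed
  show ?thesis
    by (rule LIMSEQ_le_const2[OF running_sup_Ioc_tendsto[OF t N \<open>a \<le> b\<close>]]) (use bound in auto)
qed


text \<open>An early position \<open>y\<close> between 0 and \<open>x\<^sub>0 / 2\<close> leaves a
  displacement \<open>x - y\<close>, which still exceeds \<open>x\<^sub>0 / 2\<close>. There the
  lower bound for the density applies, and (M) gives that \<open>\<nu> (x - y)\<close> is at least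
  \<open>\<nu> x / c\<^sub>M\<close>.\<close>

theorem running_sup_density_lower:
  assumes p: "\<And>t. 0 < t \<Longrightarrow> has_density_on (distr M borel (X t)) {0..} (p t)"
    and \<nu>: "has_density_on \<Lambda> {0<..} \<nu>"
    and f: "\<And>t. 0 < t \<Longrightarrow> has_density_on (distr M borel (running_sup X t)) {0<..} (f t)"
    and mono: "cond_M \<nu>"
    and lower: "unif_est (\<lambda>c t x. p t x \<ge> c * t * \<nu> x)"
  shows "unif_est (\<lambda>c t x. f t x \<ge> c * t * \<nu> x)"
  unfolding unif_est_def
proof (intro allI impI)
  fix x\<^sub>0 t\<^sub>0 :: real assume x\<^sub>0: "0 < x\<^sub>0" and t\<^sub>0: "0 < t\<^sub>0"
  obtain c where c: "0 < c"
    and p_lower: "\<And>t. 0 < t \<Longrightarrow> t < t\<^sub>0 \<Longrightarrow> AE x in lborel. x > x\<^sub>0 / 2 \<longrightarrow> p t x \<ge> c * t * \<nu> x"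
    using lower[unfolded unif_est_def, rule_format, of "x\<^sub>0 / 2" t\<^sub>0] x\<^sub>0 t\<^sub>0 by auto
  obtain c\<^sub>M' where "0 < c\<^sub>M'" and c\<^sub>M': "\<And>x y. x\<^sub>0 / 2 < x \<Longrightarrow> x < y \<Longrightarrow> \<nu> y \<le> c\<^sub>M' * \<nu> x"
    using mono[unfolded cond_M_def, rule_format, of "x\<^sub>0 / 2"] x\<^sub>0 by auto
  obtain \<nu>' where [measurable]: "\<nu>' \<in> borel_measurable borel" and \<nu>'_nonneg: "\<And>x. 0 \<le> \<nu>' x"
    and \<nu>': "\<And>x. 0 < x \<Longrightarrow> \<nu>' x = \<nu> x"
    using \<nu> by (rule has_density_onE) auto
  \<comment> \<open>The maximum with 1 covers \<open>x = y\<close>, on which (M) is silent; it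
    occurs for a zero shift.\<close>
  define c\<^sub>M where "c\<^sub>M = max 1 c\<^sub>M'"
  have c\<^sub>M_pos: "0 < c\<^sub>M" by (simp add: c\<^sub>M_def)
  have c\<^sub>M: "\<nu>' y \<le> c\<^sub>M * \<nu>' x" if "x\<^sub>0 / 2 < x" "x \<le> y" for x y
  proof (cases "x = y")
    case True
    then show ?thesis
      using mult_right_mono[of 1 c\<^sub>M "\<nu>' x"] \<nu>'_nonneg[of x] by (simp add: c\<^sub>M_def)
  next
    case False
    then have "\<nu>' y \<le> c\<^sub>M' * \<nu>' x"
      using c\<^sub>M'[of x y] that x\<^sub>0 \<nu>'[of x] \<nu>'[of y] by simp
    also have "\<dots> \<le> c\<^sub>M * \<nu>' x"
      using \<nu>'_nonneg[of x] by (intro mult_right_mono) (auto simp: c\<^sub>M_def)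
    finally show ?thesis .
  qed
  obtain \<tau> where \<tau>: "0 < \<tau>" "1 / 2 \<le> prob {\<omega> \<in> space M. \<forall>s\<in>{0..\<tau>}. X s \<omega> \<le> x\<^sub>0 / 2}"
    using small_time[OF random_variable_X right_continuous_paths start_at_zero, of "x\<^sub>0 / 2"] x\<^sub>0 by auto
  obtain N :: nat where N: "4 \<le> N" "t\<^sub>0 / real N \<le> \<tau>"
  proof -
    obtain k :: nat where "t\<^sub>0 / \<tau> < real k" using reals_Archimedean2 by blast
    then have "t\<^sub>0 / \<tau> \<le> real (max 4 k)" by simp
    then show thesis using \<tau> that[of "max 4 k"] by (simp add: field_simps)
  qed
  \<comment> \<open>The 4 is the constant of the walk bound. As \<open>N\<close> is chosen for
    \<open>t\<^sub>0\<close>, the block length \<open>t / N\<close> is at most \<open>\<tau>\<close>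
    for all \<open>t < t\<^sub>0\<close>, and \<open>C\<close> does not depend on
    \<open>t\<close>.\<close>
  define C where "C = c / (c\<^sub>M * (4 * real N))"
  have C: "0 < C" using c c\<^sub>M_pos N by (simp add: C_def)
  have "AE x in lborel. x > x\<^sub>0 \<longrightarrow> f t x \<ge> C * t * \<nu> x" if t: "0 < t" "t < t\<^sub>0" for t
  proof -
    obtain f' where [measurable]: "f' \<in> borel_measurable borel" and f'_nonneg: "\<And>x. 0 \<le> f' x"
      and f': "\<And>x. 0 < x \<Longrightarrow> f' x = f t x"
      and f'_density: "\<And>B. B \<in> sets borel \<Longrightarrow> B \<subseteq> {0<..} \<Longrightarrow>
        emeasure (distr M borel (running_sup X t)) B = (\<integral>\<^sup>+x\<in>B. ennreal (f' x) \<partial>lborel)"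
      using f[OF t(1)] by (rule has_density_onE) auto
    have Ioc: "(\<integral>\<^sup>+x\<in>{a<..b}. ennreal (C * t * \<nu>' x) \<partial>lborel) \<le> (\<integral>\<^sup>+x\<in>{a<..b}. ennreal (f' x) \<partial>lborel)"
      if ab: "x\<^sub>0 \<le> a" "a < b" for a b
    proof -
      define \<kappa> where "\<kappa> = ennreal (c / c\<^sub>M) * (\<integral>\<^sup>+x\<in>{a<..b}. ennreal (\<nu>' x) \<partial>lborel)"
      have "ennreal (t / real N) * \<kappa> \<le> 4 * emeasure (distr M borel (running_sup X t)) {a<..b}"
      proof (rule running_sup_lower_bound)
        fix s y assume s: "0 < s" "s \<le> t" and y: "0 \<le> y" "y \<le> x\<^sub>0 / 2"
        obtain p' where [measurable]: "p' \<in> borel_measurable borel" and p'_nonneg: "\<And>x. 0 \<le> p' x"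
          and p': "\<And>x. 0 \<le> x \<Longrightarrow> p' x = p s x"
          and p'_density: "\<And>B. B \<in> sets borel \<Longrightarrow> B \<subseteq> {0..} \<Longrightarrow>
            emeasure (distr M borel (X s)) B = (\<integral>\<^sup>+x\<in>B. ennreal (p' x) \<partial>lborel)"
          using p[OF s(1)] by (rule has_density_onE) auto
        have [measurable]: "{x. x + y \<in> {a<..b}} \<in> sets borel" by measurable
        have "ennreal s * \<kappa> = (\<integral>\<^sup>+x. ennreal (s * (c / c\<^sub>M) * \<nu>' x) * indicator {a<..b} x \<partial>lborel)"
        proof -
          have "ennreal (s * (c / c\<^sub>M) * \<nu>' x) = ennreal s * (ennreal (c / c\<^sub>M) * ennreal (\<nu>' x))" for x
            using s c c\<^sub>M_pos \<nu>'_nonneg[of x]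
            by (simp only: ennreal_mult[symmetric] mult.assoc divide_nonneg_nonneg mult_nonneg_nonneg less_imp_le)
          then show ?thesis
            unfolding \<kappa>_def by (simp only: mult.assoc) (simp add: nn_integral_cmult)
        qed
        also have "\<dots> \<le> (\<integral>\<^sup>+x. ennreal (c * s * \<nu>' (x - y)) * indicator {a<..b} x \<partial>lborel)"
        proof (intro nn_integral_mono)
          fix x
          have "s * (c / c\<^sub>M) * \<nu>' x \<le> c * s * \<nu>' (x - y)" if "x \<in> {a<..b}"
            using mult_left_mono[OF c\<^sub>M[of "x - y" x], of "c * s / c\<^sub>M"] that ab y x\<^sub>0 s c c\<^sub>M_pos
            by (simp add: field_simps)
          then show "ennreal (s * (c / c\<^sub>M) * \<nu>' x) * indicator {a<..b} x \<le>
              ennreal (c * s * \<nu>' (x - y)) * indicator {a<..b} x"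
            by (auto simp: indicator_def intro: ennreal_leI)
        qed
        also have "\<dots> = (\<integral>\<^sup>+x. ennreal (c * s * \<nu>' x) * indicator {a<..b} (x + y) \<partial>lborel)"
          using nn_integral_real_affine[of "\<lambda>x. ennreal (c * s * \<nu>' (x - y)) * indicator {a<..b} x" 1 y]
          by (simp add: add.commute)
        also have "\<dots> \<le> (\<integral>\<^sup>+x. ennreal (p' x) * indicator {x. x + y \<in> {a<..b}} x \<partial>lborel)"
        proof (rule nn_integral_mono_AE)
          have "AE x in lborel. x > x\<^sub>0 / 2 \<longrightarrow> p s x \<ge> c * s * \<nu> x"
            using s t by (intro p_lower) auto
          then show "AE x in lborel. ennreal (c * s * \<nu>' x) * indicator {a<..b} (x + y) \<le>
              ennreal (p' x) * indicator {x. x + y \<in> {a<..b}} x"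
          proof eventually_elim
            case (elim x)
            have "c * s * \<nu>' x \<le> p' x" if "x + y \<in> {a<..b}"
              using elim that ab y x\<^sub>0 \<nu>'[of x] p'[of x] by simp
            then show ?case by (auto simp: indicator_def intro: ennreal_leI)
          qed
        qed
        also have "\<dots> = emeasure (distr M borel (X s)) {x. x + y \<in> {a<..b}}"
          using ab y x\<^sub>0 by (intro p'_density[symmetric]) auto
        also have "\<dots> = (\<integral>\<^sup>+x. indicator {x. x + y \<in> {a<..b}} x \<partial>step_law s)"
          unfolding step_law_def by simp
        also have "\<dots> = (\<integral>\<^sup>+x. indicator {0<..} x * indicator {a<..b} (x + y) \<partial>step_law s)"
          using ab y x\<^sub>0 by (intro nn_integral_cong) (auto simp: indicator_def)
        finally show "ennreal s * \<kappa> \<le> (\<integral>\<^sup>+x. indicator {0<..} x * indicator {a<..b} (x + y) \<partial>step_law s)" .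
      next
        have "t / real N \<le> t\<^sub>0 / real N" using t by (intro divide_right_mono) auto
        then show "t / real N \<le> \<tau>" using N(2) by simp
      qed (use t N \<tau> ab in auto)
      then have "ennreal (1 / 4) * (ennreal (t / real N) * \<kappa>) \<le>
          ennreal (1 / 4) * (4 * emeasure (distr M borel (running_sup X t)) {a<..b})"
        by (rule mult_left_mono) simp
      also have "\<dots> = emeasure (distr M borel (running_sup X t)) {a<..b}"
      proof -
        have "ennreal (1 / 4) * 4 = ennreal (1 / 4 * 4)"
          by (subst ennreal_mult) auto
        then show ?thesis by (simp add: mult.assoc[symmetric])
      qed
      also have "\<dots> = (\<integral>\<^sup>+x\<in>{a<..b}. ennreal (f' x) \<partial>lborel)"
        using ab x\<^sub>0 by (intro f'_density) auto
      also have "ennreal (1 / 4) * (ennreal (t / real N) * \<kappa>) =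
          ennreal (1 / 4 * (t / real N) * (c / c\<^sub>M)) * (\<integral>\<^sup>+x\<in>{a<..b}. ennreal (\<nu>' x) \<partial>lborel)"
        unfolding \<kappa>_def using t c c\<^sub>M_pos by (simp only: ennreal_mult' mult.assoc divide_nonneg_nonneg
            of_nat_0_le_iff less_imp_le zero_le_numeral zero_le_one mult_nonneg_nonneg)
      also have "1 / 4 * (t / real N) * (c / c\<^sub>M) = C * t"
        by (simp add: C_def mult_ac)
      also have "ennreal (C * t) * (\<integral>\<^sup>+x\<in>{a<..b}. ennreal (\<nu>' x) \<partial>lborel) =
          (\<integral>\<^sup>+x\<in>{a<..b}. ennreal (C * t * \<nu>' x) \<partial>lborel)"
      proof -
        have "ennreal (C * t * \<nu>' x) = ennreal (C * t) * ennreal (\<nu>' x)" for x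
          using t C \<nu>'_nonneg[of x] by (intro ennreal_mult) auto
        then show ?thesis
          by (simp only: mult.assoc[of "ennreal (C * t)"]) (simp add: nn_integral_cmult)
      qed
      finally show ?thesis .
    qed
    have "AE x in lborel. x\<^sub>0 < x \<longrightarrow> x \<le> real n \<longrightarrow> ennreal (C * t * \<nu>' x) \<le> ennreal (f' x)" for n :: nat
    proof (rule AE_le_on_of_nn_integral_Ioc_le)
      have "(\<integral>\<^sup>+x\<in>{x\<^sub>0<..real n}. ennreal (f' x) \<partial>lborel) =
          emeasure (distr M borel (running_sup X t)) {x\<^sub>0<..real n}"
        using x\<^sub>0 by (intro f'_density[symmetric]) auto
      also have "\<dots> < \<top>"
        using prob_space.finite_measure[OF prob_space_distr[OF rv_running_sup[OF t(1)]]]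
        by (simp add: finite_measure.emeasure_finite less_top[symmetric])
      finally show "(\<integral>\<^sup>+x\<in>{x\<^sub>0<..real n}. ennreal (f' x) \<partial>lborel) < \<top>" .
    qed (use Ioc in auto)
    then have "AE x in lborel. \<forall>n::nat. x\<^sub>0 < x \<longrightarrow> x \<le> real n \<longrightarrow> ennreal (C * t * \<nu>' x) \<le> ennreal (f' x)"
      unfolding AE_all_countable by blast
    then show ?thesis
    proof eventually_elim
      case (elim x)
      show ?case
      proof
        assume x: "x\<^sub>0 < x"
        obtain n :: nat where "x \<le> real n" using real_arch_simple by blast
        with elim x have "ennreal (C * t * \<nu>' x) \<le> ennreal (f' x)" by blast
        then have "C * t * \<nu>' x \<le> f' x" using f'_nonneg[of x] by (simp add: ennreal_le_iff)
        then show "C * t * \<nu> x \<le> f t x" using \<nu>'[of x] f'[of x] x x\<^sub>0 by simp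
      qed
    qed
  qed
  with C show "\<exists>c>0. \<forall>t. 0 < t \<and> t < t\<^sub>0 \<longrightarrow> (AE x in lborel. x > x\<^sub>0 \<longrightarrow> f t x \<ge> c * t * \<nu> x)"
    by blast
qed

text \<open>On \<open>(r, 2 * r]\<close> the density is compared with a constant: displacements
  above \<open>r / 8\<close> have density at most \<open>c * s * c\<^sub>M * \<nu> (r / 8)\<close>
  by (M). Four applications of (D) lead from \<open>r / 8\<close> to \<open>2 * r\<close>, and (M)
  leads from there to \<open>x < 2 * r\<close>.\<close>

theorem running_sup_density_upper:
  assumes p: "\<And>t. 0 < t \<Longrightarrow> has_density_on (distr M borel (X t)) {0..} (p t)"
    and \<nu>_nonneg: "\<And>x. 0 < x \<Longrightarrow> 0 \<le> \<nu> x"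
    and f: "\<And>t. 0 < t \<Longrightarrow> has_density_on (distr M borel (running_sup X t)) {0<..} (f t)"
    and mono: "cond_M \<nu>" and doubling: "cond_D \<nu>"
    and upper: "unif_est (\<lambda>c t x. p t x \<le> c * t * \<nu> x)"
  shows "unif_est (\<lambda>c t x. f t x \<le> c * t * \<nu> x)"
  unfolding unif_est_def
proof (intro allI impI)
  fix x\<^sub>0 t\<^sub>0 :: real assume x\<^sub>0: "0 < x\<^sub>0" and t\<^sub>0: "0 < t\<^sub>0"
  obtain c where c: "0 < c"
    and p_upper: "\<And>t. 0 < t \<Longrightarrow> t < t\<^sub>0 \<Longrightarrow> AE x in lborel. x > x\<^sub>0 / 8 \<longrightarrow> p t x \<le> c * t * \<nu> x"
    using upper[unfolded unif_est_def, rule_format, of "x\<^sub>0 / 8" t\<^sub>0] x\<^sub>0 t\<^sub>0 by auto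
  \<comment> \<open>The bound \<open>x\<^sub>0 / 16\<close> lies strictly below \<open>r / 8\<close>
    for all \<open>r \<ge> x\<^sub>0\<close>, so (M) and (D) apply at \<open>r / 8\<close> even for
    \<open>r = x\<^sub>0\<close>.\<close>
  obtain c\<^sub>M where c\<^sub>M_pos: "0 < c\<^sub>M" and c\<^sub>M: "\<And>x y. x\<^sub>0 / 16 < x \<Longrightarrow> x < y \<Longrightarrow> \<nu> y \<le> c\<^sub>M * \<nu> x"
    using mono[unfolded cond_M_def, rule_format, of "x\<^sub>0 / 16"] x\<^sub>0 by auto
  obtain c\<^sub>D where c\<^sub>D_pos: "0 < c\<^sub>D" and c\<^sub>D: "\<And>x. x\<^sub>0 / 16 < x \<Longrightarrow> \<nu> x \<le> c\<^sub>D * \<nu> (2 * x)"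
    using doubling[unfolded cond_D_def, rule_format, of "x\<^sub>0 / 16"] x\<^sub>0 by auto
  have c\<^sub>D_16: "\<nu> x \<le> c\<^sub>D ^ 4 * \<nu> (16 * x)" if x: "x\<^sub>0 / 16 < x" for x
  proof -
    have "\<nu> x \<le> c\<^sub>D * \<nu> (2 * x)" by (rule c\<^sub>D) fact
    also have "\<dots> \<le> c\<^sub>D * (c\<^sub>D * \<nu> (2 * (2 * x)))"
      using x x\<^sub>0 c\<^sub>D_pos by (intro mult_left_mono c\<^sub>D) auto
    also have "\<dots> \<le> c\<^sub>D * (c\<^sub>D * (c\<^sub>D * \<nu> (2 * (2 * (2 * x)))))"
      using x x\<^sub>0 c\<^sub>D_pos by (intro mult_left_mono c\<^sub>D) auto
    also have "\<dots> \<le> c\<^sub>D * (c\<^sub>D * (c\<^sub>D * (c\<^sub>D * \<nu> (2 * (2 * (2 * (2 * x)))))))"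
      using x x\<^sub>0 c\<^sub>D_pos by (intro mult_left_mono c\<^sub>D) auto
    finally show ?thesis by (simp add: power4_eq_xxxx mult.assoc)
  qed
  have "AE \<omega> in M. - X 0 \<omega> = 0" using start_at_zero by eventually_elim simp
  note minus_zero = this
  \<comment> \<open>The level \<open>x\<^sub>0 / 8\<close> is at most \<open>r / 8\<close> for all
    \<open>r \<ge> x\<^sub>0\<close>. Hence \<open>\<tau>\<close>, and with it \<open>N\<close>,
    serve all \<open>r\<close> and \<open>t\<close> at once.\<close>
  have "\<exists>\<tau>>0. 1 / 2 \<le> prob {\<omega> \<in> space M. \<forall>s\<in>{0..\<tau>}. - X s \<omega> \<le> x\<^sub>0 / 8}"
  proof (rule small_time[OF _ right_continuous_minus_paths minus_zero, of "x\<^sub>0 / 8"])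
    show "random_variable borel (\<lambda>\<omega>. - X t \<omega>)" if "0 \<le> t" for t
      using random_variable_X[OF that] by measurable
  qed (use x\<^sub>0 in auto)
  then obtain \<tau> where \<tau>: "0 < \<tau>" "1 / 2 \<le> prob {\<omega> \<in> space M. \<forall>s\<in>{0..\<tau>}. - X s \<omega> \<le> x\<^sub>0 / 8}"
    by blast
  obtain N :: nat where N: "0 < N" "t\<^sub>0 / real N \<le> \<tau>"
  proof -
    obtain k :: nat where "t\<^sub>0 / \<tau> < real k" using reals_Archimedean2 by blast
    then have "t\<^sub>0 / \<tau> \<le> real (max 1 k)" by simp
    then show thesis using \<tau> that[of "max 1 k"] by (simp add: field_simps)
  qed
  \<comment> \<open>\<open>N + 3\<close> comes from the blocks, \<open>c * c\<^sub>M\<close> from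
    the density bound at \<open>r / 8\<close>, and \<open>c\<^sub>D ^ 4 * c\<^sub>M\<close> from the
    way back from \<open>r / 8\<close> to \<open>x\<close>.\<close>
  define C where "C = real (N + 3) * (c * c\<^sub>M * (c\<^sub>D ^ 4 * c\<^sub>M))"
  have "AE x in lborel. x > x\<^sub>0 \<longrightarrow> f t x \<le> C * t * \<nu> x" if t: "0 < t" "t < t\<^sub>0" for t
  proof -
    obtain f' where [measurable]: "f' \<in> borel_measurable borel" and f'_nonneg: "\<And>x. 0 \<le> f' x"
      and f': "\<And>x. 0 < x \<Longrightarrow> f' x = f t x"
      and f'_density: "\<And>B. B \<in> sets borel \<Longrightarrow> B \<subseteq> {0<..} \<Longrightarrow>
        emeasure (distr M borel (running_sup X t)) B = (\<integral>\<^sup>+x\<in>B. ennreal (f' x) \<partial>lborel)"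
      using f[OF t(1)] by (rule has_density_onE) auto
    have local_bound: "AE x in lborel. r < x \<longrightarrow> x \<le> 2 * r \<longrightarrow> ennreal (f' x) \<le> ennreal (real (N + 3) * t * (c * c\<^sub>M * \<nu> (r / 8)))"
      if r: "x\<^sub>0 \<le> r" for r
    proof (rule AE_le_on_of_nn_integral_Ioc_le)
      let ?K = "c * c\<^sub>M * \<nu> (r / 8)"
      have K: "0 \<le> ?K" using c c\<^sub>M_pos \<nu>_nonneg[of "r / 8"] r x\<^sub>0 by simp
      show "(\<integral>\<^sup>+x\<in>{r<..2 * r}. ennreal (real (N + 3) * t * ?K) \<partial>lborel) < \<top>"
        using r x\<^sub>0 by (simp add: nn_integral_cmult_indicator ennreal_mult_less_top)
      fix a b assume ab: "r \<le> a" "a < b" "b \<le> 2 * r"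
      define \<kappa> where "\<kappa> = ennreal ?K * emeasure lborel {a<..b}"
      have "emeasure (distr M borel (running_sup X t)) {a<..b} \<le> ennreal (real (N + 3) * t) * \<kappa>"
      proof (rule running_sup_upper_bound[where \<rho> = "r / 8" and \<epsilon> = "x\<^sub>0 / 8"])
        fix s y assume s: "0 < s" "s \<le> t"
        obtain p' where [measurable]: "p' \<in> borel_measurable borel" and p'_nonneg: "\<And>x. 0 \<le> p' x"
          and p': "\<And>x. 0 \<le> x \<Longrightarrow> p' x = p s x"
          and p'_density: "\<And>B. B \<in> sets borel \<Longrightarrow> B \<subseteq> {0..} \<Longrightarrow>
            emeasure (distr M borel (X s)) B = (\<integral>\<^sup>+x\<in>B. ennreal (p' x) \<partial>lborel)"
          using p[OF s(1)] by (rule has_density_onE) auto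
        let ?B = "{x. r / 8 < x \<and> x + y \<in> {a<..b}}"
        have [measurable]: "?B \<in> sets borel" by measurable
        have "(\<integral>\<^sup>+x. indicator {r / 8<..} x * indicator {a<..b} (x + y) \<partial>step_law s) =
            (\<integral>\<^sup>+x. indicator ?B x \<partial>step_law s)"
          by (intro nn_integral_cong) (auto simp: indicator_def)
        also have "\<dots> = emeasure (distr M borel (X s)) ?B"
          unfolding step_law_def by simp
        also have "\<dots> = (\<integral>\<^sup>+x. ennreal (p' x) * indicator ?B x \<partial>lborel)"
          using r x\<^sub>0 by (intro p'_density) auto
        also have "\<dots> \<le> (\<integral>\<^sup>+x. ennreal (s * ?K) * indicator {a<..b} (x + y) \<partial>lborel)"
        proof (rule nn_integral_mono_AE)
          have bound: "p' x \<le> s * ?K" if "x > x\<^sub>0 / 8 \<longrightarrow> p s x \<le> c * s * \<nu> x" "x \<in> ?B" for x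
          proof -
            have "p' x \<le> c * s * \<nu> x"
              using that r x\<^sub>0 p'[of x] by simp
            also have "\<dots> \<le> c * s * (c\<^sub>M * \<nu> (r / 8))"
              using that r x\<^sub>0 c s by (intro mult_left_mono c\<^sub>M) auto
            finally show ?thesis by (simp add: mult_ac)
          qed
          have "AE x in lborel. x > x\<^sub>0 / 8 \<longrightarrow> p s x \<le> c * s * \<nu> x"
            using s t by (intro p_upper) auto
          then show "AE x in lborel. ennreal (p' x) * indicator ?B x \<le>
              ennreal (s * ?K) * indicator {a<..b} (x + y)"
          proof eventually_elim
            case (elim x)
            show ?case using bound[OF elim]
              by (cases "x \<in> ?B") (auto intro: ennreal_leI)
          qed
        qed
        also have "\<dots> = (\<integral>\<^sup>+x. ennreal (s * ?K) * indicator {a<..b} x \<partial>lborel)"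
          using nn_integral_real_affine[of "\<lambda>x. ennreal (s * ?K) * indicator {a<..b} x" 1 y]
          by (simp add: add.commute)
        also have "\<dots> = ennreal s * \<kappa>"
        proof -
          have "ennreal (s * ?K) = ennreal s * ennreal ?K"
            using s K by (intro ennreal_mult) auto
          moreover have "(\<integral>\<^sup>+x. ennreal (s * ?K) * indicator {a<..b} x \<partial>lborel) = ennreal (s * ?K) * emeasure lborel {a<..b}"
            by (rule nn_integral_cmult_indicator) simp
          ultimately show ?thesis
            unfolding \<kappa>_def by (simp only: mult.assoc)
        qed
        finally show "(\<integral>\<^sup>+x. indicator {r / 8<..} x * indicator {a<..b} (x + y) \<partial>step_law s) \<le> ennreal s * \<kappa>" .
      next
        have "t / real N \<le> t\<^sub>0 / real N" using t by (intro divide_right_mono) auto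
        then show "t / real N \<le> \<tau>" using N(2) by simp
      qed (use t N \<tau> ab r x\<^sub>0 in auto)
      then have "(\<integral>\<^sup>+x\<in>{a<..b}. ennreal (f' x) \<partial>lborel) \<le> ennreal (real (N + 3) * t) * \<kappa>"
        using ab r x\<^sub>0 by (subst f'_density[symmetric]) auto
      also have "\<dots> = (\<integral>\<^sup>+x\<in>{a<..b}. ennreal (real (N + 3) * t * ?K) \<partial>lborel)"
      proof -
        have "ennreal (real (N + 3) * t * ?K) = ennreal (real (N + 3) * t) * ennreal ?K"
          using t K by (intro ennreal_mult) auto
        then show ?thesis
          unfolding \<kappa>_def by (subst nn_integral_cmult_indicator) (simp_all only: mult.assoc sets_lborel greaterThanAtMost_borel)
      qed
      finally show "(\<integral>\<^sup>+x\<in>{a<..b}. ennreal (f' x) \<partial>lborel) \<le>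
          (\<integral>\<^sup>+x\<in>{a<..b}. ennreal (real (N + 3) * t * ?K) \<partial>lborel)" .
    qed auto
    \<comment> \<open>The null set in \<open>local_bound\<close> depends on \<open>r\<close>, so
      only countably many \<open>r\<close> may be used. A rational one between
      \<open>max x\<^sub>0 (x / 2)\<close> and \<open>x\<close> always exists.\<close>
    have "AE x in lborel. \<forall>r::rat. x\<^sub>0 \<le> of_rat r \<longrightarrow> of_rat r < x \<longrightarrow> x \<le> 2 * of_rat r \<longrightarrow>
        ennreal (f' x) \<le> ennreal (real (N + 3) * t * (c * c\<^sub>M * \<nu> (of_rat r / 8)))"
      unfolding AE_all_countable
    proof
      fix r :: rat
      show "AE x in lborel. x\<^sub>0 \<le> of_rat r \<longrightarrow> of_rat r < x \<longrightarrow> x \<le> 2 * of_rat r \<longrightarrow>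
        ennreal (f' x) \<le> ennreal (real (N + 3) * t * (c * c\<^sub>M * \<nu> (of_rat r / 8)))"
        using local_bound[of "of_rat r"] by (cases "x\<^sub>0 \<le> of_rat r") auto
    qed
    then show ?thesis
    proof eventually_elim
      case (elim x)
      show ?case
      proof
        assume x: "x\<^sub>0 < x"
        obtain r where r: "max x\<^sub>0 (x / 2) < of_rat r" "of_rat r < x"
          using of_rat_dense[of "max x\<^sub>0 (x / 2)" x] x x\<^sub>0 by auto
        let ?r = "of_rat r :: real"
        have "\<nu> (?r / 8) \<le> c\<^sub>D ^ 4 * \<nu> (16 * (?r / 8))"
          using r x\<^sub>0 by (intro c\<^sub>D_16) auto
        also have "\<dots> \<le> c\<^sub>D ^ 4 * (c\<^sub>M * \<nu> x)"
          using r x\<^sub>0 c\<^sub>D_pos by (intro mult_left_mono c\<^sub>M) auto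
        finally have \<nu>_le: "\<nu> (?r / 8) \<le> c\<^sub>D ^ 4 * (c\<^sub>M * \<nu> x)" .
        have "ennreal (f' x) \<le> ennreal (real (N + 3) * t * (c * c\<^sub>M * \<nu> (?r / 8)))"
          using elim r by auto
        then have "f' x \<le> real (N + 3) * t * (c * c\<^sub>M * \<nu> (?r / 8))"
        proof (subst (asm) ennreal_le_iff)
          have "0 < ?r / 8" using r x\<^sub>0 by linarith
          then show "0 \<le> real (N + 3) * t * (c * c\<^sub>M * \<nu> (?r / 8))"
            using t c c\<^sub>M_pos \<nu>_nonneg by (intro mult_nonneg_nonneg) auto
        qed
        also have "\<dots> \<le> real (N + 3) * t * (c * c\<^sub>M * (c\<^sub>D ^ 4 * (c\<^sub>M * \<nu> x)))"
          using t c c\<^sub>M_pos \<nu>_le by (intro mult_left_mono) auto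
        also have "\<dots> = C * t * \<nu> x"
          by (simp add: C_def mult_ac)
        finally show "f t x \<le> C * t * \<nu> x" using f'[of x] x x\<^sub>0 by simp
      qed
    qed
  qed
  moreover have "0 < C" using c c\<^sub>M_pos c\<^sub>D_pos by (simp add: C_def)
  ultimately show "\<exists>c>0. \<forall>t. 0 < t \<and> t < t\<^sub>0 \<longrightarrow> (AE x in lborel. x > x\<^sub>0 \<longrightarrow> f t x \<le> c * t * \<nu> x)"
    by blast
qed

end

section \<open>The three comparison statements\<close>

theorem theorem3p5:
  fixes M :: "'a measure" and X :: "real \<Rightarrow> 'a \<Rightarrow> real"
    and \<Lambda> :: "real measure" and \<nu> :: "real \<Rightarrow> real"
    and p f :: "real \<Rightarrow> real \<Rightarrow> real"
  assumes "levy_process M X"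
    and "\<not> compound_poisson_process M X"
    and "\<not> subordinator M (\<lambda>t \<omega>. \<bar>X t \<omega>\<bar>)"
    and "\<And>t. t > 0 \<Longrightarrow> has_density_on (distr M borel (X t)) {0..} (p t)"
    and "is_levy_measure M X \<Lambda>"
    and "has_density_on \<Lambda> {0<..} \<nu>"
    and "\<And>t. t > 0 \<Longrightarrow> has_density_on (distr M borel (running_sup X t)) {0<..} (f t)"
  shows "(cond_M \<nu> \<longrightarrow>
            unif_est (\<lambda>c t x. p t x \<ge> c * t * \<nu> x) \<longrightarrow>
            unif_est (\<lambda>c t x. f t x \<ge> c * t * \<nu> x)) \<and>
         (cond_M \<nu> \<and> cond_D \<nu> \<longrightarrow>
            unif_est (\<lambda>c t x. p t x \<le> c * t * \<nu> x) \<longrightarrow>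
            unif_est (\<lambda>c t x. f t x \<le> c * t * \<nu> x)) \<and>
         (cond_M \<nu> \<and> cond_D \<nu> \<longrightarrow>
            unif_est (\<lambda>c t x. inverse c * t * \<nu> x \<le> p t x \<and> p t x \<le> c * t * \<nu> x) \<longrightarrow>
            unif_est (\<lambda>c t x. inverse c * p t x \<le> f t x \<and> f t x \<le> c * p t x \<and>
                              inverse c * t * \<nu> x \<le> p t x \<and> p t x \<le> c * t * \<nu> x))"
proof -
  interpret levy_process M X by fact
  have \<nu>_nonneg: "0 \<le> \<nu> x" if "0 < x" for x
    using assms(6) that by (simp add: has_density_on_def)
  have lower: "unif_est (\<lambda>c t x. f t x \<ge> c * t * \<nu> x)"
    if "cond_M \<nu>" "unif_est (\<lambda>c t x. p t x \<ge> c * t * \<nu> x)"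
    using running_sup_density_lower[OF assms(4,6,7) that] .
  have upper: "unif_est (\<lambda>c t x. f t x \<le> c * t * \<nu> x)"
    if "cond_M \<nu>" "cond_D \<nu>" "unif_est (\<lambda>c t x. p t x \<le> c * t * \<nu> x)"
    using running_sup_density_upper[OF assms(4) \<nu>_nonneg assms(7) that] .
  have "unif_est (\<lambda>c t x. inverse c * p t x \<le> f t x \<and> f t x \<le> c * p t x \<and>
      inverse c * t * \<nu> x \<le> p t x \<and> p t x \<le> c * t * \<nu> x)"
    if M: "cond_M \<nu>" and D: "cond_D \<nu>"
      and both: "unif_est (\<lambda>c t x. inverse c * t * \<nu> x \<le> p t x \<and> p t x \<le> c * t * \<nu> x)"
  proof -
    have "unif_est (\<lambda>c t x. p t x \<ge> c * t * \<nu> x)"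
      unfolding unif_est_def
    proof (intro allI impI)
      fix x\<^sub>0 t\<^sub>0 :: real assume "0 < x\<^sub>0" "0 < t\<^sub>0"
      then obtain c where "0 < c" and c: "\<And>t. 0 < t \<and> t < t\<^sub>0 \<Longrightarrow>
          AE x in lborel. x\<^sub>0 < x \<longrightarrow> inverse c * t * \<nu> x \<le> p t x \<and> p t x \<le> c * t * \<nu> x"
        using both unfolding unif_est_def by meson
      show "\<exists>c>0. \<forall>t. 0 < t \<and> t < t\<^sub>0 \<longrightarrow> (AE x in lborel. x\<^sub>0 < x \<longrightarrow> c * t * \<nu> x \<le> p t x)"
      proof (intro exI[of _ "inverse c"] conjI allI impI)
        fix t assume "0 < t \<and> t < t\<^sub>0"
        from c[OF this] show "AE x in lborel. x\<^sub>0 < x \<longrightarrow> inverse c * t * \<nu> x \<le> p t x"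
          by eventually_elim blast
      qed (use \<open>0 < c\<close> in simp)
    qed
    note f_lower = lower[OF M this]
    have "unif_est (\<lambda>c t x. p t x \<le> c * t * \<nu> x)"
      unfolding unif_est_def
    proof (intro allI impI)
      fix x\<^sub>0 t\<^sub>0 :: real assume "0 < x\<^sub>0" "0 < t\<^sub>0"
      then obtain c where "0 < c" and c: "\<And>t. 0 < t \<and> t < t\<^sub>0 \<Longrightarrow>
          AE x in lborel. x\<^sub>0 < x \<longrightarrow> inverse c * t * \<nu> x \<le> p t x \<and> p t x \<le> c * t * \<nu> x"
        using both unfolding unif_est_def by meson
      show "\<exists>c>0. \<forall>t. 0 < t \<and> t < t\<^sub>0 \<longrightarrow> (AE x in lborel. x\<^sub>0 < x \<longrightarrow> p t x \<le> c * t * \<nu> x)"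
      proof (intro exI[of _ c] conjI allI impI)
        fix t assume "0 < t \<and> t < t\<^sub>0"
        from c[OF this] show "AE x in lborel. x\<^sub>0 < x \<longrightarrow> p t x \<le> c * t * \<nu> x"
          by eventually_elim blast
      qed fact
    qed
    note f_upper = upper[OF M D this]
    show ?thesis
      unfolding unif_est_def
    proof (intro allI impI)
      fix x\<^sub>0 t\<^sub>0 :: real assume x\<^sub>0: "0 < x\<^sub>0" and t\<^sub>0: "0 < t\<^sub>0"
      obtain c where "0 < c" and c: "\<And>t. 0 < t \<and> t < t\<^sub>0 \<Longrightarrow>
          AE x in lborel. x\<^sub>0 < x \<longrightarrow> inverse c * t * \<nu> x \<le> p t x \<and> p t x \<le> c * t * \<nu> x"
        using both x\<^sub>0 t\<^sub>0 unfolding unif_est_def by meson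
      obtain l where "0 < l" and l: "\<And>t. 0 < t \<and> t < t\<^sub>0 \<Longrightarrow> AE x in lborel. x\<^sub>0 < x \<longrightarrow> l * t * \<nu> x \<le> f t x"
        using f_lower x\<^sub>0 t\<^sub>0 unfolding unif_est_def by meson
      obtain u where "0 < u" and u: "\<And>t. 0 < t \<and> t < t\<^sub>0 \<Longrightarrow> AE x in lborel. x\<^sub>0 < x \<longrightarrow> f t x \<le> u * t * \<nu> x"
        using f_upper x\<^sub>0 t\<^sub>0 unfolding unif_est_def by meson
      \<comment> \<open>\<open>c / l\<close> comes from chaining the upper estimate of
        \<open>p\<close> with the lower one of \<open>f\<close>, and \<open>u * c\<close> from
        chaining the upper estimate of \<open>f\<close> with the lower one of
        \<open>p\<close>.\<close>
      define C where "C = max c (max (c / l) (u * c))"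
      have C: "0 < C" "c \<le> C" "c / l \<le> C" "u * c \<le> C"
        using \<open>0 < c\<close> by (auto simp: C_def)
      have "inverse C * p t x \<le> f t x \<and> f t x \<le> C * p t x \<and> inverse C * t * \<nu> x \<le> p t x \<and> p t x \<le> C * t * \<nu> x"
        if t: "0 < t" and x: "0 < x" and cx: "inverse c * t * \<nu> x \<le> p t x" "p t x \<le> c * t * \<nu> x"
          and lx: "l * t * \<nu> x \<le> f t x" and ux: "f t x \<le> u * t * \<nu> x" for t x
      proof (intro conjI)
        have y: "0 \<le> t * \<nu> x" using t \<nu>_nonneg[OF x] by simp
        \<comment> \<open>Nonnegativity of \<open>p t x\<close> allows constants to be enlarged; it
          comes from the lower estimate and \<open>\<nu> \<ge> 0\<close>.\<close>
        then have px: "0 \<le> p t x"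
          using cx(1) \<open>0 < c\<close> by (smt (verit) inverse_nonnegative_iff_nonnegative mult.assoc mult_nonneg_nonneg)
        have "inverse C \<le> l / c"
          using le_imp_inverse_le[OF C(3)] \<open>0 < c\<close> \<open>0 < l\<close> by simp
        then have "inverse C * p t x \<le> l / c * (c * t * \<nu> x)"
          using cx(2) px \<open>0 < c\<close> \<open>0 < l\<close> by (intro mult_mono) auto
        then show "inverse C * p t x \<le> f t x"
          using lx \<open>0 < c\<close> by simp
        have "t * \<nu> x \<le> c * p t x"
        proof -
          have "c * (inverse c * t * \<nu> x) = t * \<nu> x"
            using \<open>0 < c\<close> by simp
          then show ?thesis
            using mult_left_mono[OF cx(1) less_imp_le[OF \<open>0 < c\<close>]] by (simp only:)
        qed
        then have "u * (t * \<nu> x) \<le> u * (c * p t x)"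
          using \<open>0 < u\<close> by simp
        also have "\<dots> \<le> C * p t x"
          using mult_right_mono[OF C(4) px] by (simp add: mult.assoc)
        finally show "f t x \<le> C * p t x"
          using ux by (simp add: mult.assoc)
        have "inverse C \<le> inverse c"
          using C(2) \<open>0 < c\<close> by (rule le_imp_inverse_le)
        then have "inverse C * (t * \<nu> x) \<le> inverse c * (t * \<nu> x)"
          using y by (rule mult_right_mono)
        then show "inverse C * t * \<nu> x \<le> p t x"
          using cx(1) by (simp add: mult.assoc)
        show "p t x \<le> C * t * \<nu> x"
          using cx(2) mult_right_mono[OF C(2) y] by (simp add: mult.assoc)
      qed
      note est = this
      show "\<exists>c>0. \<forall>t. 0 < t \<and> t < t\<^sub>0 \<longrightarrow> (AE x in lborel. x\<^sub>0 < x \<longrightarrow>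
          inverse c * p t x \<le> f t x \<and> f t x \<le> c * p t x \<and> inverse c * t * \<nu> x \<le> p t x \<and> p t x \<le> c * t * \<nu> x)"
      proof (intro exI[of _ C] conjI[OF C(1)] allI impI)
        fix t assume t: "0 < t \<and> t < t\<^sub>0"
        show "AE x in lborel. x\<^sub>0 < x \<longrightarrow>
          inverse C * p t x \<le> f t x \<and> f t x \<le> C * p t x \<and> inverse C * t * \<nu> x \<le> p t x \<and> p t x \<le> C * t * \<nu> x"
          using c[OF t] l[OF t] u[OF t]
        proof eventually_elim
          case (elim x)
          show ?case
          proof
            assume "x\<^sub>0 < x"
            then show "inverse C * p t x \<le> f t x \<and> f t x \<le> C * p t x \<and>
                inverse C * t * \<nu> x \<le> p t x \<and> p t x \<le> C * t * \<nu> x"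
              using elim t x\<^sub>0 by (intro est) auto
          qed
        qed
      qed
    qed
  qed
  with lower upper show ?thesis by blast
qed

end
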